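(* For $\mathbb P$-almost every environment $\omega$, $$\sum_{n\ge 0}p^\omega_n(x,x)<\infty\qquad\text{for every }x\in\mathbb Z^2 .$$
   Context: Let $e_1,e_2$ be the standard basis of $\mathbb Z^2$. The environment is a function $\omega\colon\mathbb Z^2\times\{1,2\}\to\{-1,1\}$ such that $\omega(z,i)$ is constant along each line parallel to $e_i$ (i.e. $\omega(z+e_i,i)=\omega(z,i)$ for all $z$); $\omega(z,i)$ is the orientation of the line through $z$ parallel to $e_i$. Under the law $\mathbb P$ the orientations of all horizontal lines ($i=1$) and all vertical lines ($i=2$) are independent and uniform on $\{-1,1\}$ (one fair coin per line). For fixed $\omega$, the discrete-time walk on $\mathbb Z^2$ is the Markov chain which from $z$ steps to $z+\omega(z,1)e_1$ or to $z+\omega(z,2)e_2$, with probability $1/2$ each. $p^\omega_n(z,z')$ denotes the probability that this chain, started at $z$, is at $z'$ after $n$ steps. *)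

theory Defs
  imports "HOL-Probability.Probability"
begin

type_synonym site = "int \<times> int"

text \<open>The index set \<open>{1,2}\<close> of the coordinate directions: \<open>Hor\<close> stands for \<open>1\<close>, \<open>Ver\<close> for \<open>2\<close>.\<close>

datatype direction = Hor | Ver

type_synonym environment = "site \<times> direction \<Rightarrow> int"

fun basis_vec :: "direction \<Rightarrow> site" where
  "basis_vec Hor = (1, 0)"
| "basis_vec Ver = (0, 1)"

definition smult_site :: "int \<Rightarrow> site \<Rightarrow> site" where
  "smult_site c z = (c * fst z, c * snd z)"

definition environments :: "environment set" where
  "environments = {\<omega>. (\<forall>z i. \<omega> (z, i) \<in> {-1, 1}) \<and>
                      (\<forall>z i. \<omega> (z + basis_vec i, i) = \<omega> (z, i))}"

definition env_space :: "environment measure" where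
  "env_space = restrict_space (Pi\<^sub>M UNIV (\<lambda>_. count_space {-1, 1})) environments"

text \<open>A line parallel to a coordinate axis is represented by its direction and the value of
  the coordinate that is constant along it.\<close>

type_synonym line = "direction \<times> int"

fun line_through :: "site \<times> direction \<Rightarrow> line" where
  "line_through ((a, b), Hor) = (Hor, b)"
| "line_through ((a, b), Ver) = (Ver, a)"

definition coin_law :: "(line \<Rightarrow> int) measure" where
  "coin_law = Pi\<^sub>M UNIV (\<lambda>_. uniform_count_measure {-1, 1})"

definition env_of_coins :: "(line \<Rightarrow> int) \<Rightarrow> environment" where
  "env_of_coins c = (\<lambda>(z, i). c (line_through (z, i)))"

definition env_law :: "environment measure" where
  "env_law = distr coin_law env_space env_of_coins"

definition walk_step :: "environment \<Rightarrow> site \<Rightarrow> site pmf" where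
  "walk_step \<omega> z =
     map_pmf (\<lambda>i. z + smult_site (\<omega> (z, i)) (basis_vec i)) (pmf_of_set {Hor, Ver})"

fun walk :: "environment \<Rightarrow> nat \<Rightarrow> site \<Rightarrow> site pmf" where
  "walk \<omega> 0 z = return_pmf z"
| "walk \<omega> (Suc n) z = bind_pmf (walk \<omega> n z) (walk_step \<omega>)"

definition trans_prob :: "environment \<Rightarrow> nat \<Rightarrow> site \<Rightarrow> site \<Rightarrow> real" where
  "trans_prob \<omega> n z z' = pmf (walk \<omega> n z) z'"

lemma space_env_space: "space env_space = environments"
  by (auto simp: env_space_def space_restrict_space space_PiM environments_def PiE_def Pi_def)

lemma prob_space_coin_law: "prob_space coin_law"
  unfolding coin_law_def by (intro prob_space_PiM prob_space_uniform_count_measure) auto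

lemma space_coin_law: "space coin_law = {c. \<forall>l. c l \<in> {-1, 1}}"
  by (auto simp: coin_law_def space_PiM space_uniform_count_measure PiE_def Pi_def)

lemma env_of_coins_in_environments:
  assumes "\<And>l. c l \<in> {-1, 1}" shows "env_of_coins c \<in> environments"
proof -
  have "line_through (z + basis_vec i, i) = line_through (z, i)" for z i
    by (cases z; cases i) auto
  then show ?thesis using assms by (auto simp: environments_def env_of_coins_def)
qed

lemma coin_component_measurable:
  "(\<lambda>c. c l) \<in> measurable coin_law (count_space {-1, 1})"
proof -
  have "(\<lambda>c. c l) \<in> measurable coin_law (uniform_count_measure {-1, 1})"
    unfolding coin_law_def by (rule measurable_component_singleton) simp
  also have "measurable coin_law (uniform_count_measure {-1, 1 :: int})
      = measurable coin_law (count_space {-1, 1})"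
    by (intro measurable_cong_sets refl sets_uniform_count_measure_count_space)
  finally show ?thesis .
qed

lemma env_of_coins_measurable: "env_of_coins \<in> measurable coin_law env_space"
  unfolding env_space_def
proof (rule measurable_restrict_space2)
  show "env_of_coins \<in> space coin_law \<rightarrow> environments"
    using env_of_coins_in_environments by (auto simp: space_coin_law)
  show "env_of_coins \<in> measurable coin_law (Pi\<^sub>M UNIV (\<lambda>_. count_space {-1, 1}))"
  proof (rule measurable_PiM_single')
    fix zi
    show "(\<lambda>c. env_of_coins c zi) \<in> measurable coin_law (count_space {-1, 1})"
      using coin_component_measurable[of "line_through zi"]
      by (cases zi) (simp add: env_of_coins_def)
  next
    show "env_of_coins \<in> space coin_law \<rightarrow> (UNIV \<rightarrow>\<^sub>E space (count_space {-1, 1}))"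
      unfolding env_of_coins_def space_coin_law PiE_UNIV_domain
      by (auto simp: Pi_def simp del: split_paired_All)
  qed
qed

lemma prob_space_env_law: "prob_space env_law"
  unfolding env_law_def
  by (intro prob_space.prob_space_distr prob_space_coin_law env_of_coins_measurable)

lemma space_env_law: "space env_law = environments"
  by (simp add: env_law_def space_env_space)

end

theory Submission
  imports Defs
begin

text \<open>
  Write \<open>\<epsilon> y\<close> and \<open>\<eta> x\<close> for the orientations of the horizontal and vertical lines. The
  walk is simple random walk perturbed by the divergence-free drift \<open>(\<epsilon> y, \<eta> x)\<close>. The drift is
  antisymmetric, so the Green function \<open>g\<close> killed at rate \<open>4\<^sup>-\<^sup>K\<close> has Dirichlet energy \<open>D \<le> 8 g(0)\<close>, and
  testing its equation with any function \<open>f\<close> bounds \<open>\<langle>f (\<epsilon>, \<eta>), \<nabla>g\<rangle>\<close> by the energy of \<open>f\<close>.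

  Compare \<open>g(0)\<close> with the averages of \<open>g\<close> over boxes of side \<open>2\<^sup>k\<close>. The difference of two
  consecutive averages is \<open>\<langle>u, \<nabla>g\<rangle>\<close> for a deterministic flow \<open>u\<close> of size \<open>2\<^sup>-\<^sup>k\<close>. The energy
  inequality alone loses a constant at each scale, which is the logarithmic divergence of planar
  simple random walk. Instead \<open>u\<close> is written as \<open>f (\<epsilon>, \<eta>)\<close> plus an error with small second
  moment. Since \<open>\<epsilon>\<^sup>2 = 1\<close>, multiplying \<open>u\<close> by \<open>\<epsilon>\<close> averaged over a wide window reproduces \<open>u\<close>
  after multiplication by \<open>\<epsilon>\<close>. The other component, a product of \<open>\<eta>\<close> with a smooth function, is
  removed by a second term at an intermediate scale. Averaging both windows over \<open>n\<close> dyadic scales,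
  \<open>n\<close> of order \<open>k\<close>, makes the squared error at scale \<open>2\<^sup>k\<close> of order \<open>k\<^sup>-\<^sup>3\<^sup>/\<^sup>2\<close>, which is summable.
  Errors at different scales are nearly orthogonal, so the expectation of \<open>g(0)\<close> is bounded
  uniformly in \<open>K\<close>.
\<close>

section \<open>Difference operators and window kernels\<close>

definition central_diff :: "(int \<Rightarrow> real) \<Rightarrow> int \<Rightarrow> real" where
  "central_diff h x = (h (x + 1) - h (x - 1)) / 2"

definition fwd_diff :: "(int \<Rightarrow> real) \<Rightarrow> int \<Rightarrow> real" where
  "fwd_diff h x = h (x + 1) - h x"

definition unif :: "nat \<Rightarrow> int \<Rightarrow> real" where
  "unif m d = (if 0 \<le> d \<and> d < 2 ^ m then 1 / 2 ^ m else 0)"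

text \<open>A primitive of \<open>\<delta> - unif m\<close>; see \<open>delta_eq_unif_prim\<close>.\<close>

definition unif_prim :: "nat \<Rightarrow> int \<Rightarrow> real" where
  "unif_prim m d = (if 0 \<le> d \<and> d < 2 ^ m then 1 - real_of_int (d + 1) / 2 ^ m else 0)"

text \<open>The floor makes the central difference of \<open>ramp m\<close> exactly \<open>unif m\<close>.\<close>

definition ramp :: "nat \<Rightarrow> int \<Rightarrow> real" where
  "ramp m d = max 0 (min 1 (2 * real_of_int ((d + 1) div 2) / 2 ^ m))"

definition trap :: "nat \<Rightarrow> int \<Rightarrow> real" where
  "trap m d = max 0 (min 1 (2 - real_of_int \<bar>d\<bar> / 2 ^ m))"

definition kernel_bound :: "(int \<Rightarrow> real) \<Rightarrow> real \<Rightarrow> real \<Rightarrow> bool" where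
  "kernel_bound U b c \<longleftrightarrow> (\<forall>d. \<bar>U d\<bar> \<le> b) \<and> (\<exists>J. finite J \<and> real (card J) \<le> c \<and> (\<forall>d. U d \<noteq> 0 \<longrightarrow> d \<in> J))"

lemma kernelI:
  assumes "\<And>d. \<bar>U d\<bar> \<le> b" "finite J" "real (card J) \<le> c" "\<And>d. U d \<noteq> 0 \<Longrightarrow> d \<in> J"
  shows "kernel_bound U b c"
  using assms unfolding kernel_bound_def by blast

lemma kernel_nonneg: "kernel_bound U b c \<Longrightarrow> 0 \<le> b \<and> 0 \<le> c"
  unfolding kernel_bound_def by (metis abs_ge_zero of_nat_0_le_iff order_trans)

lemma clamp_0: "a \<le> 0 \<Longrightarrow> max 0 (min 1 a) = 0" for a :: real
  by (simp add: max_def min_def)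

lemma delta_eq_unif_prim: "(if d = 0 then 1 else 0) = unif m d + unif_prim m d - unif_prim m (d - 1)"
proof -
  consider "d < 0" | "d = 0" | "0 < d \<and> d < 2 ^ m" | "d = 2 ^ m" | "d > 2 ^ m" by linarith
  then show ?thesis
    by cases (auto simp: unif_def unif_prim_def field_simps)
qed

lemma central_diff_ramp: "central_diff (ramp (Suc m)) d = unif (Suc m) d"
proof -
  define q where "q = d div 2"
  have e: "(d + 1 + 1) div 2 = q + 1" "(d - 1 + 1) div 2 = q" unfolding q_def by presburger+
  have r: "(0 \<le> d \<and> d < 2 ^ Suc m) \<longleftrightarrow> (0 \<le> q \<and> q < 2 ^ m)"
    unfolding q_def by (auto simp: div_less_iff_less_mult zdiv_mono1)
  have P: "(2::real)^m > 0" by simp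
  have "central_diff (ramp (Suc m)) d
      = (max 0 (min 1 (real_of_int (q + 1) / 2 ^ m)) - max 0 (min 1 (real_of_int q / 2 ^ m))) / 2"
    unfolding central_diff_def ramp_def e by (simp add: add_divide_distrib)
  also have "\<dots> = (if 0 \<le> q \<and> q < 2 ^ m then 1 / 2 ^ Suc m else 0)"
  proof -
    consider "q \<le> -1" | "0 \<le> q \<and> q < 2 ^ m" | "q \<ge> 2 ^ m" by linarith
    then show ?thesis
    proof cases
      case 1
      then have h: "real_of_int (q + 1) / 2 ^ m \<le> 0" "real_of_int q / 2 ^ m \<le> 0"
        by (auto simp: divide_le_0_iff)
      have "\<not> 0 \<le> q" using 1 by linarith
      then show ?thesis unfolding clamp_0[OF h(1)] clamp_0[OF h(2)] by simp
    next
      case 2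
      then have "real_of_int (q + 1) \<le> real_of_int (2 ^ m)" "real_of_int q \<le> real_of_int (2 ^ m)"
        "real_of_int 0 \<le> real_of_int q"
        by (simp_all only: of_int_le_iff) auto
      then have "real_of_int (q + 1) / 2 ^ m \<le> 1" "real_of_int q / 2 ^ m \<le> 1" "0 \<le> real_of_int q / 2 ^ m"
        "0 \<le> real_of_int (q + 1) / 2 ^ m"
        by (auto simp: divide_le_eq)
      with 2 show ?thesis by (simp add: max_def min_def field_simps)
    next
      case 3
      then have "real_of_int q \<ge> 2 ^ m" by (metis of_int_le_iff of_int_numeral of_int_power)
      moreover from this have "real_of_int (q + 1) \<ge> 2 ^ m" by linarith
      ultimately have "real_of_int (q + 1) / 2 ^ m \<ge> 1" "real_of_int q / 2 ^ m \<ge> 1"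
        by (simp_all only: le_divide_eq_1_pos zero_less_power zero_less_numeral)
      with 3 show ?thesis by (simp add: max_def min_def)
    qed
  qed
  finally show ?thesis using r by (simp add: unif_def)
qed

lemma ramp_nonneg: "0 \<le> ramp m d" and ramp_le_1: "ramp m d \<le> 1"
  by (auto simp: ramp_def)

lemma ramp_eq_0: "d \<le> 0 \<Longrightarrow> ramp m d = 0"
proof -
  assume "d \<le> 0"
  then have "(d + 1) div 2 \<le> 0" by linarith
  then have "2 * real_of_int ((d + 1) div 2) / 2 ^ m \<le> 0" by (simp add: divide_le_0_iff)
  then show ?thesis by (simp add: ramp_def)
qed

lemma ramp_eq_1: "d \<ge> 2 ^ m \<Longrightarrow> ramp m d = 1"
proof -
  assume "d \<ge> 2 ^ m"
  show ?thesis
  proof (cases m)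
    case 0
    with \<open>d \<ge> 2 ^ m\<close> have "d \<ge> 1" by simp
    then have "(d + 1) div 2 \<ge> 1" by linarith
    then have "2 * real_of_int ((d + 1) div 2) / 2 ^ m \<ge> 1" using 0 by simp
    then show ?thesis by (simp add: ramp_def)
  next
    case (Suc m')
    then have "(d + 1) div 2 \<ge> 2 ^ m'" using \<open>d \<ge> 2 ^ m\<close> by simp
    then have "real_of_int ((d + 1) div 2) \<ge> 2 ^ m'" by (metis of_int_le_iff of_int_numeral of_int_power)
    then have "2 * real_of_int ((d + 1) div 2) / 2 ^ m \<ge> 1" using Suc by (simp add: le_divide_eq)
    then show ?thesis by (simp add: ramp_def)
  qed
qed

lemma clamp_lipschitz: "\<bar>max 0 (min 1 a) - max 0 (min 1 b)\<bar> \<le> \<bar>a - b\<bar>" for a b :: real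
  by (auto simp: max_def min_def abs_if)

lemma fwd_diff_ramp: "\<bar>fwd_diff (ramp m) d\<bar> \<le> 2 / 2 ^ m"
proof -
  have "\<bar>real_of_int ((d + 1 + 1) div 2) - real_of_int ((d + 1) div 2)\<bar> \<le> 1"
  proof -
    have "(d + 1 + 1) div 2 - (d + 1) div 2 \<in> {0, 1}" by simp presburger
    then show ?thesis by (auto simp flip: of_int_diff)
  qed
  then have "\<bar>2 * real_of_int ((d + 1 + 1) div 2) / 2 ^ m - 2 * real_of_int ((d + 1) div 2) / 2 ^ m\<bar> \<le> 2 / 2 ^ m"
    by (simp add: field_simps flip: diff_divide_distrib abs_divide)
  then show ?thesis unfolding fwd_diff_def ramp_def
    using clamp_lipschitz order_trans by blast
qed

lemma kernel_unif: "kernel_bound (unif m) (1 / 2 ^ m) (2 ^ m)"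
  by (rule kernelI[where J="{0..<2 ^ m}"]) (auto simp: unif_def split: if_splits)

lemma kernel_unif_prim: "kernel_bound (unif_prim m) 1 (2 ^ m)"
proof (rule kernelI[where J="{0..<2 ^ m}"])
  fix d
  show "\<bar>unif_prim m d\<bar> \<le> 1"
  proof (cases "0 \<le> d \<and> d < 2 ^ m")
    case True
    then have "real_of_int (d + 1) \<le> 2 ^ m"
      by (metis add1_zle_eq of_int_le_iff of_int_numeral of_int_power)
    then show ?thesis using True by (auto simp: unif_prim_def field_simps)
  qed (auto simp: unif_prim_def)
qed (auto simp: unif_prim_def split: if_splits)

definition ramp_diff :: "nat \<Rightarrow> nat \<Rightarrow> int \<Rightarrow> real" where
  "ramp_diff m m' d = ramp m d - ramp m' d"

lemma ramp_diff_support: "m \<le> m' \<Longrightarrow> ramp_diff m m' d \<noteq> 0 \<Longrightarrow> 1 \<le> d \<and> d < 2 ^ m'"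
proof (rule ccontr)
  assume a: "m \<le> m'" "ramp_diff m m' d \<noteq> 0" "\<not> (1 \<le> d \<and> d < 2 ^ m')"
  then consider "d \<le> 0" | "d \<ge> 2 ^ m'" by linarith
  then show False
  proof cases
    case 1 then show False using a by (simp add: ramp_diff_def ramp_eq_0)
  next
    case 2
    have "(2::int) ^ m \<le> 2 ^ m'" using a by simp
    then have "d \<ge> 2 ^ m" using 2 by linarith
    then show False using a 2 by (simp add: ramp_diff_def ramp_eq_1)
  qed
qed

lemma kernel_ramp_diff: "m \<le> m' \<Longrightarrow> kernel_bound (ramp_diff m m') 1 (2 ^ m')"
proof (rule kernelI[where J="{0..<2 ^ m'}"])
  fix d show "\<bar>ramp_diff m m' d\<bar> \<le> 1"
    using ramp_nonneg[of m d] ramp_le_1[of m d] ramp_nonneg[of m' d] ramp_le_1[of m' d]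
    by (simp add: ramp_diff_def)
qed (use ramp_diff_support in \<open>auto dest!: ramp_diff_support\<close>)

lemma central_diff_ramp_diff:
  "0 < m \<Longrightarrow> 0 < m' \<Longrightarrow> central_diff (ramp_diff m m') d = unif m d - unif m' d"
proof -
  assume "0 < m" "0 < m'"
  then obtain a b where "m = Suc a" "m' = Suc b" by (meson gr0_implies_Suc)
  then have "unif m d - unif m' d = central_diff (ramp m) d - central_diff (ramp m') d"
    by (simp add: central_diff_ramp)
  then show ?thesis by (simp add: central_diff_def ramp_diff_def field_simps)
qed

lemma kernel_fwd_diff_ramp_diff:
  "m \<le> m' \<Longrightarrow> kernel_bound (fwd_diff (ramp_diff m m')) (4 / 2 ^ m) (2 * 2 ^ m')"
proof (rule kernelI[where J="{0..<2 ^ m'}"])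
  assume mm: "m \<le> m'"
  fix d 
  have "(2::real) / 2 ^ m' \<le> 2 / 2 ^ m" using mm by (simp add: frac_le)
  then show "\<bar>fwd_diff (ramp_diff m m') d\<bar> \<le> 4 / 2 ^ m"
    using fwd_diff_ramp[of m d] fwd_diff_ramp[of m' d]
    by (simp add: fwd_diff_def ramp_diff_def)
next
  assume mm: "m \<le> m'"
  fix d assume "fwd_diff (ramp_diff m m') d \<noteq> 0"
  then have "ramp_diff m m' (d + 1) \<noteq> 0 \<or> ramp_diff m m' d \<noteq> 0" by (auto simp: fwd_diff_def)
  then show "d \<in> {0..<2 ^ m'}" using ramp_diff_support[OF mm] by force
qed auto

lemma kernel_central_diff_ramp_diff:
  "0 < m \<Longrightarrow> m \<le> m' \<Longrightarrow> kernel_bound (central_diff (ramp_diff m m')) (1 / 2 ^ m) (2 ^ m')"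
proof (rule kernelI[where J="{0..<2 ^ m'}"])
  assume m: "0 < m" "m \<le> m'"
  fix d
  have "unif m d \<le> 1 / 2 ^ m" "unif m' d \<le> 1 / 2 ^ m'" "0 \<le> unif m d" "0 \<le> unif m' d" by (auto simp: unif_def)
  moreover have "(1::real) / 2 ^ m' \<le> 1 / 2 ^ m" using m by (simp add: frac_le)
  ultimately show "\<bar>central_diff (ramp_diff m m') d\<bar> \<le> 1 / 2 ^ m" using m by (simp add: central_diff_ramp_diff)
next
  assume m: "0 < m" "m \<le> m'"
  have le: "(2::int) ^ m \<le> 2 ^ m'" using m by simp
  fix d assume "central_diff (ramp_diff m m') d \<noteq> 0"
  then have "unif m d \<noteq> 0 \<or> unif m' d \<noteq> 0" using m by (auto simp: central_diff_ramp_diff)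
  then have "0 \<le> d \<and> (d < 2 ^ m \<or> d < 2 ^ m')" by (auto simp: unif_def split: if_splits)
  then show "d \<in> {0..<2 ^ m'}" using le by (metis atLeastLessThan_iff order_less_le_trans)
qed auto

lemma trap_nonneg: "0 \<le> trap m d" and trap_le_1: "trap m d \<le> 1" by (auto simp: trap_def)

lemma trap_eq_1: "\<bar>d\<bar> \<le> 2 ^ m \<Longrightarrow> trap m d = 1"
proof -
  assume "\<bar>d\<bar> \<le> 2 ^ m"
  then have "real_of_int \<bar>d\<bar> \<le> 2 ^ m" by (metis of_int_le_iff of_int_numeral of_int_power)
  then have "2 - real_of_int \<bar>d\<bar> / 2 ^ m \<ge> 1" by (simp add: field_simps)
  then show ?thesis by (simp add: trap_def)
qed

lemma trap_eq_0: "\<bar>d\<bar> \<ge> 2 * 2 ^ m \<Longrightarrow> trap m d = 0"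
proof -
  assume "\<bar>d\<bar> \<ge> 2 * 2 ^ m"
  then have "real_of_int \<bar>d\<bar> \<ge> real_of_int (2 * 2 ^ m)" by (simp only: of_int_le_iff)
  then have "2 - real_of_int \<bar>d\<bar> / 2 ^ m \<le> 0" by (simp add: field_simps)
  then show ?thesis by (simp add: trap_def)
qed

lemma fwd_diff_trap: "\<bar>fwd_diff (trap m) d\<bar> \<le> 1 / 2 ^ m"
proof -
  have "\<bar>\<bar>real_of_int d + 1\<bar> - \<bar>real_of_int d\<bar>\<bar> \<le> 1" by linarith
  then have "\<bar>\<bar>real_of_int d + 1\<bar> - \<bar>real_of_int d\<bar>\<bar> / 2 ^ m \<le> 1 / 2 ^ m"
    by (simp add: divide_right_mono)
  moreover have "(2 - real_of_int \<bar>d + 1\<bar> / 2 ^ m) - (2 - real_of_int \<bar>d\<bar> / 2 ^ m)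
      = - ((\<bar>real_of_int d + 1\<bar> - \<bar>real_of_int d\<bar>) / 2 ^ m)"
    by (simp add: diff_divide_distrib)
  ultimately have "\<bar>(2 - real_of_int \<bar>d + 1\<bar> / 2 ^ m) - (2 - real_of_int \<bar>d\<bar> / 2 ^ m)\<bar> \<le> 1 / 2 ^ m"
    by simp
  then show ?thesis unfolding fwd_diff_def trap_def using clamp_lipschitz order_trans by blast
qed

lemma fwd_diff_trap_support: "fwd_diff (trap m) d \<noteq> 0 \<Longrightarrow> 2 ^ m \<le> \<bar>d\<bar> + 1 \<and> \<bar>d\<bar> \<le> 2 * 2 ^ m"
proof (rule ccontr)
  assume a: "fwd_diff (trap m) d \<noteq> 0" "\<not> (2 ^ m \<le> \<bar>d\<bar> + 1 \<and> \<bar>d\<bar> \<le> 2 * 2 ^ m)"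
  then consider "\<bar>d\<bar> + 1 < 2 ^ m" | "\<bar>d\<bar> > 2 * 2 ^ m" by linarith
  then show False
  proof cases
    case 1 then have "\<bar>d\<bar> \<le> 2 ^ m" "\<bar>d + 1\<bar> \<le> 2 ^ m" by auto
    then show False using a by (simp add: fwd_diff_def trap_eq_1)
  next
    case 2 then have "\<bar>d\<bar> \<ge> 2 * 2 ^ m" "\<bar>d + 1\<bar> \<ge> 2 * 2 ^ m" by auto
    then show False using a by (simp add: fwd_diff_def trap_eq_0)
  qed
qed

lemma central_diff_fwd: "central_diff h d = (fwd_diff h d + fwd_diff h (d - 1)) / 2"
  by (simp add: central_diff_def fwd_diff_def)

lemma central_diff_trap_support: "central_diff (trap m) d \<noteq> 0 \<Longrightarrow> 2 ^ m \<le> \<bar>d\<bar> + 1 \<and> \<bar>d\<bar> \<le> 2 * 2 ^ m"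
proof (rule ccontr)
  assume a: "central_diff (trap m) d \<noteq> 0" "\<not> (2 ^ m \<le> \<bar>d\<bar> + 1 \<and> \<bar>d\<bar> \<le> 2 * 2 ^ m)"
  then consider "\<bar>d\<bar> + 1 < 2 ^ m" | "\<bar>d\<bar> > 2 * 2 ^ m" by linarith
  then show False
  proof cases
    case 1 then have "\<bar>d - 1\<bar> \<le> 2 ^ m" "\<bar>d + 1\<bar> \<le> 2 ^ m" by auto
    then show False using a by (simp add: central_diff_def trap_eq_1)
  next
    case 2 then have "\<bar>d - 1\<bar> \<ge> 2 * 2 ^ m" "\<bar>d + 1\<bar> \<ge> 2 * 2 ^ m" by auto
    then show False using a by (simp add: central_diff_def trap_eq_0)
  qed
qed

lemma kernel_trap: "kernel_bound (trap m) 1 (4 * 2 ^ m)"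
proof (rule kernelI[where J="{- (2 * 2 ^ m)<..<2 * 2 ^ m}"])
  have "card {- (2 * 2 ^ m)<..<(2::int) * 2 ^ m} = nat (4 * 2 ^ m - 1)" by simp
  then show "real (card {- (2 * 2 ^ m)<..<(2::int) * 2 ^ m}) \<le> 4 * 2 ^ m" by simp
  fix d assume "trap m d \<noteq> 0"
  then show "d \<in> {- (2 * 2 ^ m)<..<2 * 2 ^ m}" using trap_eq_0[of m d] by force
qed (use trap_nonneg trap_le_1 in \<open>auto simp: abs_le_iff intro: order_trans[of _ 0]\<close>)

lemma card_symmetric: "real (card {- (2 * 2 ^ m)..(2::int) * 2 ^ m}) \<le> 5 * 2 ^ m"
proof -
  have "(1::real) \<le> 2 ^ m" by simp
  moreover have "real (card {- (2 * 2 ^ m)..(2::int) * 2 ^ m}) = 4 * 2 ^ m + 1" by simp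
  ultimately show ?thesis by linarith
qed

lemma kernel_fwd_diff_trap: "kernel_bound (fwd_diff (trap m)) (1 / 2 ^ m) (5 * 2 ^ m)"
  by (rule kernelI[where J="{- (2 * 2 ^ m)..2 * 2 ^ m}", OF fwd_diff_trap _ card_symmetric])
     (auto dest!: fwd_diff_trap_support)

lemma kernel_central_diff_trap: "kernel_bound (central_diff (trap m)) (1 / 2 ^ m) (5 * 2 ^ m)"
proof (rule kernelI[where J="{- (2 * 2 ^ m)..2 * 2 ^ m}", OF _ _ card_symmetric])
  show "\<bar>central_diff (trap m) d\<bar> \<le> 1 / 2 ^ m" for d
    using fwd_diff_trap[of m d] fwd_diff_trap[of m "d - 1"] by (simp add: central_diff_fwd)
qed (auto dest!: central_diff_trap_support)

definition second_diff :: "(int \<Rightarrow> real) \<Rightarrow> int \<Rightarrow> real" where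
  "second_diff h x = h (x + 1) - 2 * h x + h (x - 1)"

lemma second_diff_fwd: "second_diff h d = fwd_diff h d - fwd_diff h (d - 1)"
  by (simp add: second_diff_def fwd_diff_def)

lemma second_diff_trap: "\<bar>second_diff (trap m) d\<bar> \<le> 2 / 2 ^ m"
  using fwd_diff_trap[of m d] fwd_diff_trap[of m "d - 1"] by (simp add: second_diff_fwd)

lemma second_diff_trap_support: 
  "second_diff (trap m) d \<noteq> 0 \<Longrightarrow> d \<in> {2 ^ m, - (2 ^ m), 2 * 2 ^ m, - (2 * 2 ^ m)}"
proof (rule ccontr)
  assume a: "second_diff (trap m) d \<noteq> 0" "d \<notin> {2 ^ m, - (2 ^ m), 2 * 2 ^ m, - (2 * 2 ^ m)}"
  have p: "(1::int) \<le> 2 ^ m" by simp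
  have ar: "a + b = 2 * c \<Longrightarrow> 2 - a - 2 * (2 - c) + (2 - b) = 0" for a b c :: real
    by (simp add: algebra_simps)
  have "d \<noteq> 2 ^ m" "d \<noteq> - (2 ^ m)" "d \<noteq> 2 * 2 ^ m" "d \<noteq> - (2 * 2 ^ m)" using a(2) by blast+
  then have "\<bar>d\<bar> \<noteq> 2 ^ m" "\<bar>d\<bar> \<noteq> 2 * 2 ^ m" by (auto simp: abs_if)
  then consider "\<bar>d\<bar> + 1 \<le> 2 ^ m" | "\<bar>d\<bar> - 1 \<ge> 2 * 2 ^ m" | "2 ^ m \<le> \<bar>d\<bar> - 1 \<and> \<bar>d\<bar> + 1 \<le> 2 * 2 ^ m"
    by linarith
  then show False
  proof cases
    case 1 then have "\<bar>d - 1\<bar> \<le> 2 ^ m" "\<bar>d + 1\<bar> \<le> 2 ^ m" "\<bar>d\<bar> \<le> 2 ^ m" by auto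
    then show False using a by (simp add: second_diff_def trap_eq_1)
  next
    case 2 then have "\<bar>d - 1\<bar> \<ge> 2 * 2 ^ m" "\<bar>d + 1\<bar> \<ge> 2 * 2 ^ m" "\<bar>d\<bar> \<ge> 2 * 2 ^ m" by auto
    then show False using a by (simp add: second_diff_def trap_eq_0)
  next
    case 3
    have lin: "trap m e = 2 - real_of_int \<bar>e\<bar> / 2 ^ m" if "2 ^ m \<le> \<bar>e\<bar>" "\<bar>e\<bar> \<le> 2 * 2 ^ m" for e
    proof -
      have "real_of_int (2 ^ m) \<le> real_of_int \<bar>e\<bar>" "real_of_int \<bar>e\<bar> \<le> real_of_int (2 * 2 ^ m)"
        using that by (simp_all only: of_int_le_iff)
      then have "2 - real_of_int \<bar>e\<bar> / 2 ^ m \<le> 1" "2 - real_of_int \<bar>e\<bar> / 2 ^ m \<ge> 0" by (auto simp: field_simps)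
      then show ?thesis by (simp add: trap_def)
    qed
    have b: "2 ^ m \<le> \<bar>d - 1\<bar>" "\<bar>d - 1\<bar> \<le> 2 * 2 ^ m" "2 ^ m \<le> \<bar>d + 1\<bar>" "\<bar>d + 1\<bar> \<le> 2 * 2 ^ m"
      "2 ^ m \<le> \<bar>d\<bar>" "\<bar>d\<bar> \<le> 2 * 2 ^ m" using 3 by auto
    have "\<bar>d + 1\<bar> + \<bar>d - 1\<bar> = 2 * \<bar>d\<bar>" using 3 p by auto
    then have "real_of_int \<bar>d + 1\<bar> + real_of_int \<bar>d - 1\<bar> = 2 * real_of_int \<bar>d\<bar>"
      by (metis of_int_add of_int_mult of_int_numeral)
    then have "real_of_int \<bar>d + 1\<bar> / 2 ^ m + real_of_int \<bar>d - 1\<bar> / 2 ^ m = 2 * (real_of_int \<bar>d\<bar> / 2 ^ m)"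
      by (simp only: add_divide_distrib[symmetric] times_divide_eq_right)
    then have "second_diff (trap m) d = 0"
      unfolding second_diff_def lin[OF b(1,2)] lin[OF b(3,4)] lin[OF b(5,6)]
      by (rule ar)
    then show False using a by simp
  qed
qed

lemma kernel_second_diff_trap_sum:
  assumes "finite T" "card T \<le> 3" "\<And>d. \<bar>U d\<bar> \<le> 2 / 2 ^ m"
    and "\<And>d. U d \<noteq> 0 \<Longrightarrow> \<exists>t\<in>T. second_diff (trap m) (d + t) \<noteq> 0"
  shows "kernel_bound U (2 / 2 ^ m) 12"
proof (rule kernelI[where J="\<Union>t\<in>T. (\<lambda>s. s - t) ` {2 ^ m, - (2 ^ m), 2 * 2 ^ m, - (2 * 2 ^ m)}"])
  let ?D = "{2 ^ m, - (2 ^ m), 2 * 2 ^ m, - (2 * 2 ^ m)} :: int set"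
  have "card ?D \<le> 4" using card_length[of "[2 ^ m, - (2 ^ m), 2 * 2 ^ m, - (2 * 2 ^ m) :: int]"] by simp
  then have c4: "card ((\<lambda>s. s - t) ` ?D) \<le> 4" for t
    using card_image_le[of ?D "\<lambda>s. s - t"] by (meson finite.emptyI finite.insertI order_trans)
  have "card (\<Union>t\<in>T. (\<lambda>s. s - t) ` ?D) \<le> (\<Sum>t\<in>T. card ((\<lambda>s. s - t) ` ?D))"
    by (rule card_UN_le[OF assms(1)])
  also have "\<dots> \<le> (\<Sum>t\<in>T. 4)" by (rule sum_mono) (rule c4)
  finally have "card (\<Union>t\<in>T. (\<lambda>s. s - t) ` ?D) \<le> (\<Sum>t\<in>T. 4)" .
  then show "real (card (\<Union>t\<in>T. (\<lambda>s. s - t) ` ?D)) \<le> 12" using assms(2) by simp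
  fix d assume "U d \<noteq> 0"
  then obtain t where "t \<in> T" "second_diff (trap m) (d + t) \<noteq> 0" using assms(4) by blast
  then show "d \<in> (\<Union>t\<in>T. (\<lambda>s. s - t) ` ?D)" 
    using second_diff_trap_support by (force intro!: bexI[of _ t] image_eqI[where x="d + t"])
qed (use assms in auto)

lemma kernel_central_central_diff_trap: "kernel_bound (central_diff (central_diff (trap m))) (2 / 2 ^ m) 12"
proof (rule kernel_second_diff_trap_sum[where T="{-1, 0, 1}"])
  have av: "\<bar>(a + 2 * b + a') / 4\<bar> \<le> c" if "\<bar>a\<bar> \<le> c" "\<bar>b\<bar> \<le> c" "\<bar>a'\<bar> \<le> c" for a a' b c :: real
    using that by (auto simp: abs_le_iff)
  fix d
  have eq: "central_diff (central_diff (trap m)) d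
      = (second_diff (trap m) (d + 1) + 2 * second_diff (trap m) d + second_diff (trap m) (d - 1)) / 4"
    by (simp add: central_diff_def second_diff_def field_simps)
  show "\<bar>central_diff (central_diff (trap m)) d\<bar> \<le> 2 / 2 ^ m"
    unfolding eq by (intro av second_diff_trap)
  show "\<exists>t\<in>{-1,0,1}. second_diff (trap m) (d + t) \<noteq> 0" if "central_diff (central_diff (trap m)) d \<noteq> 0"
    using that unfolding eq by auto
qed auto

lemma kernel_fwd_central_diff_trap: "kernel_bound (fwd_diff (central_diff (trap m))) (2 / 2 ^ m) 12"
proof (rule kernel_second_diff_trap_sum[where T="{0, 1}"])
  have av: "\<bar>(a + b) / 2\<bar> \<le> c" if "\<bar>a\<bar> \<le> c" "\<bar>b\<bar> \<le> c" for a b c :: real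
    using that by (auto simp: abs_le_iff)
  fix d
  have eq: "fwd_diff (central_diff (trap m)) d = (second_diff (trap m) (d + 1) + second_diff (trap m) d) / 2"
    by (simp add: fwd_diff_def central_diff_def second_diff_def field_simps)
  show "\<bar>fwd_diff (central_diff (trap m)) d\<bar> \<le> 2 / 2 ^ m"
    using av[OF second_diff_trap[of m "d + 1"] second_diff_trap[of m d]] unfolding eq .
  show "\<exists>t\<in>{0,1}. second_diff (trap m) (d + t) \<noteq> 0" if "fwd_diff (central_diff (trap m)) d \<noteq> 0"
    using that unfolding eq by auto
qed auto

definition conv :: "int set \<Rightarrow> (int \<Rightarrow> real) \<Rightarrow> (int \<Rightarrow> real) \<Rightarrow> int \<Rightarrow> real" where
  "conv \<Lambda> U c y = (\<Sum>t\<in>\<Lambda>. U (y - t) * c t)"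

lemma conv_diff: "conv \<Lambda> (\<lambda>d. U d - W d) c y = conv \<Lambda> U c y - conv \<Lambda> W c y"
  by (simp add: conv_def algebra_simps sum_subtractf)

lemma conv_cong: "(\<And>d. U d = W d) \<Longrightarrow> conv \<Lambda> U c y = conv \<Lambda> W c y"
  by (simp add: conv_def)

lemma central_diff_conv: "central_diff (conv \<Lambda> U c) y = conv \<Lambda> (central_diff U) c y"
  unfolding conv_def central_diff_def
  by (simp add: sum_subtractf[symmetric] sum_divide_distrib algebra_simps diff_divide_distrib)

lemma fwd_diff_conv: "fwd_diff (conv \<Lambda> U c) y = conv \<Lambda> (fwd_diff U) c y"
  unfolding conv_def fwd_diff_def
  by (simp add: sum_subtractf[symmetric] algebra_simps)

lemma conv_unif_decomp:
  assumes "finite \<Lambda>" "\<And>t. t \<notin> \<Lambda> \<Longrightarrow> c t = 0"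
  shows "c y = conv \<Lambda> (unif m) c y + (conv \<Lambda> (unif_prim m) c y - conv \<Lambda> (unif_prim m) c (y - 1))"
proof -
  have "c y = (\<Sum>t\<in>\<Lambda>. (if y - t = 0 then 1 else 0) * c t)"
  proof (cases "y \<in> \<Lambda>")
    case True
    have "(\<Sum>t\<in>\<Lambda>. (if y - t = 0 then 1 else 0) * c t) = (\<Sum>t\<in>\<Lambda>. if t = y then c t else 0)"
      by (rule sum.cong) auto
    with True assms(1) show ?thesis by simp
  next
    case False
    then have "(\<Sum>t\<in>\<Lambda>. (if y - t = 0 then 1 else 0) * c t) = 0" by (intro sum.neutral) auto
    with False assms(2) show ?thesis by simp
  qed
  then show ?thesis
    unfolding delta_eq_unif_prim[of _ m] conv_def
    by (simp add: sum.distrib[symmetric] sum_subtractf[symmetric] algebra_simps)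
qed

definition vanishes_outside :: "int \<Rightarrow> (int \<Rightarrow> real) \<Rightarrow> bool" where
  "vanishes_outside R h \<longleftrightarrow> (\<forall>t. \<bar>t\<bar> > R \<longrightarrow> h t = 0)"

lemma vanishes_outside_conv:
  assumes "vanishes_outside R c" "vanishes_outside w U" "R + w \<le> R'"
  shows "vanishes_outside R' (conv \<Lambda> U c)"
  unfolding vanishes_outside_def conv_def
proof (intro allI impI sum.neutral ballI)
  fix y t assume "\<bar>y\<bar> > R'"
  then have "\<bar>t\<bar> > R \<or> \<bar>y - t\<bar> > w" using assms(3) by linarith
  then show "U (y - t) * c t = 0" using assms unfolding vanishes_outside_def by auto
qed

lemma vanishes_outside_mono: "vanishes_outside R h \<Longrightarrow> R \<le> R' \<Longrightarrow> vanishes_outside R' h"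
  unfolding vanishes_outside_def by auto

lemma vanishes_outside_central_diff: "vanishes_outside R h \<Longrightarrow> R + 1 \<le> R' \<Longrightarrow> vanishes_outside R' (central_diff h)"
  unfolding vanishes_outside_def central_diff_def by auto

lemma vanishes_outside_mult1: "vanishes_outside R h \<Longrightarrow> vanishes_outside R (\<lambda>t. h t * h' t)"
  and vanishes_outside_mult2: "vanishes_outside R h \<Longrightarrow> vanishes_outside R (\<lambda>t. h' t * h t)"
  unfolding vanishes_outside_def by auto

lemma vanishes_outside_sum: "(\<And>i. i \<in> I \<Longrightarrow> vanishes_outside R (h i)) \<Longrightarrow> vanishes_outside R (\<lambda>t. \<Sum>i\<in>I. h i t)"
  unfolding vanishes_outside_def by (auto intro!: sum.neutral)

lemma vanishes_outside_unif: "2 ^ m \<le> R \<Longrightarrow> vanishes_outside R (unif m)"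
  and vanishes_outside_unif_prim: "2 ^ m \<le> R \<Longrightarrow> vanishes_outside R (unif_prim m)"
  unfolding vanishes_outside_def unif_def unif_prim_def by auto

lemma vanishes_outside_trap: "2 * 2 ^ m \<le> R \<Longrightarrow> vanishes_outside R (trap m)"
  unfolding vanishes_outside_def using trap_eq_0[of m] by force

lemma vanishes_outside_ramp_diff: "m \<le> m' \<Longrightarrow> 2 ^ m' \<le> R \<Longrightarrow> vanishes_outside R (ramp_diff m m')"
  unfolding vanishes_outside_def using ramp_diff_support[of m m'] by force

section \<open>Averages over finitely many coins\<close>

text \<open>A coin is \<open>0\<close> outside \<open>\<Lambda>\<close>: far lines carry no drift, which does not affect walks of bounded
  length (\<open>ret_local\<close>).\<close>

definition coins :: "int set \<Rightarrow> (int \<Rightarrow> real) set" where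
  "coins \<Lambda> = {e. (\<forall>t\<in>\<Lambda>. e t = 1 \<or> e t = -1) \<and> (\<forall>t. t \<notin> \<Lambda> \<longrightarrow> e t = 0)}"

lemma abs_coin_le_1: "\<epsilon> \<in> coins \<Lambda> \<Longrightarrow> \<bar>\<epsilon> t\<bar> \<le> 1"
  by (cases "t \<in> \<Lambda>") (auto simp: coins_def)

definition cut :: "int set \<Rightarrow> (int \<Rightarrow> real) \<Rightarrow> int \<Rightarrow> real" where
  "cut \<Lambda> e t = (if t \<in> \<Lambda> then e t else 0)"

lemma bij_betw_coins: "bij_betw (\<lambda>e. restrict e \<Lambda>) (coins \<Lambda>) (\<Lambda> \<rightarrow>\<^sub>E {1, -1})"
proof (rule bij_betw_byWitness[where f'="cut \<Lambda>"])
  show "\<forall>e\<in>coins \<Lambda>. cut \<Lambda> (restrict e \<Lambda>) = e" by (auto simp: coins_def cut_def fun_eq_iff)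
  show "\<forall>e\<in>\<Lambda> \<rightarrow>\<^sub>E {1, -1}. restrict (cut \<Lambda> e) \<Lambda> = e"
    by (auto simp: cut_def fun_eq_iff PiE_def extensional_def)
  show "(\<lambda>e. restrict e \<Lambda>) ` coins \<Lambda> \<subseteq> \<Lambda> \<rightarrow>\<^sub>E {1, -1}" by (auto simp: coins_def)
  show "cut \<Lambda> ` (\<Lambda> \<rightarrow>\<^sub>E {1, -1}) \<subseteq> coins \<Lambda>" by (auto simp: coins_def cut_def PiE_def Pi_def)
qed

lemma finite_coins: "finite \<Lambda> \<Longrightarrow> finite (coins \<Lambda>)"
  using bij_betw_finite[OF bij_betw_coins] by (simp add: finite_PiE)

lemma card_coins: "finite \<Lambda> \<Longrightarrow> card (coins \<Lambda>) = 2 ^ card \<Lambda>"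
  using bij_betw_same_card[OF bij_betw_coins, of \<Lambda>] by (simp add: card_PiE numeral_2_eq_2)

definition avg :: "int set \<Rightarrow> ((int \<Rightarrow> real) \<Rightarrow> real) \<Rightarrow> real" where
  "avg \<Lambda> f = (\<Sum>e\<in>coins \<Lambda>. f e) / card (coins \<Lambda>)"

lemma card_coins_pos: "finite \<Lambda> \<Longrightarrow> card (coins \<Lambda>) > 0"
  by (simp add: card_coins)

lemma avg_const: "finite \<Lambda> \<Longrightarrow> avg \<Lambda> (\<lambda>_. c) = c"
  using card_coins_pos by (simp add: avg_def)

lemma avg_add: "avg \<Lambda> (\<lambda>e. f e + g e) = avg \<Lambda> f + avg \<Lambda> g"
  by (simp add: avg_def sum.distrib add_divide_distrib)

lemma avg_cmult: "avg \<Lambda> (\<lambda>e. c * f e) = c * avg \<Lambda> f"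
  by (simp add: avg_def sum_distrib_left)

lemma avg_sum: "avg \<Lambda> (\<lambda>e. \<Sum>i\<in>I. f i e) = (\<Sum>i\<in>I. avg \<Lambda> (f i))"
  unfolding avg_def by (simp add: sum.swap[of _ I] sum_divide_distrib)

lemma avg_mono: "(\<And>e. e \<in> coins \<Lambda> \<Longrightarrow> f e \<le> g e) \<Longrightarrow> avg \<Lambda> f \<le> avg \<Lambda> g"
  unfolding avg_def by (intro divide_right_mono sum_mono) auto

lemma avg_cong: "(\<And>e. e \<in> coins \<Lambda> \<Longrightarrow> f e = g e) \<Longrightarrow> avg \<Lambda> f = avg \<Lambda> g"
  unfolding avg_def by (intro arg_cong2[where f="(/)"] sum.cong) auto

lemma avg_nonneg: "(\<And>e. e \<in> coins \<Lambda> \<Longrightarrow> 0 \<le> f e) \<Longrightarrow> 0 \<le> avg \<Lambda> f"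
  unfolding avg_def by (intro divide_nonneg_nonneg sum_nonneg) auto

lemma avg_odd_flip:
  assumes a: "a \<in> \<Lambda>" and Z: "\<And>e. Z (e(a := - e a)) = Z e"
  shows "avg \<Lambda> (\<lambda>e. e a * Z e) = 0"
proof -
  let ?F = "\<lambda>e. e(a := - e a)"
  have "?F e \<in> coins \<Lambda>" if "e \<in> coins \<Lambda>" for e
    using that a unfolding coins_def by (simp, force)
  then have "bij_betw ?F (coins \<Lambda>) (coins \<Lambda>)"
    by (intro bij_betw_byWitness[where f'="?F"]) auto
  then have "(\<Sum>e\<in>coins \<Lambda>. e a * Z e) = (\<Sum>e\<in>coins \<Lambda>. ?F e a * Z (?F e))"
    by (rule sum.reindex_bij_betw[symmetric])
  also have "\<dots> = - (\<Sum>e\<in>coins \<Lambda>. e a * Z e)" by (simp add: Z sum_negf)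
  finally show ?thesis by (simp add: avg_def)
qed

lemma avg_indep:
  assumes fin: "finite \<Lambda>"
    and X: "\<And>e e'. (\<And>t. t \<in> S \<Longrightarrow> e t = e' t) \<Longrightarrow> X e = X e'"
    and Y: "\<And>e e'. (\<And>t. t \<notin> S \<Longrightarrow> e t = e' t) \<Longrightarrow> Y e = Y e'"
  shows "avg \<Lambda> (\<lambda>e. X e * Y e) = avg \<Lambda> X * avg \<Lambda> Y"
proof -
  let ?C = "coins \<Lambda>"
  define mix :: "(int \<Rightarrow> real) \<Rightarrow> (int \<Rightarrow> real) \<Rightarrow> int \<Rightarrow> real" where
    "mix e e' = (\<lambda>t. if t \<in> S then e t else e' t)" for e e'
  let ?M = "\<lambda>(e, e'). (mix e e', mix e' e)"
  have "mix e e' \<in> ?C" if "e \<in> ?C" "e' \<in> ?C" for e e'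
    using that unfolding coins_def mix_def by simp
  moreover have "mix (mix e e') (mix e' e) = e" for e e' by (auto simp: mix_def)
  ultimately have "bij_betw ?M (?C \<times> ?C) (?C \<times> ?C)"
    by (intro bij_betw_byWitness[where f'="?M"]) auto
  then have "(\<Sum>(e, e')\<in>?C \<times> ?C. X e * Y e) = (\<Sum>p\<in>?C \<times> ?C. (\<lambda>(e, e'). X e * Y e) (?M p))"
    by (rule sum.reindex_bij_betw[symmetric])
  also have "\<dots> = (\<Sum>(e, e')\<in>?C \<times> ?C. X e * Y e')"
  proof (rule sum.cong[OF refl])
    fix p :: "(int \<Rightarrow> real) \<times> (int \<Rightarrow> real)"
    obtain e e' where p: "p = (e, e')" by force
    have "X (mix e e') = X e" "Y (mix e e') = Y e'"
      by (rule X Y, simp add: mix_def)+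
    then show "(\<lambda>(e, e'). X e * Y e) (?M p) = (\<lambda>(e, e'). X e * Y e') p" by (simp add: p)
  qed
  also have "\<dots> = (\<Sum>e\<in>?C. X e) * (\<Sum>e\<in>?C. Y e)"
    by (simp add: sum_product sum.cartesian_product)
  also have "(\<Sum>(e, e')\<in>?C \<times> ?C. X e * Y e) = card ?C * (\<Sum>e\<in>?C. X e * Y e)"
    by (simp add: sum.cartesian_product[symmetric] sum_distrib_left mult.commute)
  finally show ?thesis
    using card_coins_pos[OF fin] by (simp add: avg_def field_simps)
qed

lemma coins_sq: "e \<in> coins \<Lambda> \<Longrightarrow> t \<in> \<Lambda> \<Longrightarrow> e t * e t = 1"
  by (auto simp: coins_def)

lemma coins_outside: "e \<in> coins \<Lambda> \<Longrightarrow> t \<notin> \<Lambda> \<Longrightarrow> e t = 0"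
  by (auto simp: coins_def)

lemma avg_two:
  assumes "finite \<Lambda>" "a \<in> \<Lambda>" "b \<in> \<Lambda>"
  shows "avg \<Lambda> (\<lambda>e. e a * e b) = (if a = b then 1 else 0)"
proof (cases "a = b")
  case True
  then have "avg \<Lambda> (\<lambda>e. e a * e b) = avg \<Lambda> (\<lambda>e. 1)" by (intro avg_cong) (use assms coins_sq in auto)
  then show ?thesis using True assms avg_const by simp
next
  case False
  then show ?thesis using avg_odd_flip[OF assms(2), of "\<lambda>e. e b"] by simp
qed

lemma avg_four:
  assumes "finite \<Lambda>" "a \<in> \<Lambda>" "b \<in> \<Lambda>" "c \<in> \<Lambda>" "d \<in> \<Lambda>" "a \<noteq> b" "c \<noteq> d"
  shows "avg \<Lambda> (\<lambda>e. (e a * e b) * (e c * e d)) = (if a = c \<and> b = d \<or> a = d \<and> b = c then 1 else 0)"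
proof -
  consider "a = c \<and> b = d \<or> a = d \<and> b = c" | "a \<noteq> c \<and> a \<noteq> d" | "b \<noteq> c \<and> b \<noteq> d"
    using assms by blast
  then show ?thesis
  proof cases
    case 1
    have "avg \<Lambda> (\<lambda>e. (e a * e b) * (e c * e d)) = avg \<Lambda> (\<lambda>e. 1)"
    proof (rule avg_cong)
      fix e assume e: "e \<in> coins \<Lambda>"
      have "(e a * e b) * (e c * e d) = (e a * e a) * (e b * e b)" using 1 by auto
      then show "(e a * e b) * (e c * e d) = 1" using coins_sq[OF e] assms by simp
    qed
    then show ?thesis using 1 avg_const[OF assms(1)] by simp
  next
    case 2
    then show ?thesis using avg_odd_flip[OF assms(2), of "\<lambda>e. e b * (e c * e d)"] assms 
      by (auto simp: mult.assoc)
  next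
    case 3
    have "avg \<Lambda> (\<lambda>e. e b * (e a * (e c * e d))) = 0" using avg_odd_flip[OF assms(3), of "\<lambda>e. e a * (e c * e d)"] 3 assms by auto
    then show ?thesis using 3 by (auto simp: mult_ac)
  qed
qed

lemma avg_conv_conv:
  assumes "finite \<Lambda>"
  shows "avg \<Lambda> (\<lambda>e. conv \<Lambda> U (\<lambda>t. \<alpha> t * e t) y * conv \<Lambda> W (\<lambda>t. \<beta> t * e t) y')
       = (\<Sum>t\<in>\<Lambda>. U (y - t) * W (y' - t) * (\<alpha> t * \<beta> t))"
proof -
  have "avg \<Lambda> (\<lambda>e. conv \<Lambda> U (\<lambda>t. \<alpha> t * e t) y * conv \<Lambda> W (\<lambda>t. \<beta> t * e t) y')
      = avg \<Lambda> (\<lambda>e. \<Sum>t\<in>\<Lambda>. \<Sum>s\<in>\<Lambda>. (U (y - t) * \<alpha> t * W (y' - s) * \<beta> s) * (e t * e s))"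
    unfolding conv_def sum_product by (simp add: mult_ac)
  also have "\<dots> = (\<Sum>t\<in>\<Lambda>. \<Sum>s\<in>\<Lambda>. (U (y - t) * \<alpha> t * W (y' - s) * \<beta> s) * (if t = s then 1 else 0))"
    unfolding avg_sum avg_cmult by (intro sum.cong refl) (simp add: avg_two[OF assms])
  also have "\<dots> = (\<Sum>t\<in>\<Lambda>. U (y - t) * \<alpha> t * W (y' - t) * \<beta> t)"
    using assms by (simp add: if_distrib cong: if_cong)
  finally show ?thesis by (simp add: mult_ac)
qed

lemma sum_kernel_le:
  assumes fin: "finite \<Lambda>" and U: "kernel_bound U b c" and W: "\<And>t. \<bar>W t\<bar> \<le> b'"
  shows "(\<Sum>t\<in>\<Lambda>. \<bar>U (y - t) * W t\<bar>) \<le> b * b' * c"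
proof -
  obtain J where J: "finite J" "real (card J) \<le> c" "\<And>d. U d \<noteq> 0 \<Longrightarrow> d \<in> J" "\<And>d. \<bar>U d\<bar> \<le> b"
    using U unfolding kernel_bound_def by blast
  have b: "0 \<le> b" "0 \<le> b'" using J(4)[of 0] W[of 0] by linarith+
  have "(\<Sum>t\<in>\<Lambda>. \<bar>U (y - t) * W t\<bar>) = (\<Sum>t\<in>{t\<in>\<Lambda>. y - t \<in> J}. \<bar>U (y - t) * W t\<bar>)"
    by (rule sum.mono_neutral_right) (use fin J(3) in auto)
  also have "\<dots> \<le> (\<Sum>t\<in>{t\<in>\<Lambda>. y - t \<in> J}. b * b')"
    by (intro sum_mono) (use J(4) W b in \<open>auto simp: abs_mult intro!: mult_mono\<close>)
  also have "\<dots> = card {t\<in>\<Lambda>. y - t \<in> J} * (b * b')" by simp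
  also have "card {t\<in>\<Lambda>. y - t \<in> J} \<le> card J"
    by (rule card_inj_on_le[where f="\<lambda>t. y - t"]) (use J in \<open>auto simp: inj_on_def\<close>)
  then have "card {t\<in>\<Lambda>. y - t \<in> J} * (b * b') \<le> c * (b * b')"
    using J(2) b by (intro mult_right_mono) auto
  finally show ?thesis by (simp add: mult_ac)
qed

lemma avg_conv_conv_le:
  assumes fin: "finite \<Lambda>" and U: "kernel_bound U b c" and W: "kernel_bound W b' c'"
    and \<alpha>: "\<And>t. \<bar>\<alpha> t\<bar> \<le> A" and \<beta>: "\<And>t. \<bar>\<beta> t\<bar> \<le> B"
  shows "\<bar>avg \<Lambda> (\<lambda>e. conv \<Lambda> U (\<lambda>t. \<alpha> t * e t) y * conv \<Lambda> W (\<lambda>t. \<beta> t * e t) y')\<bar> \<le> A * B * (b * b' * min c c')"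
proof -
  have A: "0 \<le> A" "0 \<le> B" using \<alpha>[of 0] \<beta>[of 0] by linarith+
  have "\<bar>avg \<Lambda> (\<lambda>e. conv \<Lambda> U (\<lambda>t. \<alpha> t * e t) y * conv \<Lambda> W (\<lambda>t. \<beta> t * e t) y')\<bar>
      \<le> (\<Sum>t\<in>\<Lambda>. \<bar>U (y - t) * W (y' - t) * (\<alpha> t * \<beta> t)\<bar>)"
    unfolding avg_conv_conv[OF fin] by (rule sum_abs)
  also have "\<dots> \<le> (\<Sum>t\<in>\<Lambda>. \<bar>U (y - t) * W (y' - t)\<bar> * (A * B))"
    by (intro sum_mono) (use \<alpha> \<beta> A in \<open>auto simp: abs_mult intro!: mult_mono\<close>)
  also have "\<dots> = A * B * (\<Sum>t\<in>\<Lambda>. \<bar>U (y - t) * W (y' - t)\<bar>)"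
    by (simp add: sum_distrib_left mult_ac)
  also have "\<dots> \<le> A * B * (b * b' * min c c')"
  proof (intro mult_left_mono)
    have "(\<Sum>t\<in>\<Lambda>. \<bar>U (y - t) * W (y' - t)\<bar>) \<le> b * b' * c"
      by (rule sum_kernel_le[OF fin U]) (use W in \<open>auto simp: kernel_bound_def\<close>)
    moreover have "(\<Sum>t\<in>\<Lambda>. \<bar>W (y' - t) * U (y - t)\<bar>) \<le> b' * b * c'"
      by (rule sum_kernel_le[OF fin W]) (use U in \<open>auto simp: kernel_bound_def\<close>)
    ultimately show "(\<Sum>t\<in>\<Lambda>. \<bar>U (y - t) * W (y' - t)\<bar>) \<le> b * b' * min c c'"
      by (auto simp: min_def mult_ac)
  qed (use A in auto)
  finally show ?thesis .
qed

lemma avg_conv_sq_le: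
  assumes fin: "finite \<Lambda>" and U: "kernel_bound U b c" and \<alpha>: "\<And>t. \<bar>\<alpha> t\<bar> \<le> A"
  shows "avg \<Lambda> (\<lambda>e. (conv \<Lambda> U (\<lambda>t. \<alpha> t * e t) y)\<^sup>2) \<le> A\<^sup>2 * (b\<^sup>2 * c)"
  using avg_conv_conv_le[OF fin U U, of \<alpha> A \<alpha> A y y] \<alpha> by (simp add: power2_eq_square)

lemma conv_depends:
  assumes "\<And>t. t \<in> \<Lambda> \<Longrightarrow> U (y - t) \<noteq> 0 \<Longrightarrow> c t = c' t"
  shows "conv \<Lambda> U c y = conv \<Lambda> U c' y"
  unfolding conv_def by (intro sum.cong refl) (use assms in force)

lemma off_diagonal_form:
  assumes fin: "finite \<Lambda>" and U0: "U 0 = 1" and supp: "\<And>t. t \<notin> \<Lambda> \<Longrightarrow> \<alpha> t = 0" and e: "e \<in> coins \<Lambda>"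
  shows "e y * conv \<Lambda> U (\<lambda>t. \<alpha> t * e t) y - \<alpha> y = (\<Sum>t\<in>\<Lambda> - {y}. (U (y - t) * \<alpha> t) * (e y * e t))"
proof (cases "y \<in> \<Lambda>")
  case True
  have "conv \<Lambda> U (\<lambda>t. \<alpha> t * e t) y = U (y - y) * (\<alpha> y * e y) + (\<Sum>t\<in>\<Lambda> - {y}. U (y - t) * (\<alpha> t * e t))"
    unfolding conv_def by (rule sum.remove[OF fin True])
  then have "e y * conv \<Lambda> U (\<lambda>t. \<alpha> t * e t) y
     = \<alpha> y * (e y * e y) + (\<Sum>t\<in>\<Lambda> - {y}. (U (y - t) * \<alpha> t) * (e y * e t))"
    by (simp add: U0 distrib_left sum_distrib_left mult_ac)
  then show ?thesis using coins_sq[OF e True] by simp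
next
  case False
  then show ?thesis using supp coins_outside[OF e] by simp
qed

lemma avg_off_diagonal_le:
  assumes fin: "finite \<Lambda>" and U0: "U 0 = 1" and U: "kernel_bound U 1 m"
    and supp: "\<And>t. t \<notin> \<Lambda> \<Longrightarrow> \<alpha> t = 0" and \<alpha>: "\<And>t. \<bar>\<alpha> t\<bar> \<le> A"
  shows "\<bar>avg \<Lambda> (\<lambda>e. (e y * conv \<Lambda> U (\<lambda>t. \<alpha> t * e t) y - \<alpha> y) * (e z * conv \<Lambda> U (\<lambda>t. \<alpha> t * e t) z - \<alpha> z))\<bar>
    \<le> A\<^sup>2 * ((if y = z then m else 0) + \<bar>U (y - z)\<bar>)"
proof -
  have A: "0 \<le> A" using \<alpha>[of 0] by linarith
  have m: "0 \<le> m" using kernel_nonneg[OF U] by simp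
  have U1: "\<bar>U d\<bar> \<le> 1" for d using U by (simp add: kernel_bound_def)
  define c where "c = (\<lambda>y t. U (y - t) * \<alpha> t)"
  have "avg \<Lambda> (\<lambda>e. (e y * conv \<Lambda> U (\<lambda>t. \<alpha> t * e t) y - \<alpha> y) * (e z * conv \<Lambda> U (\<lambda>t. \<alpha> t * e t) z - \<alpha> z))
      = avg \<Lambda> (\<lambda>e. \<Sum>t\<in>\<Lambda> - {y}. \<Sum>s\<in>\<Lambda> - {z}. (c y t * c z s) * ((e y * e t) * (e z * e s)))"
  proof (rule avg_cong)
    fix e assume e: "e \<in> coins \<Lambda>"
    have form: "e y * conv \<Lambda> U (\<lambda>t. \<alpha> t * e t) y - \<alpha> y = (\<Sum>t\<in>\<Lambda> - {y}. (U (y - t) * \<alpha> t) * (e y * e t))" for y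
      by (rule off_diagonal_form) (use fin U0 supp e in auto)
    show "(e y * conv \<Lambda> U (\<lambda>t. \<alpha> t * e t) y - \<alpha> y) * (e z * conv \<Lambda> U (\<lambda>t. \<alpha> t * e t) z - \<alpha> z)
      = (\<Sum>t\<in>\<Lambda> - {y}. \<Sum>s\<in>\<Lambda> - {z}. (c y t * c z s) * ((e y * e t) * (e z * e s)))"
      unfolding form sum_product c_def by (intro sum.cong refl) (simp only: mult_ac)
  qed
  also have "\<dots> = (\<Sum>t\<in>\<Lambda> - {y}. \<Sum>s\<in>\<Lambda> - {z}. (c y t * c z s) * avg \<Lambda> (\<lambda>e. (e y * e t) * (e z * e s)))" (is "_ = ?S")
    unfolding avg_sum avg_cmult ..
  finally have eq: "avg \<Lambda> (\<lambda>e. (e y * conv \<Lambda> U (\<lambda>t. \<alpha> t * e t) y - \<alpha> y) * (e z * conv \<Lambda> U (\<lambda>t. \<alpha> t * e t) z - \<alpha> z)) = ?S" .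
  show ?thesis
  proof (cases "y \<in> \<Lambda> \<and> z \<in> \<Lambda>")
    case False
    have "avg \<Lambda> (\<lambda>e. (e y * e t) * (e z * e s)) = 0" for t s
    proof -
      have "avg \<Lambda> (\<lambda>e. (e y * e t) * (e z * e s)) = avg \<Lambda> (\<lambda>e. 0)"
        by (rule avg_cong) (use False coins_outside in auto)
      then show ?thesis using avg_const[OF fin] by simp
    qed
    then have "?S = 0" by simp
    then show ?thesis unfolding eq using m by simp
  next
    case True
    have S: "?S = (\<Sum>t\<in>\<Lambda> - {y}. \<Sum>s\<in>\<Lambda> - {z}. (c y t * c z s) * (if y = z \<and> t = s \<or> y = s \<and> t = z then 1 else 0))"
      by (intro sum.cong refl arg_cong2[where f="(*)"] avg_four) (use True fin in auto)
    show ?thesis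
    proof (cases "y = z")
      case eqyz: True
      have "?S = (\<Sum>t\<in>\<Lambda> - {y}. \<Sum>s\<in>\<Lambda> - {y}. if s = t then c y t * c y t else 0)"
        unfolding S by (intro sum.cong refl) (use eqyz in auto)
      also have "\<dots> = (\<Sum>t\<in>\<Lambda> - {y}. c y t * c y t)"
        using fin by (intro sum.cong refl) simp
      finally have "\<bar>?S\<bar> \<le> (\<Sum>t\<in>\<Lambda> - {y}. \<bar>U (y - t) * (c y t * \<alpha> t)\<bar>)"
        using sum_abs[of "\<lambda>t. c y t * c y t" "\<Lambda> - {y}"] by (simp add: c_def mult_ac)
      also have "\<dots> \<le> 1 * A\<^sup>2 * m"
      proof (rule sum_kernel_le[OF _ U])
        show "finite (\<Lambda> - {y})" using fin by simp
        show "\<bar>c y t * \<alpha> t\<bar> \<le> A\<^sup>2" for t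
        proof -
          have "\<bar>c y t * \<alpha> t\<bar> = \<bar>U (y - t)\<bar> * (\<bar>\<alpha> t\<bar> * \<bar>\<alpha> t\<bar>)" by (simp add: c_def abs_mult)
          also have "\<dots> \<le> 1 * (A * A)" by (intro mult_mono U1 \<alpha>) (use A in auto)
          finally show ?thesis by (simp add: power2_eq_square)
        qed
      qed
      also have "\<dots> \<le> A\<^sup>2 * (m + \<bar>U (y - z)\<bar>)" by (simp add: distrib_left)
      finally show ?thesis unfolding eq using eqyz by simp
    next
      case neq: False
      have "?S = (\<Sum>t\<in>\<Lambda> - {y}. \<Sum>s\<in>\<Lambda> - {z}. if s = y then (if t = z then c y z * c z y else 0) else 0)"
        unfolding S by (intro sum.cong refl) (use neq in auto)
      also have "\<dots> = c y z * c z y"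
        using fin True neq by simp
      finally have "\<bar>?S\<bar> = \<bar>U (y - z)\<bar> * (\<bar>U (z - y)\<bar> * (\<bar>\<alpha> z\<bar> * \<bar>\<alpha> y\<bar>))" by (simp add: c_def abs_mult)
      also have "\<dots> \<le> \<bar>U (y - z)\<bar> * (1 * (A * A))"
        by (intro mult_mono U1 \<alpha>) (use A in auto)
      finally show ?thesis unfolding eq using neq by (simp add: power2_eq_square mult_ac)
    qed
  qed
qed

lemma avg_conv_window_le:
  assumes fin: "finite \<Lambda>" and W: "kernel_bound W b c" and U: "kernel_bound U 1 m"
    and X: "\<And>t s. W (y - t) \<noteq> 0 \<Longrightarrow> W (y - s) \<noteq> 0 \<Longrightarrow>
        \<bar>avg \<Lambda> (\<lambda>e. X e t * X e s)\<bar> \<le> B * ((if t = s then m else 0) + \<bar>U (t - s)\<bar>)"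
    and B: "0 \<le> B"
  shows "avg \<Lambda> (\<lambda>e. (conv \<Lambda> W (X e) y)\<^sup>2) \<le> B * (2 * m) * (b\<^sup>2 * c)"
proof -
  have b: "0 \<le> b" "0 \<le> c" using kernel_nonneg[OF W] by auto
  have m: "0 \<le> m" using kernel_nonneg[OF U] by auto
  have Wb: "\<bar>W d\<bar> \<le> b" for d using W by (simp add: kernel_bound_def)
  have "avg \<Lambda> (\<lambda>e. (conv \<Lambda> W (X e) y)\<^sup>2)
      = avg \<Lambda> (\<lambda>e. \<Sum>t\<in>\<Lambda>. \<Sum>s\<in>\<Lambda>. (W (y - t) * W (y - s)) * (X e t * X e s))"
    unfolding conv_def power2_eq_square sum_product by (simp add: mult_ac)
  also have "\<dots> = (\<Sum>t\<in>\<Lambda>. \<Sum>s\<in>\<Lambda>. (W (y - t) * W (y - s)) * avg \<Lambda> (\<lambda>e. X e t * X e s))"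
    unfolding avg_sum avg_cmult ..
  also have "\<dots> \<le> (\<Sum>t\<in>\<Lambda>. \<Sum>s\<in>\<Lambda>. \<bar>W (y - t)\<bar> * b * (B * ((if s = t then m else 0) + \<bar>U (t - s)\<bar>)))"
  proof (intro sum_mono)
    fix t s
    show "(W (y - t) * W (y - s)) * avg \<Lambda> (\<lambda>e. X e t * X e s)
        \<le> \<bar>W (y - t)\<bar> * b * (B * ((if s = t then m else 0) + \<bar>U (t - s)\<bar>))" 
    proof (cases "W (y - t) \<noteq> 0 \<and> W (y - s) \<noteq> 0")
      case True
      have "(W (y - t) * W (y - s)) * avg \<Lambda> (\<lambda>e. X e t * X e s)
          \<le> \<bar>W (y - t)\<bar> * \<bar>W (y - s)\<bar> * \<bar>avg \<Lambda> (\<lambda>e. X e t * X e s)\<bar>"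
        unfolding abs_mult[symmetric] by (rule abs_ge_self)
      also have "\<dots> \<le> \<bar>W (y - t)\<bar> * b * (B * ((if t = s then m else 0) + \<bar>U (t - s)\<bar>))"
        using True by (intro mult_mono X Wb) (use b in auto)
      finally show ?thesis by (cases "s = t") auto
    next
      case False
      have "0 \<le> \<bar>W (y - t)\<bar> * b * (B * ((if s = t then m else 0) + \<bar>U (t - s)\<bar>))" using b B m by simp
      then show ?thesis using False by auto
    qed
  qed
  also have "\<dots> = (\<Sum>t\<in>\<Lambda>. \<bar>W (y - t)\<bar> * (b * B * (\<Sum>s\<in>\<Lambda>. (if s = t then m else 0) + \<bar>U (t - s)\<bar>)))"
    by (simp add: sum_distrib_left mult_ac)
  also have "\<dots> \<le> (\<Sum>t\<in>\<Lambda>. \<bar>W (y - t)\<bar> * (b * B * (2 * m)))"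
  proof (intro sum_mono mult_left_mono)
    fix t assume "t \<in> \<Lambda>"
    have "(\<Sum>s\<in>\<Lambda>. \<bar>U (t - s) * 1\<bar>) \<le> 1 * 1 * m" by (rule sum_kernel_le[OF fin U]) simp
    then show "(\<Sum>s\<in>\<Lambda>. (if s = t then m else 0) + \<bar>U (t - s)\<bar>) \<le> 2 * m"
      using fin \<open>t \<in> \<Lambda>\<close> by (simp add: sum.distrib)
  qed (use b B in auto)
  also have "\<dots> = (\<Sum>t\<in>\<Lambda>. \<bar>W (y - t) * 1\<bar>) * (b * B * (2 * m))"
    by (simp add: sum_distrib_right)
  also have "\<dots> \<le> (b * 1 * c) * (b * B * (2 * m))"
    by (intro mult_right_mono sum_kernel_le[OF fin W]) (use b B m in auto)
  finally show ?thesis by (simp add: power2_eq_square mult_ac)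
qed

text \<open>Kernels supported on positive offsets make \<open>x \<mapsto> e x * conv \<Lambda> \<kappa> (\<Psi> * e) x\<close> a martingale
  difference sequence, so its values at different sites are uncorrelated.\<close>

lemma avg_martingale_difference:
  assumes fin: "finite \<Lambda>" and \<kappa>: "\<And>d. d \<le> 0 \<Longrightarrow> \<kappa> d = 0" and \<kappa>': "\<And>d. d \<le> 0 \<Longrightarrow> \<kappa>' d = 0"
    and ne: "x \<noteq> x'"
  shows "avg \<Lambda> (\<lambda>e. (e x * conv \<Lambda> \<kappa> (\<lambda>t. \<Psi> t * e t) x) * (e x' * conv \<Lambda> \<kappa>' (\<lambda>t. \<Psi> t * e t) x')) = 0"
proof -
  have gen: "avg \<Lambda> (\<lambda>e. (e x * conv \<Lambda> \<kappa> (\<lambda>t. \<Psi> t * e t) x) * (e x' * conv \<Lambda> \<kappa>' (\<lambda>t. \<Psi> t * e t) x')) = 0"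
    if lt: "x' < x" and \<kappa>: "\<And>d. d \<le> 0 \<Longrightarrow> \<kappa> d = 0" and \<kappa>': "\<And>d. d \<le> 0 \<Longrightarrow> \<kappa>' d = 0" for \<kappa> \<kappa>' x x'
  proof (cases "x \<in> \<Lambda>")
    case True
    let ?Z = "\<lambda>e. conv \<Lambda> \<kappa> (\<lambda>t. \<Psi> t * e t) x * (e x' * conv \<Lambda> \<kappa>' (\<lambda>t. \<Psi> t * e t) x')"
    have "?Z (e(x := - e x)) = ?Z e" for e
    proof -
      have "conv \<Lambda> \<kappa> (\<lambda>t. \<Psi> t * (e(x := - e x)) t) x = conv \<Lambda> \<kappa> (\<lambda>t. \<Psi> t * e t) x"
        by (rule conv_depends) (use \<kappa> in auto)
      moreover have "conv \<Lambda> \<kappa>' (\<lambda>t. \<Psi> t * (e(x := - e x)) t) x' = conv \<Lambda> \<kappa>' (\<lambda>t. \<Psi> t * e t) x'"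
        by (rule conv_depends) (use \<kappa>' lt in auto)
      moreover have "(e(x := - e x)) x' = e x'" using lt by simp
      ultimately show ?thesis by simp
    qed
    from avg_odd_flip[where Z="?Z", OF True this] show ?thesis by (simp add: mult_ac)
  next
    case False
    then have "avg \<Lambda> (\<lambda>e. (e x * conv \<Lambda> \<kappa> (\<lambda>t. \<Psi> t * e t) x) * (e x' * conv \<Lambda> \<kappa>' (\<lambda>t. \<Psi> t * e t) x')) = avg \<Lambda> (\<lambda>e. 0)"
      by (intro avg_cong) (simp add: coins_outside)
    then show ?thesis using avg_const[OF fin] by simp
  qed
  consider "x' < x" | "x < x'" using ne by linarith
  then show ?thesis
  proof cases
    case 1 then show ?thesis by (rule gen) (use \<kappa> \<kappa>' in auto)
  next
    case 2 
    then have "avg \<Lambda> (\<lambda>e. (e x' * conv \<Lambda> \<kappa>' (\<lambda>t. \<Psi> t * e t) x') * (e x * conv \<Lambda> \<kappa> (\<lambda>t. \<Psi> t * e t) x)) = 0" 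
      by (rule gen) (use \<kappa> \<kappa>' in auto)
    then show ?thesis by (simp add: mult_ac)
  qed
qed

lemma avg_conv_martingale_le:
  assumes fin: "finite \<Lambda>" and \<kappa>: "\<And>d. d \<le> 0 \<Longrightarrow> \<kappa> d = 0" and \<kappa>': "\<And>d. d \<le> 0 \<Longrightarrow> \<kappa>' d = 0"
    and k1: "kernel_bound \<kappa> 1 c" and k2: "kernel_bound \<kappa>' 1 c'" and \<Psi>: "\<And>t. \<bar>\<Psi> t\<bar> \<le> 1"
    and W: "kernel_bound W b d" and W': "kernel_bound W' b' d'"
  shows "\<bar>avg \<Lambda> (\<lambda>e. conv \<Lambda> W (\<lambda>t. e t * conv \<Lambda> \<kappa> (\<lambda>t. \<Psi> t * e t) t) x
               * conv \<Lambda> W' (\<lambda>t. e t * conv \<Lambda> \<kappa>' (\<lambda>t. \<Psi> t * e t) t) x)\<bar>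
      \<le> (b * b' * min d d') * min c c'"
proof -
  have nn: "0 \<le> c" "0 \<le> c'" "0 \<le> b" "0 \<le> b'" using kernel_nonneg k1 k2 W W' by auto
  let ?E = "\<lambda>\<kappa> e t. e t * conv \<Lambda> \<kappa> (\<lambda>t. \<Psi> t * e t) t"
  have cov: "\<bar>avg \<Lambda> (\<lambda>e. ?E \<kappa> e t * ?E \<kappa>' e s)\<bar> \<le> (if s = t then min c c' else 0)" if "t \<in> \<Lambda>" for t s
  proof (cases "s = t")
    case True
    have "avg \<Lambda> (\<lambda>e. ?E \<kappa> e t * ?E \<kappa>' e t)
        = avg \<Lambda> (\<lambda>e. conv \<Lambda> \<kappa> (\<lambda>t. \<Psi> t * e t) t * conv \<Lambda> \<kappa>' (\<lambda>t. \<Psi> t * e t) t)"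
    proof (rule avg_cong)
      fix e assume "e \<in> coins \<Lambda>"
      have "?E \<kappa> e t * ?E \<kappa>' e t = (e t * e t) * (conv \<Lambda> \<kappa> (\<lambda>t. \<Psi> t * e t) t * conv \<Lambda> \<kappa>' (\<lambda>t. \<Psi> t * e t) t)"
        by (simp add: mult_ac)
      then show "?E \<kappa> e t * ?E \<kappa>' e t = conv \<Lambda> \<kappa> (\<lambda>t. \<Psi> t * e t) t * conv \<Lambda> \<kappa>' (\<lambda>t. \<Psi> t * e t) t"
        using coins_sq[OF \<open>e \<in> coins \<Lambda>\<close> that] by simp
    qed
    also have "\<bar>\<dots>\<bar> \<le> 1 * 1 * (1 * 1 * min c c')"
      by (rule avg_conv_conv_le[OF fin k1 k2]) (use \<Psi> in auto)
    finally show ?thesis using True by simp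
  next
    case False
    then have "avg \<Lambda> (\<lambda>e. ?E \<kappa> e t * ?E \<kappa>' e s) = 0"
      by (intro avg_martingale_difference[OF fin \<kappa> \<kappa>']) auto
    then show ?thesis using False by simp
  qed
  have "avg \<Lambda> (\<lambda>e. conv \<Lambda> W (?E \<kappa> e) x * conv \<Lambda> W' (?E \<kappa>' e) x)
      = (\<Sum>t\<in>\<Lambda>. \<Sum>s\<in>\<Lambda>. (W (x - t) * W' (x - s)) * avg \<Lambda> (\<lambda>e. ?E \<kappa> e t * ?E \<kappa>' e s))"
  proof -
    have "avg \<Lambda> (\<lambda>e. conv \<Lambda> W (?E \<kappa> e) x * conv \<Lambda> W' (?E \<kappa>' e) x)
      = avg \<Lambda> (\<lambda>e. \<Sum>t\<in>\<Lambda>. \<Sum>s\<in>\<Lambda>. (W (x - t) * W' (x - s)) * (?E \<kappa> e t * ?E \<kappa>' e s))"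
      unfolding conv_def[of \<Lambda> W] conv_def[of \<Lambda> W'] sum_product by (intro avg_cong sum.cong refl) (simp only: mult_ac)
    then show ?thesis unfolding avg_sum avg_cmult .
  qed
  also have "\<bar>\<dots>\<bar> \<le> (\<Sum>t\<in>\<Lambda>. \<Sum>s\<in>\<Lambda>. if s = t then \<bar>W (x - t) * W' (x - t)\<bar> * min c c' else 0)"
  proof (intro order_trans[OF sum_abs] sum_mono)
    fix t s assume t: "t \<in> \<Lambda>"
    have "\<bar>(W (x - t) * W' (x - s)) * avg \<Lambda> (\<lambda>e. ?E \<kappa> e t * ?E \<kappa>' e s)\<bar>
        \<le> \<bar>W (x - t) * W' (x - s)\<bar> * (if s = t then min c c' else 0)"
      unfolding abs_mult[of "W (x - t) * W' (x - s)"] by (intro mult_left_mono cov t) simp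
    then show "\<bar>(W (x - t) * W' (x - s)) * avg \<Lambda> (\<lambda>e. ?E \<kappa> e t * ?E \<kappa>' e s)\<bar>
        \<le> (if s = t then \<bar>W (x - t) * W' (x - t)\<bar> * min c c' else 0)" by (auto split: if_splits)
  qed
  also have "\<dots> = (\<Sum>t\<in>\<Lambda>. \<bar>W (x - t) * W' (x - t)\<bar>) * min c c'"
    using fin by (simp add: sum_distrib_right)
  also have "\<dots> \<le> (b * b' * min d d') * min c c'"
  proof (intro mult_right_mono)
    have "(\<Sum>t\<in>\<Lambda>. \<bar>W (x - t) * W' (x - t)\<bar>) \<le> b * b' * d"
      by (rule sum_kernel_le[OF fin W]) (use W' in \<open>auto simp: kernel_bound_def\<close>)
    moreover have "(\<Sum>t\<in>\<Lambda>. \<bar>W' (x - t) * W (x - t)\<bar>) \<le> b' * b * d'"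
      by (rule sum_kernel_le[OF fin W']) (use W in \<open>auto simp: kernel_bound_def\<close>)
    ultimately show "(\<Sum>t\<in>\<Lambda>. \<bar>W (x - t) * W' (x - t)\<bar>) \<le> b * b' * min d d'"
      by (auto simp: min_def mult_ac)
  qed (use nn in auto)
  finally show ?thesis .
qed

definition avg2 :: "int set \<Rightarrow> ((int \<Rightarrow> real) \<Rightarrow> (int \<Rightarrow> real) \<Rightarrow> real) \<Rightarrow> real" where
  "avg2 \<Lambda> f = avg \<Lambda> (\<lambda>\<eta>. avg \<Lambda> (\<lambda>\<epsilon>. f \<epsilon> \<eta>))"

lemma avg2_mono: "(\<And>\<epsilon> \<eta>. \<epsilon> \<in> coins \<Lambda> \<Longrightarrow> \<eta> \<in> coins \<Lambda> \<Longrightarrow> f \<epsilon> \<eta> \<le> g \<epsilon> \<eta>) \<Longrightarrow> avg2 \<Lambda> f \<le> avg2 \<Lambda> g"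
  unfolding avg2_def by (intro avg_mono) auto

lemma avg2_add: "avg2 \<Lambda> (\<lambda>\<epsilon> \<eta>. f \<epsilon> \<eta> + g \<epsilon> \<eta>) = avg2 \<Lambda> f + avg2 \<Lambda> g"
  by (simp add: avg2_def avg_add)

lemma avg2_cmult: "avg2 \<Lambda> (\<lambda>\<epsilon> \<eta>. c * f \<epsilon> \<eta>) = c * avg2 \<Lambda> f"
  by (simp add: avg2_def avg_cmult)

lemma avg2_sum: "avg2 \<Lambda> (\<lambda>\<epsilon> \<eta>. \<Sum>i\<in>I. f i \<epsilon> \<eta>) = (\<Sum>i\<in>I. avg2 \<Lambda> (f i))"
  by (simp add: avg2_def avg_sum)

lemma avg2_const: "finite \<Lambda> \<Longrightarrow> avg2 \<Lambda> (\<lambda>_ _. c) = c"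
  by (simp add: avg2_def avg_const)

lemma avg2_prod: "avg2 \<Lambda> (\<lambda>\<epsilon> \<eta>. A \<eta> * B \<epsilon>) = avg \<Lambda> A * avg \<Lambda> B"
proof -
  have "avg2 \<Lambda> (\<lambda>\<epsilon> \<eta>. A \<eta> * B \<epsilon>) = avg \<Lambda> (\<lambda>\<eta>. avg \<Lambda> B * A \<eta>)"
    unfolding avg2_def by (rule avg_cong) (simp only: avg_cmult mult.commute)
  also have "\<dots> = avg \<Lambda> B * avg \<Lambda> A" by (rule avg_cmult)
  finally show ?thesis by (simp only: mult.commute)
qed

lemma avg2_swap: "avg2 \<Lambda> (\<lambda>\<epsilon> \<eta>. f \<eta> \<epsilon>) = avg2 \<Lambda> f"
proof -
  have "(\<Sum>\<eta>\<in>coins \<Lambda>. \<Sum>\<epsilon>\<in>coins \<Lambda>. f \<eta> \<epsilon>) = (\<Sum>\<eta>\<in>coins \<Lambda>. \<Sum>\<epsilon>\<in>coins \<Lambda>. f \<epsilon> \<eta>)"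
    by (rule sum.swap)
  then show ?thesis unfolding avg2_def avg_def sum_divide_distrib[symmetric] by (rule arg_cong)
qed

lemma avg2_sum_products_le:
  assumes M: "\<And>t s. t \<in> T \<Longrightarrow> s \<in> T \<Longrightarrow> \<bar>avg \<Lambda> (\<lambda>e. A t e * A s e)\<bar> * \<bar>avg \<Lambda> (\<lambda>e. B t e * B s e)\<bar> \<le> M t s"
  shows "avg2 \<Lambda> (\<lambda>\<epsilon> \<eta>. (\<Sum>t\<in>T. w * (A t \<eta> * B t \<epsilon>))\<^sup>2) \<le> w\<^sup>2 * (\<Sum>t\<in>T. \<Sum>s\<in>T. M t s)"
proof -
  have "avg2 \<Lambda> (\<lambda>\<epsilon> \<eta>. (\<Sum>t\<in>T. w * (A t \<eta> * B t \<epsilon>))\<^sup>2)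
     = avg2 \<Lambda> (\<lambda>\<epsilon> \<eta>. \<Sum>t\<in>T. \<Sum>s\<in>T. w\<^sup>2 * ((A t \<eta> * A s \<eta>) * (B t \<epsilon> * B s \<epsilon>)))"
    by (simp add: power2_eq_square sum_product mult_ac)
  also have "\<dots> = (\<Sum>t\<in>T. \<Sum>s\<in>T. w\<^sup>2 * (avg \<Lambda> (\<lambda>e. A t e * A s e) * avg \<Lambda> (\<lambda>e. B t e * B s e)))"
    unfolding avg2_sum avg2_cmult avg2_prod[of \<Lambda> "\<lambda>\<eta>. A _ \<eta> * A _ \<eta>" "\<lambda>\<epsilon>. B _ \<epsilon> * B _ \<epsilon>"] ..
  also have "\<dots> \<le> (\<Sum>t\<in>T. \<Sum>s\<in>T. w\<^sup>2 * M t s)"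
  proof (intro sum_mono mult_left_mono)
    fix t s assume "t \<in> T" "s \<in> T"
    then show "avg \<Lambda> (\<lambda>e. A t e * A s e) * avg \<Lambda> (\<lambda>e. B t e * B s e) \<le> M t s"
      using M[of t s] unfolding abs_mult[symmetric] by linarith
  qed simp
  finally show ?thesis by (simp add: sum_distrib_left)
qed

lemma sum_sq_le_card: "(\<Sum>t\<in>T. f t)\<^sup>2 \<le> real (card T) * (\<Sum>t\<in>T. (f t)\<^sup>2)" for f :: "'a \<Rightarrow> real"
proof (cases "finite T")
  case True
  have "(\<Sum>t\<in>T. f t * 1)\<^sup>2 \<le> (\<Sum>t\<in>T. (f t)\<^sup>2) * (\<Sum>t\<in>T. 1\<^sup>2)" by (rule Cauchy_Schwarz_ineq_sum)
  then show ?thesis by (simp add: mult.commute)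
qed simp

lemma avg2_mean_sq_le:
  assumes T: "finite T" "T \<noteq> {}" and X: "\<And>t. t \<in> T \<Longrightarrow> avg2 \<Lambda> (\<lambda>\<epsilon> \<eta>. (X t \<epsilon> \<eta>)\<^sup>2) \<le> M"
  shows "avg2 \<Lambda> (\<lambda>\<epsilon> \<eta>. (\<Sum>t\<in>T. 1 / card T * X t \<epsilon> \<eta>)\<^sup>2) \<le> M"
proof -
  let ?n = "real (card T)"
  have n: "?n > 0" using T by (simp add: card_gt_0_iff)
  have "avg2 \<Lambda> (\<lambda>\<epsilon> \<eta>. (\<Sum>t\<in>T. 1 / ?n * X t \<epsilon> \<eta>)\<^sup>2) \<le> avg2 \<Lambda> (\<lambda>\<epsilon> \<eta>. ?n * (\<Sum>t\<in>T. (1 / ?n)\<^sup>2 * (X t \<epsilon> \<eta>)\<^sup>2))"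
    by (rule avg2_mono, rule order_trans[OF sum_sq_le_card]) (simp add: power_divide)
  also have "\<dots> = ?n * (\<Sum>t\<in>T. (1 / ?n)\<^sup>2 * avg2 \<Lambda> (\<lambda>\<epsilon> \<eta>. (X t \<epsilon> \<eta>)\<^sup>2))"
    by (simp only: avg2_cmult avg2_sum)
  also have "\<dots> \<le> ?n * (\<Sum>t\<in>T. (1 / ?n)\<^sup>2 * M)" by (intro mult_left_mono sum_mono X) auto
  also have "\<dots> = M" using n by (simp add: power2_eq_square)
  finally show ?thesis .
qed

lemma avg2_add_sq_le:
  assumes "avg2 \<Lambda> (\<lambda>\<epsilon> \<eta>. (X \<epsilon> \<eta>)\<^sup>2) \<le> M" "avg2 \<Lambda> (\<lambda>\<epsilon> \<eta>. (Y \<epsilon> \<eta>)\<^sup>2) \<le> M'"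
  shows "avg2 \<Lambda> (\<lambda>\<epsilon> \<eta>. (X \<epsilon> \<eta> + Y \<epsilon> \<eta>)\<^sup>2) \<le> 2 * M + 2 * M'"
    and "avg2 \<Lambda> (\<lambda>\<epsilon> \<eta>. (X \<epsilon> \<eta> - Y \<epsilon> \<eta>)\<^sup>2) \<le> 2 * M + 2 * M'"
proof -
  have eq: "avg2 \<Lambda> (\<lambda>\<epsilon> \<eta>. 2 * (X \<epsilon> \<eta>)\<^sup>2 + 2 * (Y \<epsilon> \<eta>)\<^sup>2) \<le> 2 * M + 2 * M'"
    unfolding avg2_add avg2_cmult using assms by simp
  have "(a + b)\<^sup>2 \<le> 2 * a\<^sup>2 + 2 * b\<^sup>2" "(a - b)\<^sup>2 \<le> 2 * a\<^sup>2 + 2 * b\<^sup>2" for a b :: real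
    using zero_le_power2[of "a - b"] zero_le_power2[of "a + b"]
    unfolding power2_sum power2_diff by linarith+
  then show "avg2 \<Lambda> (\<lambda>\<epsilon> \<eta>. (X \<epsilon> \<eta> + Y \<epsilon> \<eta>)\<^sup>2) \<le> 2 * M + 2 * M'"
     "avg2 \<Lambda> (\<lambda>\<epsilon> \<eta>. (X \<epsilon> \<eta> - Y \<epsilon> \<eta>)\<^sup>2) \<le> 2 * M + 2 * M'"
    by (auto intro!: order_trans[OF avg2_mono eq])
qed

definition scale_ratio :: "nat \<Rightarrow> nat \<Rightarrow> real" where
  "scale_ratio i j = 2 ^ min i j / 2 ^ max i j"

lemma scale_ratio_row: "(\<Sum>j<n. scale_ratio i j) \<le> 3"
proof -
  have 1: "(\<Sum>j<n. if j < i then 2 ^ j / 2 ^ i else 0 :: real) \<le> 2 ^ min n i / 2 ^ i"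
  proof (induction n)
    case (Suc n)
    show ?case
    proof (cases "n < i")
      case True
      then have "min n i = n" "min (Suc n) i = Suc n" by auto
      then show ?thesis using Suc True by (simp add: field_simps)
    next
      case False
      then have "min n i = i" "min (Suc n) i = i" by auto
      then show ?thesis using Suc False by simp
    qed
  qed simp
  have 2: "(\<Sum>j<n. if i \<le> j then 2 ^ i / 2 ^ j else 0 :: real) = (if n \<le> i then 0 else 2 - 2 * 2 ^ i / 2 ^ n)"
  proof (induction n)
    case (Suc n)
    then show ?case by (cases "n = i") (auto simp: field_simps)
  qed simp
  have "(\<Sum>j<n. scale_ratio i j)
      = (\<Sum>j<n. (if j < i then 2 ^ j / 2 ^ i else 0) + (if i \<le> j then 2 ^ i / 2 ^ j else 0))"
    by (intro sum.cong refl) (auto simp: scale_ratio_def min_def max_def)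
  also have "\<dots> \<le> 2 ^ min n i / 2 ^ i + (if n \<le> i then 0 else 2 - 2 * 2 ^ i / 2 ^ n)"
    unfolding sum.distrib using 1 2 by linarith
  also have "\<dots> \<le> 1 + 2"
  proof (rule add_mono)
    have "(2::real) ^ min n i \<le> 2 ^ i" by (intro power_increasing) auto
    then show "(2::real) ^ min n i / 2 ^ i \<le> 1" by simp
    show "(if n \<le> i then 0 else 2 - 2 * 2 ^ i / 2 ^ n :: real) \<le> 2" by simp
  qed
  finally show ?thesis by simp
qed

lemma scale_ratio_sum: "(\<Sum>i<n. \<Sum>j<n. scale_ratio i j) \<le> 3 * real n"
  using sum_mono[of "{..<n}" "\<lambda>i. \<Sum>j<n. scale_ratio i j" "\<lambda>_. 3"] scale_ratio_row by simp

lemma scale_ratio_nonneg: "0 \<le> scale_ratio i j"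
  by (simp add: scale_ratio_def)

lemma sum_inverse_max: "(\<Sum>i<n. \<Sum>j<n. 1 / 2 ^ max i j :: real) \<le> 6"
proof -
  have "(\<Sum>i<n. \<Sum>j<n. 1 / 2 ^ max i j :: real) = 6 - (4 * real n + 6) / 2 ^ n"
  proof (induction n)
    case (Suc n)
    have 1: "(\<Sum>j<n. 1 / 2 ^ max j n :: real) = real n / 2 ^ n"
      by (simp add: max_absorb2 cong: sum.cong_simp)
    have 2: "(\<Sum>j<n. 1 / 2 ^ max n j :: real) = real n / 2 ^ n"
      by (simp add: max_absorb1 cong: sum.cong_simp)
    have "(\<Sum>i<Suc n. \<Sum>j<Suc n. 1 / 2 ^ max i j :: real)
       = (\<Sum>i<n. \<Sum>j<n. 1 / 2 ^ max i j) + real n / 2 ^ n + (real n / 2 ^ n + 1 / 2 ^ n)"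
      using 1 2 by (simp add: sum.distrib add_divide_distrib)
    also have "\<dots> = 6 - (4 * real (Suc n) + 6) / 2 ^ Suc n"
      unfolding Suc by (simp add: field_simps)
    finally show ?case .
  qed simp
  then show ?thesis by simp
qed

section \<open>Summation by parts on a box\<close>

definition box_sum :: "int \<Rightarrow> (int \<Rightarrow> int \<Rightarrow> real) \<Rightarrow> real" where
  "box_sum M \<phi> = (\<Sum>x\<in>{-M..M}. \<Sum>y\<in>{-M..M}. \<phi> x y)"

lemma box_sum_add: "box_sum M (\<lambda>x y. a x y + b x y) = box_sum M a + box_sum M b"
  by (simp add: box_sum_def sum.distrib)

lemma box_sum_diff: "box_sum M (\<lambda>x y. a x y - b x y) = box_sum M a - box_sum M b"
  by (simp add: box_sum_def sum_subtractf)

lemma box_sum_cmult: "box_sum M (\<lambda>x y. c * a x y) = c * box_sum M a"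
  by (simp add: box_sum_def sum_distrib_left)

lemma box_sum_uminus: "box_sum M (\<lambda>x y. - a x y) = - box_sum M a"
  by (simp add: box_sum_def sum_negf)

lemma box_sum_sum: "box_sum M (\<lambda>x y. \<Sum>i\<in>I. a i x y) = (\<Sum>i\<in>I. box_sum M (a i))"
  unfolding box_sum_def by (simp add: sum.swap[of _ I])

lemma box_sum_cong: "(\<And>x y. a x y = b x y) \<Longrightarrow> box_sum M a = box_sum M b"
  by (simp add: box_sum_def)

lemma box_sum_mono: "(\<And>x y. a x y \<le> b x y) \<Longrightarrow> box_sum M a \<le> box_sum M b"
  unfolding box_sum_def by (intro sum_mono)

lemma box_sum_nonneg: "(\<And>x y. 0 \<le> a x y) \<Longrightarrow> 0 \<le> box_sum M a"
  unfolding box_sum_def by (intro sum_nonneg)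

lemma box_sum_transpose: "box_sum M (\<lambda>x y. a y x) = box_sum M a"
  unfolding box_sum_def by (rule sum.swap)

definition cdx :: "(int \<Rightarrow> int \<Rightarrow> real) \<Rightarrow> int \<Rightarrow> int \<Rightarrow> real" where
  "cdx g x y = (g (x + 1) y - g (x - 1) y) / 2"
definition cdy :: "(int \<Rightarrow> int \<Rightarrow> real) \<Rightarrow> int \<Rightarrow> int \<Rightarrow> real" where
  "cdy g x y = (g x (y + 1) - g x (y - 1)) / 2"
definition fdx :: "(int \<Rightarrow> int \<Rightarrow> real) \<Rightarrow> int \<Rightarrow> int \<Rightarrow> real" where
  "fdx g x y = g (x + 1) y - g x y"
definition fdy :: "(int \<Rightarrow> int \<Rightarrow> real) \<Rightarrow> int \<Rightarrow> int \<Rightarrow> real" where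
  "fdy g x y = g x (y + 1) - g x y"

definition supported :: "int \<Rightarrow> (int \<Rightarrow> int \<Rightarrow> real) \<Rightarrow> bool" where
  "supported R g \<longleftrightarrow> (\<forall>x y. \<bar>x\<bar> > R \<or> \<bar>y\<bar> > R \<longrightarrow> g x y = 0)"

lemma supported_mono: "supported R g \<Longrightarrow> R \<le> R' \<Longrightarrow> supported R' g"
  unfolding supported_def by auto

lemma supported_diffs:
  assumes "supported R g"
  shows "supported (R + 1) (cdx g)" "supported (R + 1) (cdy g)" "supported (R + 1) (fdx g)" "supported (R + 1) (fdy g)"
  using assms unfolding supported_def cdx_def cdy_def fdx_def fdy_def by auto

lemma sum_shift_up:
  fixes a h :: "int \<Rightarrow> real"
  assumes "\<And>x. \<bar>x\<bar> \<ge> M \<Longrightarrow> h x = 0"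
  shows "(\<Sum>x\<in>{-M..M}. a (x + 1) * h x) = (\<Sum>x\<in>{-M..M}. a x * h (x - 1))"
proof -
  have "(\<Sum>x\<in>{-M..M}. a (x + 1) * h x) = (\<Sum>x\<in>{-M..M - 1}. a (x + 1) * h x)"
    by (rule sum.mono_neutral_right) (use assms in auto)
  also have "\<dots> = (\<Sum>x\<in>{-M + 1..M}. a x * h (x - 1))"
    by (rule sum.reindex_bij_witness[where i="\<lambda>x. x - 1" and j="\<lambda>x. x + 1"]) auto
  also have "\<dots> = (\<Sum>x\<in>{-M..M}. a x * h (x - 1))"
    by (rule sum.mono_neutral_left) (use assms in auto)
  finally show ?thesis .
qed

lemma sum_shift_down:
  fixes a h :: "int \<Rightarrow> real"
  assumes "\<And>x. \<bar>x\<bar> \<ge> M \<Longrightarrow> h x = 0"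
  shows "(\<Sum>x\<in>{-M..M}. a (x - 1) * h x) = (\<Sum>x\<in>{-M..M}. a x * h (x + 1))"
proof -
  have "(\<Sum>x\<in>{-M..M}. a (x - 1) * h x) = (\<Sum>x\<in>{-M + 1..M}. a (x - 1) * h x)"
    by (rule sum.mono_neutral_right) (use assms in auto)
  also have "\<dots> = (\<Sum>x\<in>{-M..M - 1}. a x * h (x + 1))"
    by (rule sum.reindex_bij_witness[where i="\<lambda>x. x + 1" and j="\<lambda>x. x - 1"]) auto
  also have "\<dots> = (\<Sum>x\<in>{-M..M}. a x * h (x + 1))"
    by (rule sum.mono_neutral_left) (use assms in auto)
  finally show ?thesis .
qed

lemma box_sum_swap: "box_sum M \<phi> = (\<Sum>y\<in>{-M..M}. \<Sum>x\<in>{-M..M}. \<phi> x y)"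
  unfolding box_sum_def by (rule sum.swap)

lemma box_sum_shift:
  assumes "supported R h" "R < M"
  shows "box_sum M (\<lambda>x y. a (x + 1) y * h x y) = box_sum M (\<lambda>x y. a x y * h (x - 1) y)"
    and "box_sum M (\<lambda>x y. a (x - 1) y * h x y) = box_sum M (\<lambda>x y. a x y * h (x + 1) y)"
    and "box_sum M (\<lambda>x y. a x (y + 1) * h x y) = box_sum M (\<lambda>x y. a x y * h x (y - 1))"
    and "box_sum M (\<lambda>x y. a x (y - 1) * h x y) = box_sum M (\<lambda>x y. a x y * h x (y + 1))"
proof -
  have v: "h x y = 0" if "\<bar>x\<bar> \<ge> M \<or> \<bar>y\<bar> \<ge> M" for x y
    using assms that unfolding supported_def by auto
  have vx: "\<bar>x\<bar> \<ge> M \<Longrightarrow> h x y = 0" and vy: "\<bar>y\<bar> \<ge> M \<Longrightarrow> h x y = 0" for x y using v by auto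
  show "box_sum M (\<lambda>x y. a (x + 1) y * h x y) = box_sum M (\<lambda>x y. a x y * h (x - 1) y)"
    unfolding box_sum_swap by (rule sum.cong[OF refl]) (rule sum_shift_up[where a="\<lambda>x. a x _" and h="\<lambda>x. h x _", OF vx])
  show "box_sum M (\<lambda>x y. a (x - 1) y * h x y) = box_sum M (\<lambda>x y. a x y * h (x + 1) y)"
    unfolding box_sum_swap by (rule sum.cong[OF refl]) (rule sum_shift_down[where a="\<lambda>x. a x _" and h="\<lambda>x. h x _", OF vx])
  show "box_sum M (\<lambda>x y. a x (y + 1) * h x y) = box_sum M (\<lambda>x y. a x y * h x (y - 1))"
    unfolding box_sum_def by (rule sum.cong[OF refl]) (rule sum_shift_up[where a="a _" and h="h _", OF vy])
  show "box_sum M (\<lambda>x y. a x (y - 1) * h x y) = box_sum M (\<lambda>x y. a x y * h x (y + 1))"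
    unfolding box_sum_def by (rule sum.cong[OF refl]) (rule sum_shift_down[where a="a _" and h="h _", OF vy])
qed

lemma sbp_cdx: "supported R h \<Longrightarrow> R < M \<Longrightarrow> box_sum M (\<lambda>x y. cdx a x y * h x y) = - box_sum M (\<lambda>x y. a x y * cdx h x y)"
  and sbp_cdy: "supported R h \<Longrightarrow> R < M \<Longrightarrow> box_sum M (\<lambda>x y. cdy a x y * h x y) = - box_sum M (\<lambda>x y. a x y * cdy h x y)"
proof -
  assume a: "supported R h" "R < M"
  have "box_sum M (\<lambda>x y. cdx a x y * h x y)
      = 1/2 * (box_sum M (\<lambda>x y. a (x + 1) y * h x y) - box_sum M (\<lambda>x y. a (x - 1) y * h x y))"
    unfolding box_sum_diff[symmetric] box_sum_cmult[symmetric] by (rule box_sum_cong) (simp add: cdx_def algebra_simps diff_divide_distrib)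
  also have "\<dots> = 1/2 * (box_sum M (\<lambda>x y. a x y * h (x - 1) y) - box_sum M (\<lambda>x y. a x y * h (x + 1) y))"
    unfolding box_sum_shift[OF a] ..
  also have "\<dots> = box_sum M (\<lambda>x y. - (a x y * cdx h x y))"
    unfolding box_sum_diff[symmetric] box_sum_cmult[symmetric] by (rule box_sum_cong) (simp add: cdx_def algebra_simps diff_divide_distrib)
  finally show "box_sum M (\<lambda>x y. cdx a x y * h x y) = - box_sum M (\<lambda>x y. a x y * cdx h x y)"
    unfolding box_sum_uminus .
next
  assume a: "supported R h" "R < M"
  have "box_sum M (\<lambda>x y. cdy a x y * h x y)
      = 1/2 * (box_sum M (\<lambda>x y. a x (y + 1) * h x y) - box_sum M (\<lambda>x y. a x (y - 1) * h x y))"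
    unfolding box_sum_diff[symmetric] box_sum_cmult[symmetric] by (rule box_sum_cong) (simp add: cdy_def algebra_simps diff_divide_distrib)
  also have "\<dots> = 1/2 * (box_sum M (\<lambda>x y. a x y * h x (y - 1)) - box_sum M (\<lambda>x y. a x y * h x (y + 1)))"
    unfolding box_sum_shift[OF a] ..
  also have "\<dots> = box_sum M (\<lambda>x y. - (a x y * cdy h x y))"
    unfolding box_sum_diff[symmetric] box_sum_cmult[symmetric] by (rule box_sum_cong) (simp add: cdy_def algebra_simps diff_divide_distrib)
  finally show "box_sum M (\<lambda>x y. cdy a x y * h x y) = - box_sum M (\<lambda>x y. a x y * cdy h x y)"
    unfolding box_sum_uminus .
qed

lemma sbp_fdx: "supported R h \<Longrightarrow> R < M \<Longrightarrow> box_sum M (\<lambda>x y. (a x y - a (x - 1) y) * h x y) = - box_sum M (\<lambda>x y. a x y * fdx h x y)"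
  and sbp_fdy: "supported R h \<Longrightarrow> R < M \<Longrightarrow> box_sum M (\<lambda>x y. (a x y - a x (y - 1)) * h x y) = - box_sum M (\<lambda>x y. a x y * fdy h x y)"
proof -
  assume a: "supported R h" "R < M"
  have "box_sum M (\<lambda>x y. (a x y - a (x - 1) y) * h x y)
      = box_sum M (\<lambda>x y. a x y * h x y) - box_sum M (\<lambda>x y. a (x - 1) y * h x y)"
    unfolding box_sum_diff[symmetric] by (rule box_sum_cong) (simp add: algebra_simps)
  also have "\<dots> = box_sum M (\<lambda>x y. - (a x y * fdx h x y))"
    unfolding box_sum_shift[OF a] box_sum_diff[symmetric] by (rule box_sum_cong) (simp add: fdx_def algebra_simps)
  finally show "box_sum M (\<lambda>x y. (a x y - a (x - 1) y) * h x y) = - box_sum M (\<lambda>x y. a x y * fdx h x y)"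
    unfolding box_sum_uminus .
  have "box_sum M (\<lambda>x y. (a x y - a x (y - 1)) * h x y)
      = box_sum M (\<lambda>x y. a x y * h x y) - box_sum M (\<lambda>x y. a x (y - 1) * h x y)"
    unfolding box_sum_diff[symmetric] by (rule box_sum_cong) (simp add: algebra_simps)
  also have "\<dots> = box_sum M (\<lambda>x y. - (a x y * fdy h x y))"
    unfolding box_sum_shift[OF a] box_sum_diff[symmetric] by (rule box_sum_cong) (simp add: fdy_def algebra_simps)
  finally show "box_sum M (\<lambda>x y. (a x y - a x (y - 1)) * h x y) = - box_sum M (\<lambda>x y. a x y * fdy h x y)"
    unfolding box_sum_uminus .
qed

lemma diffs_commute: "fdx (cdy g) = cdy (fdx g)" "fdy (cdx g) = cdx (fdy g)" "cdx (cdy g) = cdy (cdx g)"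
  by (intro ext, simp add: fdx_def fdy_def cdx_def cdy_def field_simps)+

lemma exchange_backward_x:
  assumes g: "supported R g" and M: "R + 1 < M"
  shows "box_sum M (\<lambda>x y. ((X x - X (x - 1)) * Y y) * cdy g x y) = box_sum M (\<lambda>x y. (X x * central_diff Y y) * fdx g x y)"
proof -
  have "box_sum M (\<lambda>x y. ((X x - X (x - 1)) * Y y) * cdy g x y) = box_sum M (\<lambda>x y. (X x * Y y - X (x - 1) * Y y) * cdy g x y)"
    by (simp add: left_diff_distrib)
  also have "\<dots> = - box_sum M (\<lambda>x y. (X x * Y y) * fdx (cdy g) x y)"
    by (rule sbp_fdx[where a="\<lambda>x y. X x * Y y", OF supported_diffs(2)[OF g] M])
  also have "\<dots> = - box_sum M (\<lambda>x y. (X x * Y y) * cdy (fdx g) x y)"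
    unfolding diffs_commute ..
  also have "\<dots> = box_sum M (\<lambda>x y. cdy (\<lambda>x y. X x * Y y) x y * fdx g x y)"
    unfolding sbp_cdy[OF supported_diffs(3)[OF g] M] ..
  also have "\<dots> = box_sum M (\<lambda>x y. (X x * central_diff Y y) * fdx g x y)"
    by (simp add: cdy_def central_diff_def algebra_simps)
  finally show ?thesis .
qed

lemma exchange_backward_y:
  assumes g: "supported R g" and M: "R + 1 < M"
  shows "box_sum M (\<lambda>x y. (X x * (Y y - Y (y - 1))) * cdx g x y) = box_sum M (\<lambda>x y. (central_diff X x * Y y) * fdy g x y)"
proof -
  have "box_sum M (\<lambda>x y. (X x * (Y y - Y (y - 1))) * cdx g x y) = box_sum M (\<lambda>x y. (X x * Y y - X x * Y (y - 1)) * cdx g x y)"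
    by (simp add: right_diff_distrib)
  also have "\<dots> = - box_sum M (\<lambda>x y. (X x * Y y) * fdy (cdx g) x y)"
    by (rule sbp_fdy[where a="\<lambda>x y. X x * Y y", OF supported_diffs(1)[OF g] M])
  also have "\<dots> = - box_sum M (\<lambda>x y. (X x * Y y) * cdx (fdy g) x y)"
    unfolding diffs_commute ..
  also have "\<dots> = box_sum M (\<lambda>x y. cdx (\<lambda>x y. X x * Y y) x y * fdy g x y)"
    unfolding sbp_cdx[OF supported_diffs(4)[OF g] M] ..
  also have "\<dots> = box_sum M (\<lambda>x y. (central_diff X x * Y y) * fdy g x y)"
    by (simp add: cdx_def central_diff_def algebra_simps)
  finally show ?thesis .
qed

lemma exchange_central:
  assumes g: "supported R g" and M: "R + 1 < M"
  shows "box_sum M (\<lambda>x y. (central_diff X x * Y y) * cdy g x y) = box_sum M (\<lambda>x y. (X x * central_diff Y y) * cdx g x y)"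
proof -
  have "box_sum M (\<lambda>x y. (central_diff X x * Y y) * cdy g x y) = box_sum M (\<lambda>x y. cdx (\<lambda>x y. X x * Y y) x y * cdy g x y)"
    by (simp add: cdx_def central_diff_def algebra_simps)
  also have "\<dots> = - box_sum M (\<lambda>x y. (X x * Y y) * cdx (cdy g) x y)"
    by (rule sbp_cdx[OF supported_diffs(2)[OF g] M])
  also have "\<dots> = - box_sum M (\<lambda>x y. (X x * Y y) * cdy (cdx g) x y)"
    unfolding diffs_commute ..
  also have "\<dots> = box_sum M (\<lambda>x y. cdy (\<lambda>x y. X x * Y y) x y * cdx g x y)"
    unfolding sbp_cdy[OF supported_diffs(1)[OF g] M] ..
  also have "\<dots> = box_sum M (\<lambda>x y. (X x * central_diff Y y) * cdx g x y)"
    by (simp add: cdy_def central_diff_def algebra_simps)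
  finally show ?thesis .
qed

section \<open>The trial function at one scale\<close>

text \<open>
  The flow to be represented is \<open>(\<Psi> x * \<alpha> y, 0)\<close>. The field \<open>F j\<close> averages \<open>\<alpha> * \<epsilon>\<close> over the window
  \<open>2 ^ (8 * n + j)\<close>, so that \<open>\<epsilon> y * Fs \<epsilon> y = \<alpha> y + c1 \<epsilon> y\<close> with \<open>c1\<close> centred and of short memory.
  The vertical component \<open>\<Psi> x * \<eta> x * F j \<epsilon> y\<close> is split by replacing \<open>\<Psi> * \<eta>\<close> with its average
  \<open>AvL j\<close>, a fine part with primitive \<open>PhA j\<close>, and an intermediate part with primitive \<open>PhB j\<close>; by
  \<open>exchange_central\<close> the last becomes the horizontal flow \<open>PhB j \<eta> x * dF j \<epsilon> y\<close>, which the second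
  term of \<open>trial\<close> cancels because \<open>\<epsilon> y * Vs \<epsilon> y\<close> is close to \<open>1\<close>.
  The remaining error is \<open>(X1, X3)\<close> against central differences of \<open>g\<close>, and \<open>X4\<close>, \<open>X2\<close> against
  forward differences in \<open>x\<close> and \<open>y\<close>.
\<close>

locale cell =
  fixes \<Lambda> :: "int set" and k p :: nat and \<alpha> \<Psi> :: "int \<Rightarrow> real"
  assumes fin: "finite \<Lambda>" and big: "{- (8 * 2 ^ k)..8 * 2 ^ k} \<subseteq> \<Lambda>"
    and kp: "64 * 4 ^ p \<le> k"
    and \<alpha>_bound: "\<And>t. \<bar>\<alpha> t\<bar> \<le> 1 / 2 ^ k"
    and \<alpha>_supp: "vanishes_outside (4 * 2 ^ k) \<alpha>"
    and \<Psi>_bound: "\<And>t. \<bar>\<Psi> t\<bar> \<le> 1"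
    and \<Psi>_supp: "vanishes_outside (4 * 2 ^ k) \<Psi>"
    and \<Psi>_lip: "\<And>t. \<bar>fwd_diff \<Psi> t\<bar> \<le> 4 / 2 ^ k"
begin

definition n :: nat where "n = 4 ^ p"
definition wt :: real where "wt = 1 / real n"

definition F :: "nat \<Rightarrow> (int \<Rightarrow> real) \<Rightarrow> int \<Rightarrow> real" where
  "F j \<epsilon> = conv \<Lambda> (trap (8 * n + j)) (\<lambda>t. \<alpha> t * \<epsilon> t)"
definition dF :: "nat \<Rightarrow> (int \<Rightarrow> real) \<Rightarrow> int \<Rightarrow> real" where
  "dF j \<epsilon> = conv \<Lambda> (central_diff (trap (8 * n + j))) (\<lambda>t. \<alpha> t * \<epsilon> t)"
definition u :: "int \<Rightarrow> real" where
  "u d = (\<Sum>j<n. wt * trap (8 * n + j) d)"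
definition Fs :: "(int \<Rightarrow> real) \<Rightarrow> int \<Rightarrow> real" where
  "Fs \<epsilon> = conv \<Lambda> u (\<lambda>t. \<alpha> t * \<epsilon> t)"
definition V :: "nat \<Rightarrow> (int \<Rightarrow> real) \<Rightarrow> int \<Rightarrow> real" where
  "V i \<epsilon> = conv \<Lambda> (trap i) \<epsilon>"
definition v :: "int \<Rightarrow> real" where
  "v d = (\<Sum>i<n. wt * trap i d)"
definition Vs :: "(int \<Rightarrow> real) \<Rightarrow> int \<Rightarrow> real" where
  "Vs \<epsilon> = conv \<Lambda> v \<epsilon>"
definition PhA :: "nat \<Rightarrow> (int \<Rightarrow> real) \<Rightarrow> int \<Rightarrow> real" where
  "PhA j \<eta> = conv \<Lambda> (unif_prim (8 * n + j - p)) (\<lambda>t. \<Psi> t * \<eta> t)"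
definition PhB :: "nat \<Rightarrow> (int \<Rightarrow> real) \<Rightarrow> int \<Rightarrow> real" where
  "PhB j \<eta> = conv \<Lambda> (ramp_diff (8 * n + j - p) (8 * n + j + p)) (\<lambda>t. \<Psi> t * \<eta> t)"
definition AvL :: "nat \<Rightarrow> (int \<Rightarrow> real) \<Rightarrow> int \<Rightarrow> real" where
  "AvL j \<eta> = conv \<Lambda> (unif (8 * n + j + p)) (\<lambda>t. \<Psi> t * \<eta> t)"
definition mart :: "nat \<Rightarrow> (int \<Rightarrow> real) \<Rightarrow> int \<Rightarrow> real" where
  "mart j \<eta> x = \<eta> x * PhB j \<eta> x"
definition c1 :: "(int \<Rightarrow> real) \<Rightarrow> int \<Rightarrow> real" where
  "c1 \<epsilon> y = \<epsilon> y * Fs \<epsilon> y - \<alpha> y"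
definition cV :: "(int \<Rightarrow> real) \<Rightarrow> int \<Rightarrow> real" where
  "cV \<epsilon> y = \<epsilon> y * Vs \<epsilon> y - (if y \<in> \<Lambda> then 1 else 0)"
definition c2 :: "nat \<Rightarrow> (int \<Rightarrow> real) \<Rightarrow> int \<Rightarrow> real" where
  "c2 j \<epsilon> y = dF j \<epsilon> y * cV \<epsilon> y"

definition trial :: "(int \<Rightarrow> real) \<Rightarrow> (int \<Rightarrow> real) \<Rightarrow> int \<Rightarrow> int \<Rightarrow> real" where
  "trial \<epsilon> \<eta> x y = \<Psi> x * Fs \<epsilon> y - (\<Sum>j<n. wt * (PhB j \<eta> x * (dF j \<epsilon> y * Vs \<epsilon> y)))"
definition X1 :: "(int \<Rightarrow> real) \<Rightarrow> (int \<Rightarrow> real) \<Rightarrow> int \<Rightarrow> int \<Rightarrow> real" where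
  "X1 \<epsilon> \<eta> x y = \<Psi> x * conv \<Lambda> (unif k) (c1 \<epsilon>) y
     - (\<Sum>j<n. wt * (PhB j \<eta> x * conv \<Lambda> (unif (4 * n)) (c2 j \<epsilon>) y))"
definition X2 :: "(int \<Rightarrow> real) \<Rightarrow> (int \<Rightarrow> real) \<Rightarrow> int \<Rightarrow> int \<Rightarrow> real" where
  "X2 \<epsilon> \<eta> x y = central_diff \<Psi> x * conv \<Lambda> (unif_prim k) (c1 \<epsilon>) y
     - (\<Sum>j<n. wt * (central_diff (PhB j \<eta>) x * conv \<Lambda> (unif_prim (4 * n)) (c2 j \<epsilon>) y))"
definition X3 :: "(int \<Rightarrow> real) \<Rightarrow> (int \<Rightarrow> real) \<Rightarrow> int \<Rightarrow> int \<Rightarrow> real" where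
  "X3 \<epsilon> \<eta> x y = (\<Sum>j<n. wt * (AvL j \<eta> x * F j \<epsilon> y))
     - (\<Sum>(j, i)\<in>{..<n} \<times> {..<n}. wt\<^sup>2 * (conv \<Lambda> (unif i) (mart j \<eta>) x * (dF j \<epsilon> y * V i \<epsilon> y)))"
definition X4 :: "(int \<Rightarrow> real) \<Rightarrow> (int \<Rightarrow> real) \<Rightarrow> int \<Rightarrow> int \<Rightarrow> real" where
  "X4 \<epsilon> \<eta> x y = (\<Sum>j<n. wt * (PhA j \<eta> x * dF j \<epsilon> y))
     - (\<Sum>(j, i)\<in>{..<n} \<times> {..<n}. wt\<^sup>2 * (conv \<Lambda> (unif_prim i) (mart j \<eta>) x * central_diff (\<lambda>y. dF j \<epsilon> y * V i \<epsilon> y) y))"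

lemma n_pos: "n > 0" by (simp add: n_def)
lemma p_less_n: "p < n" unfolding n_def by (rule less_le_trans[OF less_exp power_mono]) auto
lemma k_ge: "64 * n \<le> k" using kp by (simp add: n_def)

lemma scale_le: "j < n \<Longrightarrow> (2::int) ^ (8 * n + j + p) \<le> 2 ^ k" "j < n \<Longrightarrow> 2 * (2::int) ^ (8 * n + j) \<le> 2 ^ k"
    "j < n \<Longrightarrow> (2::int) ^ (8 * n + j - p) \<le> 2 ^ k"
proof -
  assume j: "j < n"
  have "8 * n + j + p \<le> k" "Suc (8 * n + j) \<le> k" "8 * n + j - p \<le> k" using k_ge p_less_n j by linarith+
  then show "(2::int) ^ (8 * n + j + p) \<le> 2 ^ k" "2 * (2::int) ^ (8 * n + j) \<le> 2 ^ k" "(2::int) ^ (8 * n + j - p) \<le> 2 ^ k"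
    using power_increasing[of "Suc (8 * n + j)" k "2::int"] by (auto intro: power_increasing)
qed

lemma Fs_sum: "Fs \<epsilon> y = (\<Sum>j<n. wt * F j \<epsilon> y)"
  unfolding Fs_def F_def u_def conv_def by (simp add: sum_distrib_left sum_distrib_right sum.swap[of _ \<Lambda>] mult_ac)

lemma Vs_sum: "Vs \<epsilon> y = (\<Sum>i<n. wt * V i \<epsilon> y)"
  unfolding Vs_def V_def v_def conv_def by (simp add: sum_distrib_left sum_distrib_right sum.swap[of _ \<Lambda>] mult_ac)

lemma dF_eq: "dF j \<epsilon> = central_diff (F j \<epsilon>)"
  by (rule ext) (simp add: dF_def F_def central_diff_conv)

lemma vanishes_F: "j < n \<Longrightarrow> vanishes_outside (5 * 2 ^ k) (F j \<epsilon>)"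
  unfolding F_def by (rule vanishes_outside_conv[OF vanishes_outside_mult1[OF \<alpha>_supp] vanishes_outside_trap[OF scale_le(2)]]) auto

lemma vanishes_Fs: "vanishes_outside (5 * 2 ^ k) (Fs \<epsilon>)"
  unfolding Fs_sum[abs_def] by (intro vanishes_outside_sum vanishes_outside_mult2 vanishes_F) auto

lemma vanishes_dF: "j < n \<Longrightarrow> vanishes_outside (6 * 2 ^ k) (dF j \<epsilon>)"
  unfolding dF_eq by (rule vanishes_outside_central_diff[OF vanishes_F]) auto

lemma vanishes_PhB: "j < n \<Longrightarrow> vanishes_outside (5 * 2 ^ k) (PhB j \<eta>)"
  unfolding PhB_def
  by (rule vanishes_outside_conv[OF vanishes_outside_mult1[OF \<Psi>_supp] vanishes_outside_ramp_diff[OF _ scale_le(1)]]) auto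

lemma vanishes_PhA: "j < n \<Longrightarrow> vanishes_outside (5 * 2 ^ k) (PhA j \<eta>)"
  unfolding PhA_def
  by (rule vanishes_outside_conv[OF vanishes_outside_mult1[OF \<Psi>_supp] vanishes_outside_unif_prim[OF scale_le(3)]]) auto

lemma vanishes_AvL: "j < n \<Longrightarrow> vanishes_outside (5 * 2 ^ k) (AvL j \<eta>)"
  unfolding AvL_def
  by (rule vanishes_outside_conv[OF vanishes_outside_mult1[OF \<Psi>_supp] vanishes_outside_unif[OF scale_le(1)]]) auto

lemma vanishes_mart: "j < n \<Longrightarrow> vanishes_outside (5 * 2 ^ k) (mart j \<eta>)"
  unfolding mart_def[abs_def] by (intro vanishes_outside_mult2 vanishes_PhB)

lemma vanishes_c1: "vanishes_outside (5 * 2 ^ k) (c1 \<epsilon>)"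
  using vanishes_Fs[of \<epsilon>] \<alpha>_supp unfolding c1_def vanishes_outside_def by force

lemma vanishes_c2: "j < n \<Longrightarrow> vanishes_outside (6 * 2 ^ k) (c2 j \<epsilon>)"
  unfolding c2_def[abs_def] by (intro vanishes_outside_mult1 vanishes_dF)

lemma n_le_k: "i < n \<Longrightarrow> (2::int) ^ i \<le> 2 ^ k" "(2::int) ^ (4 * n) \<le> 2 ^ k"
  using k_ge by (auto intro!: power_increasing)

lemma outside_\<Lambda>: "vanishes_outside (8 * 2 ^ k) h \<Longrightarrow> t \<notin> \<Lambda> \<Longrightarrow> h t = 0"
proof -
  assume h: "vanishes_outside (8 * 2 ^ k) h" and "t \<notin> \<Lambda>"
  then have "t \<notin> {- (8 * 2 ^ k)..8 * 2 ^ k}" using big by blast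
  then have "\<bar>t\<bar> > 8 * 2 ^ k" by auto
  then show ?thesis using h unfolding vanishes_outside_def by blast
qed

lemma two_k: "(1::int) \<le> 2 ^ k" by simp

lemma supported_product:
  "vanishes_outside R X \<Longrightarrow> vanishes_outside R Y \<Longrightarrow> supported R (\<lambda>x y. X x * Y y)"
  unfolding supported_def vanishes_outside_def by auto

lemma supported_fields:
  "supported (6 * 2 ^ k) (trial \<epsilon> \<eta>)" "supported (8 * 2 ^ k) (X1 \<epsilon> \<eta>)" "supported (8 * 2 ^ k) (X2 \<epsilon> \<eta>)"
  "supported (8 * 2 ^ k) (X3 \<epsilon> \<eta>)" "supported (8 * 2 ^ k) (X4 \<epsilon> \<eta>)"
proof -
  have diff: "supported R (\<lambda>x y. a x y - b x y)" if "supported R a" "supported R b" for R a b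
    using that unfolding supported_def by auto
  have sm: "supported R (\<lambda>x y. \<Sum>i\<in>I. c i * a i x y)" if "\<And>i. i \<in> I \<Longrightarrow> supported R (a i)" for R and I :: "nat set" and a and c :: "nat \<Rightarrow> real"
    using that unfolding supported_def by (auto intro!: sum.neutral)
  have sm2: "supported R (\<lambda>x y. \<Sum>(j, i)\<in>I. c * a j i x y)" if "\<And>j i. (j, i) \<in> I \<Longrightarrow> supported R (a j i)" for R and I :: "(nat \<times> nat) set" and a and c :: real
    using that unfolding supported_def by (auto intro!: sum.neutral)
  note mono = vanishes_outside_mono
  note prod = supported_product
  have cv: "vanishes_outside (8 * 2 ^ k) (conv \<Lambda> U c)" if "vanishes_outside (6 * 2 ^ k) c" "vanishes_outside (2 ^ k) U" for U c
    by (rule vanishes_outside_conv[OF that]) auto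
  have un: "vanishes_outside (2 ^ k) (unif m)" "vanishes_outside (2 ^ k) (unif_prim m)" if "(2::int) ^ m \<le> 2 ^ k" for m
    by (intro vanishes_outside_unif vanishes_outside_unif_prim that)+
  have five: "(5::int) * 2 ^ k \<le> 6 * 2 ^ k" "(5::int) * 2 ^ k \<le> 8 * 2 ^ k" "(4::int) * 2 ^ k \<le> 8 * 2 ^ k" "(4::int) * 2 ^ k \<le> 6 * 2 ^ k" "(6::int) * 2 ^ k \<le> 8 * 2 ^ k"
     "(4::int) * 2 ^ k + 1 \<le> 8 * 2 ^ k" "(5::int) * 2 ^ k + 1 \<le> 8 * 2 ^ k" "(6::int) * 2 ^ k + 1 \<le> 8 * 2 ^ k"
    using two_k by linarith+
  show "supported (6 * 2 ^ k) (trial \<epsilon> \<eta>)"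
    unfolding trial_def
    by (intro diff sm prod mono[OF \<Psi>_supp] mono[OF vanishes_Fs] mono[OF vanishes_PhB] vanishes_outside_mult1 vanishes_dF five) auto
  show "supported (8 * 2 ^ k) (X1 \<epsilon> \<eta>)"
    unfolding X1_def
    by (intro diff sm prod mono[OF \<Psi>_supp] cv mono[OF vanishes_c1] vanishes_c2 mono[OF vanishes_PhB] un n_le_k order_refl five) auto
  show "supported (8 * 2 ^ k) (X2 \<epsilon> \<eta>)"
    unfolding X2_def
    by (intro diff sm prod vanishes_outside_central_diff[OF \<Psi>_supp] cv mono[OF vanishes_c1] vanishes_c2
         vanishes_outside_central_diff[OF vanishes_PhB] un n_le_k order_refl five) auto
  show "supported (8 * 2 ^ k) (X3 \<epsilon> \<eta>)"
    unfolding X3_def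
    by (intro diff sm sm2 prod mono[OF vanishes_AvL] mono[OF vanishes_F] cv mono[OF vanishes_mart] vanishes_outside_mult1
         mono[OF vanishes_dF] un n_le_k order_refl five) auto
  show "supported (8 * 2 ^ k) (X4 \<epsilon> \<eta>)"
    unfolding X4_def
    by (intro diff sm sm2 prod mono[OF vanishes_PhA] mono[OF vanishes_dF] cv mono[OF vanishes_mart] vanishes_outside_mult1
         vanishes_outside_central_diff[OF vanishes_outside_mult1[OF vanishes_dF]] un n_le_k order_refl five) auto
qed

lemma decompose_vertical:
  assumes g: "supported R g" and M: "R + 1 < M" and \<eta>: "\<eta> \<in> coins \<Lambda>" and j: "j < n"
  shows "box_sum M (\<lambda>x y. ((\<Psi> x * \<eta> x) * F j \<epsilon> y) * cdy g x y)
     = box_sum M (\<lambda>x y. (AvL j \<eta> x * F j \<epsilon> y) * cdy g x y)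
     + box_sum M (\<lambda>x y. (PhB j \<eta> x * dF j \<epsilon> y) * cdx g x y)
     + box_sum M (\<lambda>x y. (PhA j \<eta> x * dF j \<epsilon> y) * fdx g x y)"
proof -
  let ?m = "8 * n + j - p" and ?m' = "8 * n + j + p"
  have pos: "0 < ?m" "0 < ?m'" using p_less_n by auto
  have van: "t \<notin> \<Lambda> \<Longrightarrow> \<Psi> t * \<eta> t = 0" for t using \<eta> by (simp add: coins_outside)
  have cd: "central_diff (PhB j \<eta>) x = conv \<Lambda> (unif ?m) (\<lambda>t. \<Psi> t * \<eta> t) x - AvL j \<eta> x" for x
    unfolding PhB_def AvL_def central_diff_conv conv_diff[symmetric]
    by (intro conv_cong central_diff_ramp_diff pos)
  have "\<Psi> x * \<eta> x = AvL j \<eta> x + central_diff (PhB j \<eta>) x + (PhA j \<eta> x - PhA j \<eta> (x - 1))" for x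
    using conv_unif_decomp[where c="\<lambda>t. \<Psi> t * \<eta> t" and y=x and m="?m", OF fin van] unfolding cd PhA_def by simp
  note id = this
  have "box_sum M (\<lambda>x y. ((\<Psi> x * \<eta> x) * F j \<epsilon> y) * cdy g x y)
    = box_sum M (\<lambda>x y. (AvL j \<eta> x * F j \<epsilon> y) * cdy g x y + (central_diff (PhB j \<eta>) x * F j \<epsilon> y) * cdy g x y
         + ((PhA j \<eta> x - PhA j \<eta> (x - 1)) * F j \<epsilon> y) * cdy g x y)"
    by (intro box_sum_cong) (subst id, simp add: algebra_simps)
  then show ?thesis
    unfolding box_sum_add exchange_central[OF g M] exchange_backward_x[OF g M] dF_eq[symmetric] .
qed

lemma decompose_horizontal:
  assumes g: "supported R g" and M: "R + 1 < M" and van: "\<And>t. t \<notin> \<Lambda> \<Longrightarrow> c t = 0"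
  shows "box_sum M (\<lambda>x y. (X x * c y) * cdx g x y)
     = box_sum M (\<lambda>x y. (X x * conv \<Lambda> (unif m) c y) * cdx g x y)
     + box_sum M (\<lambda>x y. (central_diff X x * conv \<Lambda> (unif_prim m) c y) * fdy g x y)"
proof -
  let ?P = "conv \<Lambda> (unif_prim m) c"
  have dec: "c y = conv \<Lambda> (unif m) c y + (?P y - ?P (y - 1))" for y
    by (rule conv_unif_decomp[OF fin van])
  have "box_sum M (\<lambda>x y. (X x * c y) * cdx g x y)
     = box_sum M (\<lambda>x y. (X x * conv \<Lambda> (unif m) c y) * cdx g x y + (X x * (?P y - ?P (y - 1))) * cdx g x y)"
    by (intro box_sum_cong) (subst dec, simp add: algebra_simps)
  then show ?thesis unfolding box_sum_add exchange_backward_y[OF g M] .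
qed

lemma decompose_vertical_martingale:
  assumes g: "supported R g" and M: "R + 1 < M" and van: "\<And>t. t \<notin> \<Lambda> \<Longrightarrow> c t = 0"
  shows "box_sum M (\<lambda>x y. (c x * Y y) * cdy g x y)
     = box_sum M (\<lambda>x y. (conv \<Lambda> (unif m) c x * Y y) * cdy g x y)
     + box_sum M (\<lambda>x y. (conv \<Lambda> (unif_prim m) c x * central_diff Y y) * fdx g x y)"
proof -
  let ?P = "conv \<Lambda> (unif_prim m) c"
  have dec: "c y = conv \<Lambda> (unif m) c y + (?P y - ?P (y - 1))" for y
    by (rule conv_unif_decomp[OF fin van])
  have "box_sum M (\<lambda>x y. (c x * Y y) * cdy g x y)
     = box_sum M (\<lambda>x y. (conv \<Lambda> (unif m) c x * Y y) * cdy g x y + ((?P x - ?P (x - 1)) * Y y) * cdy g x y)"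
    by (intro box_sum_cong) (subst dec, simp add: algebra_simps)
  then show ?thesis unfolding box_sum_add exchange_backward_x[OF g M] .
qed

lemma box_sum_expand1:
  "box_sum M (\<lambda>x y. (a x y - (\<Sum>j<m. w * b j x y)) * h x y)
    = box_sum M (\<lambda>x y. a x y * h x y) - (\<Sum>j<m. w * box_sum M (\<lambda>x y. b j x y * h x y))"
proof -
  have "box_sum M (\<lambda>x y. (a x y - (\<Sum>j<m. w * b j x y)) * h x y)
    = box_sum M (\<lambda>x y. a x y * h x y - (\<Sum>j<m. w * (b j x y * h x y)))"
    by (intro box_sum_cong) (simp add: left_diff_distrib sum_distrib_right mult.assoc)
  then show ?thesis unfolding box_sum_diff box_sum_sum box_sum_cmult .
qed

lemma box_sum_expand2:
  "box_sum M (\<lambda>x y. ((\<Sum>j<m. w * b j x y) - (\<Sum>(j, i)\<in>I. w' * c j i x y)) * h x y)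
    = (\<Sum>j<m. w * box_sum M (\<lambda>x y. b j x y * h x y)) - (\<Sum>(j, i)\<in>I. w' * box_sum M (\<lambda>x y. c j i x y * h x y))"
proof -
  have "box_sum M (\<lambda>x y. ((\<Sum>j<m. w * b j x y) - (\<Sum>(j, i)\<in>I. w' * c j i x y)) * h x y)
    = box_sum M (\<lambda>x y. (\<Sum>j<m. w * (b j x y * h x y)) - (\<Sum>q\<in>I. w' * (c (fst q) (snd q) x y * h x y)))"
    by (intro box_sum_cong) (simp add: left_diff_distrib sum_distrib_right mult.assoc case_prod_unfold)
  then show ?thesis unfolding box_sum_diff box_sum_sum box_sum_cmult case_prod_unfold .
qed

lemma cell_identity:
  assumes g: "supported R g" and M: "R + 1 < M" and \<epsilon>: "\<epsilon> \<in> coins \<Lambda>" and \<eta>: "\<eta> \<in> coins \<Lambda>"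
  shows "box_sum M (\<lambda>x y. trial \<epsilon> \<eta> x y * (\<epsilon> y * cdx g x y + \<eta> x * cdy g x y))
    = box_sum M (\<lambda>x y. (\<Psi> x * \<alpha> y) * cdx g x y)
    + box_sum M (\<lambda>x y. X1 \<epsilon> \<eta> x y * cdx g x y) + box_sum M (\<lambda>x y. X2 \<epsilon> \<eta> x y * fdy g x y)
    + box_sum M (\<lambda>x y. X3 \<epsilon> \<eta> x y * cdy g x y) + box_sum M (\<lambda>x y. X4 \<epsilon> \<eta> x y * fdx g x y)"
proof -
  let ?I = "{..<n} \<times> {..<n}"
  have c1: "\<epsilon> y * Fs \<epsilon> y = \<alpha> y + c1 \<epsilon> y" for y by (simp add: c1_def)
  have c2: "dF j \<epsilon> y * (\<epsilon> y * Vs \<epsilon> y) = dF j \<epsilon> y + c2 j \<epsilon> y" if "j < n" for j y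
  proof (cases "y \<in> \<Lambda>")
    case False
    then have "dF j \<epsilon> y = 0" by (intro outside_\<Lambda>[OF vanishes_outside_mono[OF vanishes_dF[OF that]]]) auto
    then show ?thesis by (simp add: c2_def)
  qed (simp add: c2_def cV_def algebra_simps)
  have dV: "dF j \<epsilon> y * Vs \<epsilon> y = (\<Sum>i<n. wt * (dF j \<epsilon> y * V i \<epsilon> y))" for j y
    by (simp add: Vs_sum sum_distrib_left mult_ac)
  have pt: "trial \<epsilon> \<eta> x y * (\<epsilon> y * cdx g x y + \<eta> x * cdy g x y)
     = ((\<Psi> x * \<alpha> y) * cdx g x y + (\<Psi> x * c1 \<epsilon> y) * cdx g x y)
      + (((\<Sum>j<n. wt * (((\<Psi> x * \<eta> x) * F j \<epsilon> y) * cdy g x y))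
      - (\<Sum>j<n. wt * ((PhB j \<eta> x * dF j \<epsilon> y) * cdx g x y + (PhB j \<eta> x * c2 j \<epsilon> y) * cdx g x y)))
      - (\<Sum>q\<in>?I. wt\<^sup>2 * ((mart (fst q) \<eta> x * (dF (fst q) \<epsilon> y * V (snd q) \<epsilon> y)) * cdy g x y)))" for x y
  proof -
    have 1: "\<Psi> x * Fs \<epsilon> y * (\<epsilon> y * cdx g x y) = (\<Psi> x * \<alpha> y) * cdx g x y + (\<Psi> x * c1 \<epsilon> y) * cdx g x y"
      using c1[of y] by (simp add: c1_def algebra_simps)
    have 2: "\<Psi> x * Fs \<epsilon> y * (\<eta> x * cdy g x y) = (\<Sum>j<n. wt * (((\<Psi> x * \<eta> x) * F j \<epsilon> y) * cdy g x y))"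
      unfolding Fs_sum by (simp add: sum_distrib_left sum_distrib_right mult_ac)
    have 3: "(\<Sum>j<n. wt * (PhB j \<eta> x * (dF j \<epsilon> y * Vs \<epsilon> y))) * (\<epsilon> y * cdx g x y)
        = (\<Sum>j<n. wt * ((PhB j \<eta> x * dF j \<epsilon> y) * cdx g x y + (PhB j \<eta> x * c2 j \<epsilon> y) * cdx g x y))"
      unfolding sum_distrib_right
    proof (rule sum.cong[OF refl])
      fix j assume "j \<in> {..<n}"
      then have "dF j \<epsilon> y * (\<epsilon> y * Vs \<epsilon> y) = dF j \<epsilon> y + c2 j \<epsilon> y" using c2 by simp
      moreover have "wt * (PhB j \<eta> x * (dF j \<epsilon> y * Vs \<epsilon> y)) * (\<epsilon> y * cdx g x y)
         = wt * (PhB j \<eta> x * (dF j \<epsilon> y * (\<epsilon> y * Vs \<epsilon> y))) * cdx g x y" by (simp only: mult_ac)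
      ultimately show "wt * (PhB j \<eta> x * (dF j \<epsilon> y * Vs \<epsilon> y)) * (\<epsilon> y * cdx g x y)
         = wt * ((PhB j \<eta> x * dF j \<epsilon> y) * cdx g x y + (PhB j \<eta> x * c2 j \<epsilon> y) * cdx g x y)"
        by (simp add: algebra_simps)
    qed
    have 4: "(\<Sum>j<n. wt * (PhB j \<eta> x * (dF j \<epsilon> y * Vs \<epsilon> y))) * (\<eta> x * cdy g x y)
        = (\<Sum>q\<in>?I. wt\<^sup>2 * ((mart (fst q) \<eta> x * (dF (fst q) \<epsilon> y * V (snd q) \<epsilon> y)) * cdy g x y))"
    proof -
      have "(\<Sum>j<n. wt * (PhB j \<eta> x * (dF j \<epsilon> y * Vs \<epsilon> y))) * (\<eta> x * cdy g x y)
         = (\<Sum>j<n. \<Sum>i<n. wt\<^sup>2 * ((mart j \<eta> x * (dF j \<epsilon> y * V i \<epsilon> y)) * cdy g x y))"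
        unfolding dV sum_distrib_left sum_distrib_right mart_def power2_eq_square
        by (intro sum.cong refl) (simp only: mult_ac)
      then show ?thesis by (simp add: sum.cartesian_product case_prod_unfold)
    qed
    show ?thesis
      unfolding trial_def left_diff_distrib distrib_left 1 2 3 4 by simp
  qed
  have 5: "box_sum M (\<lambda>x y. (\<Psi> x * c1 \<epsilon> y) * cdx g x y)
     = box_sum M (\<lambda>x y. (\<Psi> x * conv \<Lambda> (unif k) (c1 \<epsilon>) y) * cdx g x y)
     + box_sum M (\<lambda>x y. (central_diff \<Psi> x * conv \<Lambda> (unif_prim k) (c1 \<epsilon>) y) * fdy g x y)"
    by (intro decompose_horizontal[OF g M] outside_\<Lambda>[OF vanishes_outside_mono[OF vanishes_c1]]) auto
  have 6: "box_sum M (\<lambda>x y. (PhB j \<eta> x * c2 j \<epsilon> y) * cdx g x y)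
     = box_sum M (\<lambda>x y. (PhB j \<eta> x * conv \<Lambda> (unif (4 * n)) (c2 j \<epsilon>) y) * cdx g x y)
     + box_sum M (\<lambda>x y. (central_diff (PhB j \<eta>) x * conv \<Lambda> (unif_prim (4 * n)) (c2 j \<epsilon>) y) * fdy g x y)" if "j < n" for j
    by (intro decompose_horizontal[OF g M] outside_\<Lambda>[OF vanishes_outside_mono[OF vanishes_c2[OF that]]]) auto
  have 7: "box_sum M (\<lambda>x y. (mart j \<eta> x * (dF j \<epsilon> y * V i \<epsilon> y)) * cdy g x y)
     = box_sum M (\<lambda>x y. (conv \<Lambda> (unif i) (mart j \<eta>) x * (dF j \<epsilon> y * V i \<epsilon> y)) * cdy g x y)
     + box_sum M (\<lambda>x y. (conv \<Lambda> (unif_prim i) (mart j \<eta>) x * central_diff (\<lambda>y. dF j \<epsilon> y * V i \<epsilon> y) y) * fdx g x y)"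
     if "j < n" for j i
    by (rule decompose_vertical_martingale[OF g M]) (rule outside_\<Lambda>[OF vanishes_outside_mono[OF vanishes_mart[OF that]]], auto)
  have A: "box_sum M (\<lambda>x y. X1 \<epsilon> \<eta> x y * cdx g x y)
     = box_sum M (\<lambda>x y. (\<Psi> x * conv \<Lambda> (unif k) (c1 \<epsilon>) y) * cdx g x y)
     - (\<Sum>j<n. wt * box_sum M (\<lambda>x y. (PhB j \<eta> x * conv \<Lambda> (unif (4 * n)) (c2 j \<epsilon>) y) * cdx g x y))"
    unfolding X1_def by (rule box_sum_expand1)
  have B: "box_sum M (\<lambda>x y. X2 \<epsilon> \<eta> x y * fdy g x y)
     = box_sum M (\<lambda>x y. (central_diff \<Psi> x * conv \<Lambda> (unif_prim k) (c1 \<epsilon>) y) * fdy g x y)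
     - (\<Sum>j<n. wt * box_sum M (\<lambda>x y. (central_diff (PhB j \<eta>) x * conv \<Lambda> (unif_prim (4 * n)) (c2 j \<epsilon>) y) * fdy g x y))"
    unfolding X2_def by (rule box_sum_expand1)
  have C: "box_sum M (\<lambda>x y. X3 \<epsilon> \<eta> x y * cdy g x y)
     = (\<Sum>j<n. wt * box_sum M (\<lambda>x y. (AvL j \<eta> x * F j \<epsilon> y) * cdy g x y))
     - (\<Sum>(j, i)\<in>?I. wt\<^sup>2 * box_sum M (\<lambda>x y. (conv \<Lambda> (unif i) (mart j \<eta>) x * (dF j \<epsilon> y * V i \<epsilon> y)) * cdy g x y))"
    unfolding X3_def by (rule box_sum_expand2)
  have D: "box_sum M (\<lambda>x y. X4 \<epsilon> \<eta> x y * fdx g x y)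
     = (\<Sum>j<n. wt * box_sum M (\<lambda>x y. (PhA j \<eta> x * dF j \<epsilon> y) * fdx g x y))
     - (\<Sum>(j, i)\<in>?I. wt\<^sup>2 * box_sum M (\<lambda>x y. (conv \<Lambda> (unif_prim i) (mart j \<eta>) x * central_diff (\<lambda>y. dF j \<epsilon> y * V i \<epsilon> y) y) * fdx g x y))"
    unfolding X4_def by (rule box_sum_expand2)
  have 8: "(\<Sum>j<n. wt * box_sum M (\<lambda>x y. ((\<Psi> x * \<eta> x) * F j \<epsilon> y) * cdy g x y))
     = (\<Sum>j<n. wt * box_sum M (\<lambda>x y. (AvL j \<eta> x * F j \<epsilon> y) * cdy g x y))
     + (\<Sum>j<n. wt * box_sum M (\<lambda>x y. (PhB j \<eta> x * dF j \<epsilon> y) * cdx g x y))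
     + (\<Sum>j<n. wt * box_sum M (\<lambda>x y. (PhA j \<eta> x * dF j \<epsilon> y) * fdx g x y))"
    unfolding sum.distrib[symmetric] distrib_left[symmetric]
    by (intro sum.cong refl arg_cong2[where f="(*)"] decompose_vertical[OF g M \<eta>]) auto
  have 9: "(\<Sum>j<n. wt * box_sum M (\<lambda>x y. (PhB j \<eta> x * c2 j \<epsilon> y) * cdx g x y))
     = (\<Sum>j<n. wt * box_sum M (\<lambda>x y. (PhB j \<eta> x * conv \<Lambda> (unif (4 * n)) (c2 j \<epsilon>) y) * cdx g x y))
     + (\<Sum>j<n. wt * box_sum M (\<lambda>x y. (central_diff (PhB j \<eta>) x * conv \<Lambda> (unif_prim (4 * n)) (c2 j \<epsilon>) y) * fdy g x y))"
    unfolding sum.distrib[symmetric] distrib_left[symmetric]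
    by (intro sum.cong refl arg_cong2[where f="(*)"] 6) auto
  have 10: "(\<Sum>q\<in>?I. wt\<^sup>2 * box_sum M (\<lambda>x y. (mart (fst q) \<eta> x * (dF (fst q) \<epsilon> y * V (snd q) \<epsilon> y)) * cdy g x y))
     = (\<Sum>(j, i)\<in>?I. wt\<^sup>2 * box_sum M (\<lambda>x y. (conv \<Lambda> (unif i) (mart j \<eta>) x * (dF j \<epsilon> y * V i \<epsilon> y)) * cdy g x y))
     + (\<Sum>(j, i)\<in>?I. wt\<^sup>2 * box_sum M (\<lambda>x y. (conv \<Lambda> (unif_prim i) (mart j \<eta>) x * central_diff (\<lambda>y. dF j \<epsilon> y * V i \<epsilon> y) y) * fdx g x y))"
    unfolding case_prod_unfold sum.distrib[symmetric] distrib_left[symmetric]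
    by (intro sum.cong refl arg_cong2[where f="(*)"] 7) auto
  have "box_sum M (\<lambda>x y. trial \<epsilon> \<eta> x y * (\<epsilon> y * cdx g x y + \<eta> x * cdy g x y))
    = box_sum M (\<lambda>x y. (\<Psi> x * \<alpha> y) * cdx g x y) + box_sum M (\<lambda>x y. (\<Psi> x * c1 \<epsilon> y) * cdx g x y)
    + (((\<Sum>j<n. wt * box_sum M (\<lambda>x y. ((\<Psi> x * \<eta> x) * F j \<epsilon> y) * cdy g x y))
    - (\<Sum>j<n. wt * (box_sum M (\<lambda>x y. (PhB j \<eta> x * dF j \<epsilon> y) * cdx g x y) + box_sum M (\<lambda>x y. (PhB j \<eta> x * c2 j \<epsilon> y) * cdx g x y))))
    - (\<Sum>q\<in>?I. wt\<^sup>2 * box_sum M (\<lambda>x y. (mart (fst q) \<eta> x * (dF (fst q) \<epsilon> y * V (snd q) \<epsilon> y)) * cdy g x y)))"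
    unfolding pt box_sum_add box_sum_diff box_sum_sum box_sum_cmult ..
  then show ?thesis
    unfolding distrib_left sum.distrib 5 8 9 10 A B C D by simp
qed

end

section \<open>Second moments at one scale\<close>

lemma avg_conv_conv_unweighted_le:
  assumes fin: "finite \<Lambda>" and U: "kernel_bound U b c" and W: "kernel_bound W b' c'"
  shows "\<bar>avg \<Lambda> (\<lambda>e. conv \<Lambda> U e y * conv \<Lambda> W e y')\<bar> \<le> b * b' * min c c'"
  using avg_conv_conv_le[OF fin U W, of "\<lambda>_. 1" 1 "\<lambda>_. 1" 1 y y'] by simp

lemma avg2_product_sq_le:
  assumes "avg \<Lambda> (\<lambda>\<eta>. (A \<eta>)\<^sup>2) \<le> a" "avg \<Lambda> (\<lambda>\<epsilon>. (B \<epsilon>)\<^sup>2) \<le> b"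
  shows "avg2 \<Lambda> (\<lambda>\<epsilon> \<eta>. (A \<eta> * B \<epsilon>)\<^sup>2) \<le> a * b"
proof -
  have "0 \<le> avg \<Lambda> (\<lambda>\<eta>. (A \<eta>)\<^sup>2)" "0 \<le> avg \<Lambda> (\<lambda>\<epsilon>. (B \<epsilon>)\<^sup>2)" by (auto intro: avg_nonneg)
  moreover have "avg2 \<Lambda> (\<lambda>\<epsilon> \<eta>. (A \<eta> * B \<epsilon>)\<^sup>2) = avg \<Lambda> (\<lambda>\<eta>. (A \<eta>)\<^sup>2) * avg \<Lambda> (\<lambda>\<epsilon>. (B \<epsilon>)\<^sup>2)"
    unfolding power_mult_distrib by (rule avg2_prod)
  ultimately show ?thesis using assms by (auto intro: mult_mono order_trans)
qed

lemma central_diff_mult: "central_diff (\<lambda>y. a y * b y) y = a (y + 1) * central_diff b y + central_diff a y * b (y - 1)"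
  by (simp add: central_diff_def field_simps)

lemma fwd_diff_mult: "fwd_diff (\<lambda>y. a y * b y) y = a (y + 1) * fwd_diff b y + fwd_diff a y * b y"
  by (simp add: fwd_diff_def field_simps)

context cell begin

text \<open>This is \<open>n powr (-3/2)\<close> relative to the square of the size \<open>2\<^sup>-\<^sup>k\<close> of the flow.\<close>

definition tgt :: real where "tgt = 1 / (4 ^ k * 8 ^ p)"

lemma tgt_nonneg: "0 \<le> tgt" by (simp add: tgt_def)

lemma four_k: "(1 / 2 ^ k) * (1 / 2 ^ k) = (1 / 4 ^ k :: real)" "(1 / 2 ^ k)\<^sup>2 = (1 / 4 ^ k :: real)"
  by (simp_all add: power2_eq_square flip: power_mult_distrib)

lemma three_p_le_n: "3 * p \<le> n"
proof -
  have "3 * p \<le> 4 ^ p"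
  proof (induction p)
    case (Suc p)
    have "3 \<le> 3 * (4::nat) ^ p" by simp
    with Suc have "3 * p + 3 \<le> 4 ^ p + 3 * 4 ^ p" by (rule add_mono)
    then show ?case by simp
  qed simp
  then show ?thesis by (simp add: n_def)
qed

lemma p_le: "p \<le> 8 * n + j" using p_less_n by simp

lemma tiny: "a + n \<le> b \<Longrightarrow> (2::real) ^ a / 2 ^ b \<le> 1 / 8 ^ p"
proof -
  assume "a + n \<le> b"
  then have "a + 3 * p \<le> b" using three_p_le_n by linarith
  then have "(2::real) ^ (a + 3 * p) \<le> 2 ^ b" by (intro power_increasing) auto
  moreover have "(2::real) ^ (3 * p) = 8 ^ p" using power_mult[of "2::real" 3 p] by simp
  ultimately show ?thesis by (simp add: power_add field_simps)
qed

lemma tiny_tgt: "a + n \<le> b \<Longrightarrow> 0 \<le> c \<Longrightarrow> c / 4 ^ k * (2 ^ a / 2 ^ b) \<le> c * tgt"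
  using mult_left_mono[OF tiny, of a b "c / 4 ^ k"] by (simp add: tgt_def field_simps)

lemma wt_card: "wt = 1 / real (card {..<n})" "wt\<^sup>2 = 1 / real (card ({..<n} \<times> {..<n}))"
  by (simp_all add: wt_def power2_eq_square)

lemma n_real: "real n = 4 ^ p" by (simp add: n_def)

lemma wt_nonneg: "0 \<le> wt" by (simp add: wt_def)
lemma sum_wt: "(\<Sum>j<n. wt) = 1" using n_pos by (simp add: wt_def)

lemma abs_mean_le: "(\<And>j. j < n \<Longrightarrow> \<bar>a j\<bar> \<le> c) \<Longrightarrow> \<bar>\<Sum>j<n. wt * a j\<bar> \<le> c"
proof -
  assume a: "\<And>j. j < n \<Longrightarrow> \<bar>a j\<bar> \<le> c"
  have "\<bar>\<Sum>j<n. wt * a j\<bar> \<le> (\<Sum>j<n. wt * c)"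
    by (rule order_trans[OF sum_abs sum_mono]) (use a wt_nonneg in \<open>auto simp: abs_mult intro!: mult_left_mono\<close>)
  also have "\<dots> = c" using sum_wt by (simp add: sum_distrib_right[symmetric])
  finally show ?thesis .
qed

lemma kernel_mean_trap:
  assumes "\<And>j. j < n \<Longrightarrow> s j \<le> m"
  shows "kernel_bound (\<lambda>d. \<Sum>j<n. wt * trap (s j) d) 1 (4 * 2 ^ m)"
proof (rule kernelI[where J="{- (2 * 2 ^ m)<..<2 * 2 ^ m}"])
  show "real (card {- (2 * 2 ^ m)<..<(2::int) * 2 ^ m}) \<le> 4 * 2 ^ m" by simp
  show "\<bar>\<Sum>j<n. wt * trap (s j) d\<bar> \<le> 1" for d
    by (rule abs_mean_le) (use trap_nonneg trap_le_1 in \<open>auto simp: abs_le_iff intro: order_trans[of _ 0]\<close>)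
  fix d assume "(\<Sum>j<n. wt * trap (s j) d) \<noteq> 0"
  then obtain j where j: "j < n" "trap (s j) d \<noteq> 0" by (metis (no_types, lifting) lessThan_iff mult_zero_right sum.neutral)
  then have "\<bar>d\<bar> < 2 * 2 ^ s j" using trap_eq_0[of "s j" d] by force
  moreover have "(2::int) ^ s j \<le> 2 ^ m" using assms j by simp
  ultimately have "\<bar>d\<bar> < 2 * 2 ^ m" by linarith
  then show "d \<in> {- (2 * 2 ^ m)<..<2 * 2 ^ m}" by auto
qed simp

lemma kernel_u: "kernel_bound u 1 (4 * 2 ^ (9 * n))"
  unfolding u_def[abs_def] by (rule kernel_mean_trap) auto

lemma kernel_v: "kernel_bound v 1 (4 * 2 ^ n)"
  unfolding v_def[abs_def] by (rule kernel_mean_trap) auto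

lemma u_0: "u 0 = 1" and v_0: "v 0 = 1"
  using sum_wt by (simp_all add: u_def v_def trap_eq_1)

text \<open>Far and near kernels read disjoint sets of coins, so their convolutions are independent.\<close>

definition near :: "(int \<Rightarrow> real) \<Rightarrow> bool" where "near W \<longleftrightarrow> (\<forall>d. W d \<noteq> 0 \<longrightarrow> \<bar>d\<bar> \<le> 2 * 2 ^ n + 1)"
definition far :: "(int \<Rightarrow> real) \<Rightarrow> bool" where "far U \<longleftrightarrow> (\<forall>d. U d \<noteq> 0 \<longrightarrow> 2 ^ (8 * n) - 2 \<le> \<bar>d\<bar>)"

lemma near_trap: "i < n \<Longrightarrow> near (trap i)"
proof -
  assume "i < n"
  then have le: "(2::int) ^ i \<le> 2 ^ n" by simp
  show ?thesis unfolding near_def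
  proof (intro allI impI)
    fix d assume "trap i d \<noteq> 0"
    then have "\<bar>d\<bar> < 2 * 2 ^ i" using trap_eq_0[of i d] by linarith
    then show "\<bar>d\<bar> \<le> 2 * 2 ^ n + 1" using le by linarith
  qed
qed

lemma near_mean: "(\<And>i. i < n \<Longrightarrow> near (h i)) \<Longrightarrow> near (\<lambda>d. \<Sum>i<n. wt * h i d)"
  unfolding near_def by (metis (no_types, lifting) lessThan_iff mult_zero_right sum.neutral)

lemma near_v: "near v"
  unfolding v_def[abs_def] by (intro near_mean near_trap)

lemma near_trap_diffs: "i < n \<Longrightarrow> near (central_diff (trap i))" "i < n \<Longrightarrow> near (fwd_diff (trap i))"
proof -
  assume "i < n"
  then have le: "(2::int) ^ i \<le> 2 ^ n" by simp
  have "\<bar>d\<bar> \<le> 2 * 2 ^ n + 1" if "central_diff (trap i) d \<noteq> 0" for d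
    using central_diff_trap_support[OF that] le by linarith
  then show "near (central_diff (trap i))" unfolding near_def by blast
  have "\<bar>d\<bar> \<le> 2 * 2 ^ n + 1" if "fwd_diff (trap i) d \<noteq> 0" for d
    using fwd_diff_trap_support[OF that] le by linarith
  then show "near (fwd_diff (trap i))" unfolding near_def by blast
qed

lemma fwd_v: "fwd_diff v d = (\<Sum>i<n. wt * fwd_diff (trap i) d)"
  unfolding fwd_diff_def v_def by (simp add: sum_subtractf right_diff_distrib)

lemma near_fwd_v: "near (fwd_diff v)"
  unfolding fwd_v[abs_def] by (intro near_mean near_trap_diffs)

lemma far_central_diff_trap: "far (central_diff (trap (8 * n + j)))"
proof -
  have le: "(2::int) ^ (8 * n) \<le> 2 ^ (8 * n + j)" by simp
  have "2 ^ (8 * n) - 2 \<le> \<bar>d\<bar>" if "central_diff (trap (8 * n + j)) d \<noteq> 0" for d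
    using central_diff_trap_support[OF that] le by linarith
  then show ?thesis unfolding far_def by blast
qed

lemma far_diff_central_diff_trap:
  "far (central_diff (central_diff (trap (8 * n + j))))" "far (fwd_diff (central_diff (trap (8 * n + j))))"
proof -
  have le: "(2::int) ^ (8 * n) \<le> 2 ^ (8 * n + j)" by simp
  have sup: "2 ^ (8 * n) \<le> \<bar>d\<bar> + 1" if "central_diff (trap (8 * n + j)) d \<noteq> 0" for d
    using central_diff_trap_support[OF that] le by linarith
  show "far (central_diff (central_diff (trap (8 * n + j))))"
    unfolding far_def
  proof (intro allI impI)
    fix d assume "central_diff (central_diff (trap (8 * n + j))) d \<noteq> 0"
    then have "central_diff (trap (8 * n + j)) (d + 1) \<noteq> 0 \<or> central_diff (trap (8 * n + j)) (d - 1) \<noteq> 0"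
      unfolding central_diff_def[of "central_diff (trap (8 * n + j))"] by auto
    then show "2 ^ (8 * n) - 2 \<le> \<bar>d\<bar>" using sup[of "d + 1"] sup[of "d - 1"] by linarith
  qed
  show "far (fwd_diff (central_diff (trap (8 * n + j))))"
    unfolding far_def
  proof (intro allI impI)
    fix d assume "fwd_diff (central_diff (trap (8 * n + j))) d \<noteq> 0"
    then have "central_diff (trap (8 * n + j)) (d + 1) \<noteq> 0 \<or> central_diff (trap (8 * n + j)) d \<noteq> 0"
      unfolding fwd_diff_def by auto
    then show "2 ^ (8 * n) - 2 \<le> \<bar>d\<bar>" using sup[of "d + 1"] sup[of d] by linarith
  qed
qed

lemma separation: "2 * (2::int) ^ n + 4 < 2 ^ (8 * n)" "2 * (2::int) ^ (4 * n) + 2 * 2 ^ n + 4 < 2 ^ (8 * n)"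
proof -
  have e: "(2::int) ^ (8 * n) = 2 ^ (4 * n) * 2 ^ (4 * n)" by (simp flip: power_add)
  have "(2::int) ^ 4 \<le> 2 ^ (4 * n)" using n_pos by (intro power_increasing) auto
  then have a: "(16::int) \<le> 2 ^ (4 * n)" by simp
  then have "16 * (2::int) ^ (4 * n) \<le> 2 ^ (8 * n)" unfolding e by (intro mult_right_mono) auto
  moreover have "(2::int) ^ n \<le> 2 ^ (4 * n)" by (intro power_increasing) auto
  ultimately show "2 * (2::int) ^ n + 4 < 2 ^ (8 * n)" "2 * (2::int) ^ (4 * n) + 2 * 2 ^ n + 4 < 2 ^ (8 * n)"
    using a by linarith+
qed

lemma avg_far_near:
  assumes U: "far U" "far U'" and W: "near W" "near W'" and yz: "\<bar>y - z\<bar> \<le> 1"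
  shows "avg \<Lambda> (\<lambda>e. (conv \<Lambda> U (\<lambda>t. \<alpha> t * e t) y * conv \<Lambda> W e z) * (conv \<Lambda> U' (\<lambda>t. \<alpha> t * e t) y * conv \<Lambda> W' e z))
     = avg \<Lambda> (\<lambda>e. conv \<Lambda> U (\<lambda>t. \<alpha> t * e t) y * conv \<Lambda> U' (\<lambda>t. \<alpha> t * e t) y) * avg \<Lambda> (\<lambda>e. conv \<Lambda> W e z * conv \<Lambda> W' e z)"
proof -
  define S where "S = {t. \<bar>z - t\<bar> > 2 * 2 ^ n + 1}"
  have S: "t \<in> S" if "2 ^ (8 * n) - 2 \<le> \<bar>y - t\<bar>" for t
  proof -
    have "\<bar>y - t\<bar> \<le> \<bar>y - z\<bar> + \<bar>z - t\<bar>" by simp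
    then show ?thesis unfolding S_def mem_Collect_eq using that separation(1) yz by linarith
  qed
  have c: "conv \<Lambda> U (\<lambda>t. \<alpha> t * e t) y = conv \<Lambda> U (\<lambda>t. \<alpha> t * e' t) y" if "far U" "\<And>t. t \<in> S \<Longrightarrow> e t = e' t" for U and e e' :: "int \<Rightarrow> real"
    by (rule conv_depends) (use that S in \<open>auto simp: far_def\<close>)
  have d: "conv \<Lambda> W e z = conv \<Lambda> W e' z" if "near W" "\<And>t. t \<notin> S \<Longrightarrow> e t = e' t" for W and e e' :: "int \<Rightarrow> real"
    by (rule conv_depends) (use that in \<open>force simp: near_def S_def\<close>)
  have "avg \<Lambda> (\<lambda>e. (conv \<Lambda> U (\<lambda>t. \<alpha> t * e t) y * conv \<Lambda> U' (\<lambda>t. \<alpha> t * e t) y) * (conv \<Lambda> W e z * conv \<Lambda> W' e z))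
     = avg \<Lambda> (\<lambda>e. conv \<Lambda> U (\<lambda>t. \<alpha> t * e t) y * conv \<Lambda> U' (\<lambda>t. \<alpha> t * e t) y) * avg \<Lambda> (\<lambda>e. conv \<Lambda> W e z * conv \<Lambda> W' e z)"
  proof (rule avg_indep[OF fin, where S=S])
    fix e e' :: "int \<Rightarrow> real" assume ee: "\<And>t. t \<in> S \<Longrightarrow> e t = e' t"
    have "conv \<Lambda> U (\<lambda>t. \<alpha> t * e t) y = conv \<Lambda> U (\<lambda>t. \<alpha> t * e' t) y" "conv \<Lambda> U' (\<lambda>t. \<alpha> t * e t) y = conv \<Lambda> U' (\<lambda>t. \<alpha> t * e' t) y"
      by (intro c U ee; assumption)+
    then show "conv \<Lambda> U (\<lambda>t. \<alpha> t * e t) y * conv \<Lambda> U' (\<lambda>t. \<alpha> t * e t) y = conv \<Lambda> U (\<lambda>t. \<alpha> t * e' t) y * conv \<Lambda> U' (\<lambda>t. \<alpha> t * e' t) y"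
      by (simp only:)
  next
    fix e e' :: "int \<Rightarrow> real" assume ee: "\<And>t. t \<notin> S \<Longrightarrow> e t = e' t"
    have "conv \<Lambda> W e z = conv \<Lambda> W e' z" "conv \<Lambda> W' e z = conv \<Lambda> W' e' z"
      by (intro d W ee; assumption)+
    then show "conv \<Lambda> W e z * conv \<Lambda> W' e z = conv \<Lambda> W e' z * conv \<Lambda> W' e' z" by (simp only:)
  qed
  then show ?thesis by (simp only: mult_ac)
qed

lemma avg_far_near_le:
  assumes "far U" "far U'" "near W" "near W'" "\<bar>y - z\<bar> \<le> 1"
    and k: "kernel_bound U b c" "kernel_bound U' b' c'" "kernel_bound W d m" "kernel_bound W' d' m'"
  shows "\<bar>avg \<Lambda> (\<lambda>e. (conv \<Lambda> U (\<lambda>t. \<alpha> t * e t) y * conv \<Lambda> W e z) * (conv \<Lambda> U' (\<lambda>t. \<alpha> t * e t) y * conv \<Lambda> W' e z))\<bar>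
    \<le> (1 / 4 ^ k * (b * b' * min c c')) * (d * d' * min m m')"
proof -
  have 1: "\<bar>avg \<Lambda> (\<lambda>e. conv \<Lambda> U (\<lambda>t. \<alpha> t * e t) y * conv \<Lambda> U' (\<lambda>t. \<alpha> t * e t) y)\<bar> \<le> 1 / 4 ^ k * (b * b' * min c c')"
    using avg_conv_conv_le[OF fin k(1,2), of \<alpha> "1 / 2 ^ k" \<alpha> "1 / 2 ^ k" y y] \<alpha>_bound unfolding four_k by blast
  have 2: "\<bar>avg \<Lambda> (\<lambda>e. conv \<Lambda> W e z * conv \<Lambda> W' e z)\<bar> \<le> d * d' * min m m'"
    by (rule avg_conv_conv_unweighted_le[OF fin k(3,4)])
  show ?thesis unfolding avg_far_near[OF assms(1-5)] abs_mult
    by (intro mult_mono 1 2 order_trans[OF abs_ge_zero 1]) auto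
qed

lemma avg_far_near_sq_le:
  assumes "far U" "near W" "\<bar>y - z\<bar> \<le> 1" and k: "kernel_bound U b c" "kernel_bound W d m"
  shows "avg \<Lambda> (\<lambda>e. (conv \<Lambda> U (\<lambda>t. \<alpha> t * e t) y * conv \<Lambda> W e z)\<^sup>2) \<le> (1 / 4 ^ k * (b\<^sup>2 * c)) * (d\<^sup>2 * m)"
  using avg_far_near_le[OF assms(1,1,2,2,3) k(1,1) k(2,2)] by (simp add: power2_eq_square)

lemma avg_alpha_sq_le: "kernel_bound U b c \<Longrightarrow> avg \<Lambda> (\<lambda>e. (conv \<Lambda> U (\<lambda>t. \<alpha> t * e t) y)\<^sup>2) \<le> 1 / 4 ^ k * (b\<^sup>2 * c)"
  using avg_conv_sq_le[OF fin, of U b c \<alpha> "1 / 2 ^ k" y] \<alpha>_bound unfolding four_k by blast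

lemma avg_Psi_sq_le: "kernel_bound U b c \<Longrightarrow> avg \<Lambda> (\<lambda>e. (conv \<Lambda> U (\<lambda>t. \<Psi> t * e t) y)\<^sup>2) \<le> b\<^sup>2 * c"
  using avg_conv_sq_le[OF fin, of U b c \<Psi> 1 y] \<Psi>_bound by simp

lemma avg_PhB_sq: "avg \<Lambda> (\<lambda>\<eta>. (PhB j \<eta> x)\<^sup>2) \<le> 2 ^ (8 * n + j + p)"
  unfolding PhB_def using avg_Psi_sq_le[OF kernel_ramp_diff[of "8 * n + j - p" "8 * n + j + p"], of x] by simp

lemma c1_window:
  assumes "kernel_bound W b c"
  shows "avg \<Lambda> (\<lambda>\<epsilon>. (conv \<Lambda> W (c1 \<epsilon>) y)\<^sup>2) \<le> 1 / 4 ^ k * (2 * (4 * 2 ^ (9 * n))) * (b\<^sup>2 * c)"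
proof (rule avg_conv_window_le[OF fin assms kernel_u])
  fix t s
  have "t \<notin> \<Lambda> \<Longrightarrow> \<alpha> t = 0" for t by (rule outside_\<Lambda>[OF vanishes_outside_mono[OF \<alpha>_supp]]) auto
  from avg_off_diagonal_le[where \<alpha>=\<alpha> and A="1 / 2 ^ k", OF fin u_0 kernel_u this \<alpha>_bound, of t s]
  show "\<bar>avg \<Lambda> (\<lambda>e. c1 e t * c1 e s)\<bar> \<le> 1 / 4 ^ k * ((if t = s then 4 * 2 ^ (9 * n) else 0) + \<bar>u (t - s)\<bar>)"
    unfolding c1_def Fs_def four_k .
qed simp

lemma c2_cov:
  assumes ts: "\<bar>t - s\<bar> \<le> 2 ^ (4 * n)"
  shows "\<bar>avg \<Lambda> (\<lambda>e. c2 j e t * c2 j e s)\<bar>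
    \<le> (1 / 4 ^ k * (5 / 2 ^ (8 * n + j))) * ((if t = s then 4 * 2 ^ n else 0) + \<bar>v (t - s)\<bar>)"
proof -
  let ?U = "central_diff (trap (8 * n + j))"
  define S where "S = {r. \<bar>t - r\<bar> \<le> 2 ^ (4 * n) + 2 * 2 ^ n + 1}"
  have dF: "dF j e y = dF j e' y" if "y = t \<or> y = s" "\<And>r. r \<notin> S \<Longrightarrow> e r = e' r" for y e e'
    unfolding dF_def
  proof (rule conv_depends)
    fix r assume "?U (y - r) \<noteq> 0"
    then have "2 ^ (8 * n) - 2 \<le> \<bar>y - r\<bar>" using far_central_diff_trap unfolding far_def by blast
    then have "r \<notin> S" unfolding S_def using separation(2) ts that(1) by auto
    then show "\<alpha> r * e r = \<alpha> r * e' r" using that(2) by simp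
  qed
  have nv: "\<bar>d\<bar> \<le> 2 * 2 ^ n + 1" if "v d \<noteq> 0" for d using near_v that unfolding near_def by blast
  have cV: "cV e y = cV e' y" if y: "y = t \<or> y = s" and ee: "\<And>r. r \<in> S \<Longrightarrow> e r = e' r" for y e e'
  proof -
    have "y \<in> S" unfolding S_def using y ts by (auto intro: order_trans)
    moreover have "Vs e y = Vs e' y" unfolding Vs_def
    proof (rule conv_depends)
      fix r assume "v (y - r) \<noteq> 0"
      then have "\<bar>y - r\<bar> \<le> 2 * 2 ^ n + 1" by (rule nv)
      then have "r \<in> S" unfolding S_def using y ts by auto
      then show "e r = e' r" by (rule ee)
    qed
    ultimately show ?thesis using ee by (simp add: cV_def)
  qed
  have "avg \<Lambda> (\<lambda>e. (cV e t * cV e s) * (dF j e t * dF j e s)) = avg \<Lambda> (\<lambda>e. cV e t * cV e s) * avg \<Lambda> (\<lambda>e. dF j e t * dF j e s)"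
  proof (rule avg_indep[OF fin, where S=S])
    fix e e' :: "int \<Rightarrow> real" assume ee: "\<And>t. t \<in> S \<Longrightarrow> e t = e' t"
    have "cV e t = cV e' t" "cV e s = cV e' s" by (rule cV[OF _ ee]; simp)+
    then show "cV e t * cV e s = cV e' t * cV e' s" by (simp only:)
  next
    fix e e' :: "int \<Rightarrow> real" assume ee: "\<And>t. t \<notin> S \<Longrightarrow> e t = e' t"
    have "dF j e t = dF j e' t" "dF j e s = dF j e' s" by (rule dF[OF _ ee]; simp)+
    then show "dF j e t * dF j e s = dF j e' t * dF j e' s" by (simp only:)
  qed
  then have eq: "avg \<Lambda> (\<lambda>e. c2 j e t * c2 j e s) = avg \<Lambda> (\<lambda>e. dF j e t * dF j e s) * avg \<Lambda> (\<lambda>e. cV e t * cV e s)"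
    unfolding c2_def by (simp only: mult_ac)
  have 1: "\<bar>avg \<Lambda> (\<lambda>e. dF j e t * dF j e s)\<bar> \<le> 1 / 4 ^ k * (5 / 2 ^ (8 * n + j))"
    using avg_conv_conv_le[OF fin kernel_central_diff_trap[of "8 * n + j"] kernel_central_diff_trap[of "8 * n + j"], of \<alpha> "1 / 2 ^ k" \<alpha> "1 / 2 ^ k" t s] \<alpha>_bound
    unfolding four_k dF_def by simp
  have 2: "\<bar>avg \<Lambda> (\<lambda>e. cV e t * cV e s)\<bar> \<le> (if t = s then 4 * 2 ^ n else 0) + \<bar>v (t - s)\<bar>"
  proof -
    let ?a = "\<lambda>t. if t \<in> \<Lambda> then 1 else 0 :: real"
    have ceq: "conv \<Lambda> v (\<lambda>t. ?a t * e t) y = Vs e y" for e y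
      unfolding Vs_def conv_def by (intro sum.cong) auto
    have "\<bar>avg \<Lambda> (\<lambda>e. (e t * conv \<Lambda> v (\<lambda>t. ?a t * e t) t - ?a t) * (e s * conv \<Lambda> v (\<lambda>t. ?a t * e t) s - ?a s))\<bar>
        \<le> 1\<^sup>2 * ((if t = s then 4 * 2 ^ n else 0) + \<bar>v (t - s)\<bar>)"
      by (rule avg_off_diagonal_le[OF fin v_0 kernel_v]) auto
    then show ?thesis unfolding ceq cV_def by simp
  qed
  show ?thesis unfolding eq abs_mult by (intro mult_mono 1 2 order_trans[OF abs_ge_zero 1]) auto
qed

lemma c2_window:
  assumes W: "kernel_bound W b c" and supp: "\<And>d. W d \<noteq> 0 \<Longrightarrow> 0 \<le> d \<and> d < 2 ^ (4 * n)"
  shows "avg \<Lambda> (\<lambda>\<epsilon>. (conv \<Lambda> W (c2 j \<epsilon>) y)\<^sup>2) \<le> 1 / 4 ^ k * (5 / 2 ^ (8 * n + j)) * (2 * (4 * 2 ^ n)) * (b\<^sup>2 * c)"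
proof (rule avg_conv_window_le[OF fin W kernel_v])
  fix t s assume "W (y - t) \<noteq> 0" "W (y - s) \<noteq> 0"
  then have "\<bar>t - s\<bar> \<le> 2 ^ (4 * n)" using supp[of "y - t"] supp[of "y - s"] by auto
  then show "\<bar>avg \<Lambda> (\<lambda>e. c2 j e t * c2 j e s)\<bar>
    \<le> 1 / 4 ^ k * (5 / 2 ^ (8 * n + j)) * ((if t = s then 4 * 2 ^ n else 0) + \<bar>v (t - s)\<bar>)"
    by (rule c2_cov)
qed simp

lemma avg_const_sq_le: "\<bar>a\<bar> \<le> b \<Longrightarrow> avg \<Lambda> (\<lambda>_. a\<^sup>2) \<le> b\<^sup>2"
  unfolding avg_const[OF fin] by (metis abs_ge_zero power2_abs power_mono)

lemma central_diff_Psi: "\<bar>central_diff \<Psi> x\<bar> \<le> 4 / 2 ^ k"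
  using \<Psi>_lip[of x] \<Psi>_lip[of "x - 1"] by (simp add: central_diff_fwd)

lemma mean_j_le:
  assumes "\<And>j. j < n \<Longrightarrow> avg2 \<Lambda> (\<lambda>\<epsilon> \<eta>. (X j \<epsilon> \<eta>)\<^sup>2) \<le> B"
  shows "avg2 \<Lambda> (\<lambda>\<epsilon> \<eta>. (\<Sum>j<n. wt * X j \<epsilon> \<eta>)\<^sup>2) \<le> B"
  unfolding wt_card(1) by (rule avg2_mean_sq_le) (use assms n_pos in auto)

lemma X1_moment: "avg2 \<Lambda> (\<lambda>\<epsilon> \<eta>. (X1 \<epsilon> \<eta> x y)\<^sup>2) \<le> 2000 * tgt"
proof -
  have 1: "avg2 \<Lambda> (\<lambda>\<epsilon> \<eta>. (\<Psi> x * conv \<Lambda> (unif k) (c1 \<epsilon>) y)\<^sup>2) \<le> 8 * tgt"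
  proof -
    have "avg2 \<Lambda> (\<lambda>\<epsilon> \<eta>. (\<Psi> x * conv \<Lambda> (unif k) (c1 \<epsilon>) y)\<^sup>2) \<le> 1\<^sup>2 * (1 / 4 ^ k * (2 * (4 * 2 ^ (9 * n))) * ((1 / 2 ^ k)\<^sup>2 * 2 ^ k))"
      by (rule avg2_product_sq_le[OF avg_const_sq_le[OF \<Psi>_bound] c1_window[OF kernel_unif]])
    also have "\<dots> = 8 / 4 ^ k * (2 ^ (9 * n) / 2 ^ k)" by (simp add: power2_eq_square)
    also have "\<dots> \<le> 8 * tgt" by (rule tiny_tgt) (use k_ge in auto)
    finally show ?thesis .
  qed
  have 2: "avg2 \<Lambda> (\<lambda>\<epsilon> \<eta>. (\<Sum>j<n. wt * (PhB j \<eta> x * conv \<Lambda> (unif (4 * n)) (c2 j \<epsilon>) y))\<^sup>2) \<le> 40 * tgt"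
  proof (rule mean_j_le)
    fix j assume "j < n"
    have "avg2 \<Lambda> (\<lambda>\<epsilon> \<eta>. (PhB j \<eta> x * conv \<Lambda> (unif (4 * n)) (c2 j \<epsilon>) y)\<^sup>2)
       \<le> 2 ^ (8 * n + j + p) * (1 / 4 ^ k * (5 / 2 ^ (8 * n + j)) * (2 * (4 * 2 ^ n)) * ((1 / 2 ^ (4 * n))\<^sup>2 * 2 ^ (4 * n)))"
      by (rule avg2_product_sq_le[OF avg_PhB_sq c2_window[OF kernel_unif]]) (auto simp: unif_def split: if_splits)
    also have "\<dots> = 40 / 4 ^ k * (2 ^ (p + n) / 2 ^ (4 * n))" by (simp add: power2_eq_square power_add)
    also have "\<dots> \<le> 40 * tgt" by (rule tiny_tgt) (use p_less_n in auto)
    finally show "avg2 \<Lambda> (\<lambda>\<epsilon> \<eta>. (PhB j \<eta> x * conv \<Lambda> (unif (4 * n)) (c2 j \<epsilon>) y)\<^sup>2) \<le> 40 * tgt" .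
  qed
  show ?thesis unfolding X1_def using avg2_add_sq_le(2)[OF 1 2] tgt_nonneg by simp
qed

lemma X2_moment: "avg2 \<Lambda> (\<lambda>\<epsilon> \<eta>. (X2 \<epsilon> \<eta> x y)\<^sup>2) \<le> 2000 * tgt"
proof -
  have 1: "avg2 \<Lambda> (\<lambda>\<epsilon> \<eta>. (central_diff \<Psi> x * conv \<Lambda> (unif_prim k) (c1 \<epsilon>) y)\<^sup>2) \<le> 128 * tgt"
  proof -
    have "avg2 \<Lambda> (\<lambda>\<epsilon> \<eta>. (central_diff \<Psi> x * conv \<Lambda> (unif_prim k) (c1 \<epsilon>) y)\<^sup>2) \<le> (4 / 2 ^ k)\<^sup>2 * (1 / 4 ^ k * (2 * (4 * 2 ^ (9 * n))) * (1\<^sup>2 * 2 ^ k))"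
      by (rule avg2_product_sq_le[OF avg_const_sq_le[OF central_diff_Psi] c1_window[OF kernel_unif_prim]])
    also have "\<dots> = 128 / 4 ^ k * (2 ^ (9 * n) / 2 ^ k)" by (simp add: power2_eq_square)
    also have "\<dots> \<le> 128 * tgt" by (rule tiny_tgt) (use k_ge in auto)
    finally show ?thesis .
  qed
  have 2: "avg2 \<Lambda> (\<lambda>\<epsilon> \<eta>. (\<Sum>j<n. wt * (central_diff (PhB j \<eta>) x * conv \<Lambda> (unif_prim (4 * n)) (c2 j \<epsilon>) y))\<^sup>2) \<le> 40 * tgt"
  proof (rule mean_j_le)
    fix j assume "j < n"
    let ?m = "8 * n + j - p" and ?m' = "8 * n + j + p"
    have pos: "0 < ?m" using p_less_n by linarith
    have id: "((1 / 2 ^ m)\<^sup>2 * 2 ^ m') * (1 / 4 ^ k * (5 / 2 ^ l) * (2 * (4 * 2 ^ n)) * (1\<^sup>2 * 2 ^ h))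
       = (40 / 4 ^ k * (2 ^ (m' + n + h) / 2 ^ (m + m + l)) :: real)" for m m' l h
      by (simp add: power2_eq_square power_add field_simps)
    have ph: "avg \<Lambda> (\<lambda>\<eta>. (central_diff (PhB j \<eta>) x)\<^sup>2) \<le> (1 / 2 ^ ?m)\<^sup>2 * 2 ^ ?m'"
      unfolding PhB_def central_diff_conv by (rule avg_Psi_sq_le[OF kernel_central_diff_ramp_diff[OF pos]]) auto
    have "avg2 \<Lambda> (\<lambda>\<epsilon> \<eta>. (central_diff (PhB j \<eta>) x * conv \<Lambda> (unif_prim (4 * n)) (c2 j \<epsilon>) y)\<^sup>2)
       \<le> ((1 / 2 ^ ?m)\<^sup>2 * 2 ^ ?m') * (1 / 4 ^ k * (5 / 2 ^ (8 * n + j)) * (2 * (4 * 2 ^ n)) * (1\<^sup>2 * 2 ^ (4 * n)))"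
      by (rule avg2_product_sq_le[OF ph c2_window[OF kernel_unif_prim]]) (auto simp: unif_prim_def split: if_splits)
    also have "\<dots> = 40 / 4 ^ k * (2 ^ (?m' + n + 4 * n) / 2 ^ (?m + ?m + (8 * n + j)))" by (rule id)
    also have "\<dots> \<le> 40 * tgt" by (rule tiny_tgt) (use p_less_n in auto)
    finally show "avg2 \<Lambda> (\<lambda>\<epsilon> \<eta>. (central_diff (PhB j \<eta>) x * conv \<Lambda> (unif_prim (4 * n)) (c2 j \<epsilon>) y)\<^sup>2) \<le> 40 * tgt" .
  qed
  show ?thesis unfolding X2_def using avg2_add_sq_le(2)[OF 1 2] tgt_nonneg by simp
qed

lemma multiscale_one:
  assumes "\<And>j j'. j < n \<Longrightarrow> j' < n \<Longrightarrow> \<bar>avg \<Lambda> (\<lambda>e. A j e * A j' e)\<bar> * \<bar>avg \<Lambda> (\<lambda>e. B j e * B j' e)\<bar> \<le> c / 4 ^ k / 2 ^ p * scale_ratio j j'"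
    and c: "0 \<le> c"
  shows "avg2 \<Lambda> (\<lambda>\<epsilon> \<eta>. (\<Sum>j<n. wt * (A j \<eta> * B j \<epsilon>))\<^sup>2) \<le> 3 * c * tgt"
proof -
  have "avg2 \<Lambda> (\<lambda>\<epsilon> \<eta>. (\<Sum>j<n. wt * (A j \<eta> * B j \<epsilon>))\<^sup>2) \<le> wt\<^sup>2 * (\<Sum>j<n. \<Sum>j'<n. c / 4 ^ k / 2 ^ p * scale_ratio j j')"
    by (rule avg2_sum_products_le) (use assms in auto)
  also have "\<dots> = wt\<^sup>2 * (c / 4 ^ k / 2 ^ p) * (\<Sum>j<n. \<Sum>j'<n. scale_ratio j j')"
    by (simp only: sum_distrib_left[symmetric] mult.assoc)
  also have "\<dots> \<le> wt\<^sup>2 * (c / 4 ^ k / 2 ^ p) * (3 * real n)"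
    by (intro mult_left_mono scale_ratio_sum) (use c in auto)
  also have "\<dots> = 3 * c * tgt"
  proof -
    have "(8::real) ^ p = 2 ^ p * 4 ^ p" by (simp flip: power_mult_distrib)
    then show ?thesis using n_pos by (simp add: wt_def tgt_def n_real field_simps power2_eq_square)
  qed
  finally show ?thesis .
qed

lemma multiscale_two:
  assumes "\<And>j i j' i'. j < n \<Longrightarrow> i < n \<Longrightarrow> j' < n \<Longrightarrow> i' < n \<Longrightarrow>
      \<bar>avg \<Lambda> (\<lambda>e. A j i e * A j' i' e)\<bar> * \<bar>avg \<Lambda> (\<lambda>e. B j i e * B j' i' e)\<bar> \<le> c / 4 ^ k * 2 ^ p * (scale_ratio j j' * scale_ratio i i')"
    and c: "0 \<le> c"
  shows "avg2 \<Lambda> (\<lambda>\<epsilon> \<eta>. (\<Sum>(j, i)\<in>{..<n} \<times> {..<n}. wt\<^sup>2 * (A j i \<eta> * B j i \<epsilon>))\<^sup>2) \<le> 9 * c * tgt"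
proof -
  let ?I = "{..<n} \<times> {..<n}"
  have "avg2 \<Lambda> (\<lambda>\<epsilon> \<eta>. (\<Sum>q\<in>?I. wt\<^sup>2 * (A (fst q) (snd q) \<eta> * B (fst q) (snd q) \<epsilon>))\<^sup>2)
     \<le> (wt\<^sup>2)\<^sup>2 * (\<Sum>q\<in>?I. \<Sum>r\<in>?I. c / 4 ^ k * 2 ^ p * (scale_ratio (fst q) (fst r) * scale_ratio (snd q) (snd r)))"
    by (rule avg2_sum_products_le) (use assms in auto)
  also have "\<dots> = (wt\<^sup>2)\<^sup>2 * (c / 4 ^ k * 2 ^ p) * (\<Sum>q\<in>?I. \<Sum>r\<in>?I. scale_ratio (fst q) (fst r) * scale_ratio (snd q) (snd r))"
    by (simp only: sum_distrib_left[symmetric] mult.assoc)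
  also have "(\<Sum>q\<in>?I. \<Sum>r\<in>?I. scale_ratio (fst q) (fst r) * scale_ratio (snd q) (snd r))
     = (\<Sum>j<n. \<Sum>j'<n. scale_ratio j j') * (\<Sum>i<n. \<Sum>i'<n. scale_ratio i i')"
  proof -
    have "(\<Sum>r\<in>?I. scale_ratio a (fst r) * scale_ratio b (snd r)) = (\<Sum>j'<n. scale_ratio a j') * (\<Sum>i'<n. scale_ratio b i')" for a b
      by (simp add: sum_product sum.cartesian_product case_prod_unfold)
    then have "(\<Sum>q\<in>?I. \<Sum>r\<in>?I. scale_ratio (fst q) (fst r) * scale_ratio (snd q) (snd r))
       = (\<Sum>q\<in>?I. (\<Sum>j'<n. scale_ratio (fst q) j') * (\<Sum>i'<n. scale_ratio (snd q) i'))" by simp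
    also have "\<dots> = (\<Sum>j<n. \<Sum>i<n. (\<Sum>j'<n. scale_ratio j j') * (\<Sum>i'<n. scale_ratio i i'))"
      by (simp only: sum.cartesian_product case_prod_unfold)
    also have "\<dots> = (\<Sum>j<n. \<Sum>j'<n. scale_ratio j j') * (\<Sum>i<n. \<Sum>i'<n. scale_ratio i i')"
      by (rule sum_product[symmetric])
    finally show ?thesis .
  qed
  also have "(wt\<^sup>2)\<^sup>2 * (c / 4 ^ k * 2 ^ p) * \<dots> \<le> (wt\<^sup>2)\<^sup>2 * (c / 4 ^ k * 2 ^ p) * ((3 * real n) * (3 * real n))"
    by (intro mult_left_mono mult_mono scale_ratio_sum sum_nonneg scale_ratio_nonneg) (use c in auto)
  also have "\<dots> = 9 * c * tgt"
  proof -
    have "(4::real) ^ p * 4 ^ p = 2 ^ p * 8 ^ p" by (simp flip: power_mult_distrib)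
    then show ?thesis using n_pos by (simp add: wt_def tgt_def n_real field_simps power2_eq_square)
  qed
  finally show ?thesis by (simp add: case_prod_unfold)
qed

lemma mean_pair_le:
  assumes "\<And>j i. j < n \<Longrightarrow> i < n \<Longrightarrow> avg2 \<Lambda> (\<lambda>\<epsilon> \<eta>. (X j i \<epsilon> \<eta>)\<^sup>2) \<le> B"
  shows "avg2 \<Lambda> (\<lambda>\<epsilon> \<eta>. (\<Sum>(j, i)\<in>{..<n} \<times> {..<n}. wt\<^sup>2 * X j i \<epsilon> \<eta>)\<^sup>2) \<le> B"
  unfolding wt_card(2) case_prod_unfold by (rule avg2_mean_sq_le) (use assms n_pos in auto)

lemma scale_ratio_shift: "scale_ratio (8 * n + j) (8 * n + j') = scale_ratio j j'"
  by (cases "j \<le> j'") (simp_all add: scale_ratio_def power_add)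

lemma AvL_cov: "\<bar>avg \<Lambda> (\<lambda>e. AvL j e x * AvL j' e x)\<bar>
    \<le> 1 / 2 ^ (8 * n + j + p) * (1 / 2 ^ (8 * n + j' + p)) * min (2 ^ (8 * n + j + p)) (2 ^ (8 * n + j' + p))"
  using avg_conv_conv_le[OF fin kernel_unif[of "8 * n + j + p"] kernel_unif[of "8 * n + j' + p"], of \<Psi> 1 \<Psi> 1 x x] \<Psi>_bound
  unfolding AvL_def by simp

lemma PhA_cov: "\<bar>avg \<Lambda> (\<lambda>e. PhA j e x * PhA j' e x)\<bar> \<le> min (2 ^ (8 * n + j - p)) (2 ^ (8 * n + j' - p))"
  using avg_conv_conv_le[OF fin kernel_unif_prim[of "8 * n + j - p"] kernel_unif_prim[of "8 * n + j' - p"], of \<Psi> 1 \<Psi> 1 x x] \<Psi>_bound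
  unfolding PhA_def by simp

lemma F_cov: "\<bar>avg \<Lambda> (\<lambda>e. F j e y * F j' e y)\<bar> \<le> 1 / 4 ^ k * min (4 * 2 ^ (8 * n + j)) (4 * 2 ^ (8 * n + j'))"
  using avg_conv_conv_le[OF fin kernel_trap[of "8 * n + j"] kernel_trap[of "8 * n + j'"], of \<alpha> "1 / 2 ^ k" \<alpha> "1 / 2 ^ k" y y] \<alpha>_bound
  unfolding F_def four_k by simp

lemma dF_cov: "\<bar>avg \<Lambda> (\<lambda>e. dF j e y * dF j' e y)\<bar>
    \<le> 1 / 4 ^ k * (1 / 2 ^ (8 * n + j) * (1 / 2 ^ (8 * n + j')) * min (5 * 2 ^ (8 * n + j)) (5 * 2 ^ (8 * n + j')))"
  using avg_conv_conv_le[OF fin kernel_central_diff_trap[of "8 * n + j"] kernel_central_diff_trap[of "8 * n + j'"], of \<alpha> "1 / 2 ^ k" \<alpha> "1 / 2 ^ k" y y] \<alpha>_bound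
  unfolding dF_def four_k by blast

lemma mart_cov:
  assumes W: "kernel_bound W b d" and W': "kernel_bound W' b' d'"
  shows "\<bar>avg \<Lambda> (\<lambda>e. conv \<Lambda> W (mart j e) x * conv \<Lambda> W' (mart j' e) x)\<bar>
    \<le> (b * b' * min d d') * min (2 ^ (8 * n + j + p)) (2 ^ (8 * n + j' + p))"
proof -
  have z: "ramp_diff (8 * n + j - p) (8 * n + j + p) d = 0" if "d \<le> 0" for d j
    using ramp_diff_support[of "8 * n + j - p" "8 * n + j + p" d] that by force
  have kr: "kernel_bound (ramp_diff (8 * n + j - p) (8 * n + j + p)) 1 (2 ^ (8 * n + j + p))" for j
    by (rule kernel_ramp_diff) simp
  show ?thesis
    unfolding mart_def[abs_def] PhB_def by (rule avg_conv_martingale_le[OF fin z z kr kr \<Psi>_bound W W'])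
qed

lemma mart_sq: "kernel_bound W b d \<Longrightarrow> avg \<Lambda> (\<lambda>e. (conv \<Lambda> W (mart j e) x)\<^sup>2) \<le> b\<^sup>2 * d * 2 ^ (8 * n + j + p)"
  using mart_cov[of W b d W b d j x j] by (simp add: power2_eq_square)

lemma scale_arith1: "(1 / 2 ^ (a + p) * (1 / 2 ^ (b + p)) * min (2 ^ (a + p)) (2 ^ (b + p))) * (1 / 4 ^ k * min (4 * 2 ^ a) (4 * 2 ^ b))
    = (4 / 4 ^ k / 2 ^ p * scale_ratio a b :: real)"
  by (cases "a \<le> b") (simp_all add: scale_ratio_def power_add field_simps)

lemma scale_arith2: "((1 / 2 ^ i * (1 / 2 ^ i') * min (2 ^ i) (2 ^ i')) * min (2 ^ (a + p)) (2 ^ (b + p)))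
     * ((1 / 4 ^ k * (1 / 2 ^ a * (1 / 2 ^ b) * min (5 * 2 ^ a) (5 * 2 ^ b))) * (1 * 1 * min (4 * 2 ^ i) (4 * 2 ^ i')))
    = (20 / 4 ^ k * 2 ^ p * (scale_ratio a b * scale_ratio i i') :: real)"
  by (cases "a \<le> b"; cases "i \<le> i'") (simp_all add: scale_ratio_def power_add field_simps)

lemma scale_arith3: "p \<le> a \<Longrightarrow> p \<le> b \<Longrightarrow> min (2 ^ (a - p)) (2 ^ (b - p)) * (1 / 4 ^ k * (1 / 2 ^ a * (1 / 2 ^ b) * min (5 * 2 ^ a) (5 * 2 ^ b)))
    = (5 / 4 ^ k / 2 ^ p * scale_ratio a b :: real)"
proof -
  assume "p \<le> a" "p \<le> b"
  then obtain a' b' where "a = a' + p" "b = b' + p" by (metis add.commute le_Suc_ex)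
  then show ?thesis
    by (cases "a' \<le> b'") (simp_all add: scale_ratio_def power_add field_simps)
qed

lemma scale_arith4: "((1 * 1 * min (2 ^ i) (2 ^ i')) * min (2 ^ (a + p)) (2 ^ (b + p)))
     * ((1 / 4 ^ k * (1 / 2 ^ a * (1 / 2 ^ b) * min (5 * 2 ^ a) (5 * 2 ^ b))) * (1 / 2 ^ i * (1 / 2 ^ i') * min (5 * 2 ^ i) (5 * 2 ^ i')))
    = (25 / 4 ^ k * 2 ^ p * (scale_ratio a b * scale_ratio i i') :: real)"
  by (cases "a \<le> b"; cases "i \<le> i'") (simp_all add: scale_ratio_def power_add field_simps)

lemma X3_moment: "avg2 \<Lambda> (\<lambda>\<epsilon> \<eta>. (X3 \<epsilon> \<eta> x y)\<^sup>2) \<le> 2000 * tgt"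
proof -
  have 1: "avg2 \<Lambda> (\<lambda>\<epsilon> \<eta>. (\<Sum>j<n. wt * (AvL j \<eta> x * F j \<epsilon> y))\<^sup>2) \<le> 3 * 4 * tgt"
  proof (rule multiscale_one)
    fix j j'
    show "\<bar>avg \<Lambda> (\<lambda>e. AvL j e x * AvL j' e x)\<bar> * \<bar>avg \<Lambda> (\<lambda>e. F j e y * F j' e y)\<bar> \<le> 4 / 4 ^ k / 2 ^ p * scale_ratio j j'"
      unfolding scale_ratio_shift[of j j', symmetric] scale_arith1[symmetric]
      by (intro mult_mono AvL_cov F_cov) (auto intro: order_trans[OF abs_ge_zero AvL_cov])
  qed simp
  have 2: "avg2 \<Lambda> (\<lambda>\<epsilon> \<eta>. (\<Sum>(j, i)\<in>{..<n} \<times> {..<n}. wt\<^sup>2 * (conv \<Lambda> (unif i) (mart j \<eta>) x * (dF j \<epsilon> y * V i \<epsilon> y)))\<^sup>2) \<le> 9 * 20 * tgt"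
  proof (rule multiscale_two[where A="\<lambda>j i \<eta>. conv \<Lambda> (unif i) (mart j \<eta>) x" and B="\<lambda>j i \<epsilon>. dF j \<epsilon> y * V i \<epsilon> y"])
    fix j i j' i' assume i: "i < n" "i' < n"
    note m = mart_cov[OF kernel_unif[of i] kernel_unif[of i'], of j x j']
    note d = avg_far_near_le[OF far_central_diff_trap[of j] far_central_diff_trap[of j'] near_trap[OF i(1)] near_trap[OF i(2)] _
        kernel_central_diff_trap kernel_central_diff_trap kernel_trap kernel_trap, of y y]
    show "\<bar>avg \<Lambda> (\<lambda>e. conv \<Lambda> (unif i) (mart j e) x * conv \<Lambda> (unif i') (mart j' e) x)\<bar>
        * \<bar>avg \<Lambda> (\<lambda>e. (dF j e y * V i e y) * (dF j' e y * V i' e y))\<bar> \<le> 20 / 4 ^ k * 2 ^ p * (scale_ratio j j' * scale_ratio i i')"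
      unfolding scale_ratio_shift[of j j', symmetric] scale_arith2[symmetric] dF_def V_def
      by (intro mult_mono m d order_trans[OF abs_ge_zero m]) auto
  qed simp
  show ?thesis unfolding X3_def using avg2_add_sq_le(2)[OF 1 2] tgt_nonneg by simp
qed

lemma X4_moment: "avg2 \<Lambda> (\<lambda>\<epsilon> \<eta>. (X4 \<epsilon> \<eta> x y)\<^sup>2) \<le> 2000 * tgt"
proof -
  let ?I = "{..<n} \<times> {..<n}"
  have 1: "avg2 \<Lambda> (\<lambda>\<epsilon> \<eta>. (\<Sum>j<n. wt * (PhA j \<eta> x * dF j \<epsilon> y))\<^sup>2) \<le> 3 * 5 * tgt"
  proof (rule multiscale_one)
    fix j j'
    show "\<bar>avg \<Lambda> (\<lambda>e. PhA j e x * PhA j' e x)\<bar> * \<bar>avg \<Lambda> (\<lambda>e. dF j e y * dF j' e y)\<bar> \<le> 5 / 4 ^ k / 2 ^ p * scale_ratio j j'"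
      unfolding scale_ratio_shift[of j j', symmetric] scale_arith3[OF p_le p_le, symmetric]
      by (intro mult_mono PhA_cov dF_cov) (auto intro: order_trans[OF abs_ge_zero PhA_cov])
  qed simp
  have 2: "avg2 \<Lambda> (\<lambda>\<epsilon> \<eta>. (\<Sum>(j, i)\<in>?I. wt\<^sup>2 * (conv \<Lambda> (unif_prim i) (mart j \<eta>) x * (dF j \<epsilon> (y + 1) * central_diff (V i \<epsilon>) y)))\<^sup>2) \<le> 9 * 25 * tgt"
  proof (rule multiscale_two[where A="\<lambda>j i \<eta>. conv \<Lambda> (unif_prim i) (mart j \<eta>) x" and B="\<lambda>j i \<epsilon>. dF j \<epsilon> (y + 1) * central_diff (V i \<epsilon>) y"])
    fix j i j' i' assume i: "i < n" "i' < n"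
    note m = mart_cov[OF kernel_unif_prim[of i] kernel_unif_prim[of i'], of j x j']
    note d = avg_far_near_le[OF far_central_diff_trap[of j] far_central_diff_trap[of j'] near_trap_diffs(1)[OF i(1)] near_trap_diffs(1)[OF i(2)] _
        kernel_central_diff_trap kernel_central_diff_trap kernel_central_diff_trap kernel_central_diff_trap, of "y + 1" y]
    show "\<bar>avg \<Lambda> (\<lambda>e. conv \<Lambda> (unif_prim i) (mart j e) x * conv \<Lambda> (unif_prim i') (mart j' e) x)\<bar>
        * \<bar>avg \<Lambda> (\<lambda>e. (dF j e (y + 1) * central_diff (V i e) y) * (dF j' e (y + 1) * central_diff (V i' e) y))\<bar> \<le> 25 / 4 ^ k * 2 ^ p * (scale_ratio j j' * scale_ratio i i')"
      unfolding scale_ratio_shift[of j j', symmetric] scale_arith4[symmetric] dF_def V_def central_diff_conv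
      by (intro mult_mono m d order_trans[OF abs_ge_zero m]) auto
  qed simp
  have 3: "avg2 \<Lambda> (\<lambda>\<epsilon> \<eta>. (\<Sum>(j, i)\<in>?I. wt\<^sup>2 * (conv \<Lambda> (unif_prim i) (mart j \<eta>) x * (central_diff (dF j \<epsilon>) y * V i \<epsilon> (y - 1))))\<^sup>2) \<le> 192 * tgt"
  proof (rule mean_pair_le)
    fix j i assume ji: "j < n" "i < n"
    have m: "avg \<Lambda> (\<lambda>e. (conv \<Lambda> (unif_prim i) (mart j e) x)\<^sup>2) \<le> 1\<^sup>2 * 2 ^ i * 2 ^ (8 * n + j + p)"
      by (rule mart_sq[OF kernel_unif_prim])
    have d: "avg \<Lambda> (\<lambda>e. (central_diff (dF j e) y * V i e (y - 1))\<^sup>2) \<le> (1 / 4 ^ k * ((2 / 2 ^ (8 * n + j))\<^sup>2 * 12)) * (1\<^sup>2 * (4 * 2 ^ i))"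
      unfolding dF_def V_def central_diff_conv
      by (rule avg_far_near_sq_le[OF far_diff_central_diff_trap(1) near_trap[OF ji(2)] _ kernel_central_central_diff_trap kernel_trap]) simp
    have id: "(1\<^sup>2 * 2 ^ i * 2 ^ (l + p)) * ((1 / 4 ^ k * ((2 / 2 ^ l)\<^sup>2 * 12)) * (1\<^sup>2 * (4 * 2 ^ i)))
       = (192 / 4 ^ k * (2 ^ (i + i + p) / 2 ^ l) :: real)" for l
      by (simp add: power2_eq_square power_add field_simps)
    have "avg2 \<Lambda> (\<lambda>\<epsilon> \<eta>. (conv \<Lambda> (unif_prim i) (mart j \<eta>) x * (central_diff (dF j \<epsilon>) y * V i \<epsilon> (y - 1)))\<^sup>2)
       \<le> (1\<^sup>2 * 2 ^ i * 2 ^ (8 * n + j + p)) * ((1 / 4 ^ k * ((2 / 2 ^ (8 * n + j))\<^sup>2 * 12)) * (1\<^sup>2 * (4 * 2 ^ i)))"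
      by (rule avg2_product_sq_le[OF m d])
    also have "\<dots> \<le> 192 * tgt"
      unfolding id by (rule tiny_tgt) (use ji p_less_n in auto)
    finally show "avg2 \<Lambda> (\<lambda>\<epsilon> \<eta>. (conv \<Lambda> (unif_prim i) (mart j \<eta>) x * (central_diff (dF j \<epsilon>) y * V i \<epsilon> (y - 1)))\<^sup>2) \<le> 192 * tgt" .
  qed
  have "X4 \<epsilon> \<eta> x y = (\<Sum>j<n. wt * (PhA j \<eta> x * dF j \<epsilon> y))
      - ((\<Sum>(j, i)\<in>?I. wt\<^sup>2 * (conv \<Lambda> (unif_prim i) (mart j \<eta>) x * (dF j \<epsilon> (y + 1) * central_diff (V i \<epsilon>) y)))
       + (\<Sum>(j, i)\<in>?I. wt\<^sup>2 * (conv \<Lambda> (unif_prim i) (mart j \<eta>) x * (central_diff (dF j \<epsilon>) y * V i \<epsilon> (y - 1)))))" for \<epsilon> \<eta>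
    unfolding X4_def central_diff_mult case_prod_unfold sum.distrib[symmetric] distrib_left[symmetric] ..
  then show ?thesis using avg2_add_sq_le(2)[OF 1 avg2_add_sq_le(1)[OF 2 3]] tgt_nonneg by simp
qed

lemma fwd_Vs_sq: "avg \<Lambda> (\<lambda>e. (conv \<Lambda> (fwd_diff v) e y)\<^sup>2) \<le> 30 * wt\<^sup>2"
proof -
  let ?c = "\<lambda>i e. conv \<Lambda> (fwd_diff (trap i)) e y"
  have "conv \<Lambda> (fwd_diff v) e y = (\<Sum>i<n. wt * ?c i e)" for e
    unfolding fwd_v[abs_def] conv_def by (simp add: sum_distrib_left sum_distrib_right sum.swap[of _ \<Lambda>] mult_ac)
  then have "avg \<Lambda> (\<lambda>e. (conv \<Lambda> (fwd_diff v) e y)\<^sup>2) = avg \<Lambda> (\<lambda>e. \<Sum>i<n. \<Sum>i'<n. wt\<^sup>2 * (?c i e * ?c i' e))"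
    by (simp add: power2_eq_square sum_product mult_ac)
  also have "\<dots> = wt\<^sup>2 * (\<Sum>i<n. \<Sum>i'<n. avg \<Lambda> (\<lambda>e. ?c i e * ?c i' e))"
    unfolding avg_sum avg_cmult sum_distrib_left ..
  also have "\<dots> \<le> wt\<^sup>2 * (\<Sum>i<n. \<Sum>i'<n. 5 * (1 / 2 ^ max i i'))"
  proof (intro mult_left_mono sum_mono)
    fix i i'
    have "avg \<Lambda> (\<lambda>e. ?c i e * ?c i' e) \<le> 1 / 2 ^ i * (1 / 2 ^ i') * min (5 * 2 ^ i) (5 * 2 ^ i')"
      by (rule order_trans[OF abs_ge_self avg_conv_conv_unweighted_le[OF fin kernel_fwd_diff_trap kernel_fwd_diff_trap]])
    also have "\<dots> = 5 * (1 / 2 ^ max i i')" by (cases "i \<le> i'") simp_all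
    finally show "avg \<Lambda> (\<lambda>e. ?c i e * ?c i' e) \<le> 5 * (1 / 2 ^ max i i')" .
  qed simp
  also have "\<dots> = wt\<^sup>2 * (5 * (\<Sum>i<n. \<Sum>i'<n. 1 / 2 ^ max i i'))" by (simp only: sum_distrib_left)
  also have "\<dots> \<le> wt\<^sup>2 * (5 * 6)" by (intro mult_left_mono sum_inverse_max) auto
  finally show ?thesis by simp
qed

lemma fdx_trial_moment: "avg2 \<Lambda> (\<lambda>\<epsilon> \<eta>. (fdx (trial \<epsilon> \<eta>) x y)\<^sup>2) \<le> 2000 * tgt"
proof -
  have 1: "avg2 \<Lambda> (\<lambda>\<epsilon> \<eta>. (fwd_diff \<Psi> x * Fs \<epsilon> y)\<^sup>2) \<le> 64 * tgt"
  proof -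
    have "avg2 \<Lambda> (\<lambda>\<epsilon> \<eta>. (fwd_diff \<Psi> x * Fs \<epsilon> y)\<^sup>2) \<le> (4 / 2 ^ k)\<^sup>2 * (1 / 4 ^ k * (1\<^sup>2 * (4 * 2 ^ (9 * n))))"
      unfolding Fs_def by (rule avg2_product_sq_le[OF avg_const_sq_le[OF \<Psi>_lip] avg_alpha_sq_le[OF kernel_u]])
    also have "\<dots> = 64 / 4 ^ k * (2 ^ (9 * n) / 2 ^ (k + k))" by (simp add: power2_eq_square power_add)
    also have "\<dots> \<le> 64 * tgt" by (rule tiny_tgt) (use k_ge in auto)
    finally show ?thesis .
  qed
  have 2: "avg2 \<Lambda> (\<lambda>\<epsilon> \<eta>. (\<Sum>j<n. wt * (fwd_diff (PhB j \<eta>) x * (dF j \<epsilon> y * Vs \<epsilon> y)))\<^sup>2) \<le> 640 * tgt"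
  proof (rule mean_j_le)
    fix j assume "j < n"
    let ?m = "8 * n + j - p" and ?m' = "8 * n + j + p"
    have ph: "avg \<Lambda> (\<lambda>\<eta>. (fwd_diff (PhB j \<eta>) x)\<^sup>2) \<le> (4 / 2 ^ ?m)\<^sup>2 * (2 * 2 ^ ?m')"
      unfolding PhB_def fwd_diff_conv by (rule avg_Psi_sq_le[OF kernel_fwd_diff_ramp_diff]) auto
    have d: "avg \<Lambda> (\<lambda>e. (dF j e y * Vs e y)\<^sup>2) \<le> (1 / 4 ^ k * ((1 / 2 ^ (8 * n + j))\<^sup>2 * (5 * 2 ^ (8 * n + j)))) * (1\<^sup>2 * (4 * 2 ^ n))"
      unfolding dF_def Vs_def
      by (rule avg_far_near_sq_le[OF far_central_diff_trap near_v _ kernel_central_diff_trap kernel_v]) simp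
    have id: "((4 / 2 ^ m)\<^sup>2 * (2 * 2 ^ m')) * ((1 / 4 ^ k * ((1 / 2 ^ l)\<^sup>2 * (5 * 2 ^ l))) * (1\<^sup>2 * (4 * 2 ^ n)))
       = (640 / 4 ^ k * (2 ^ (m' + n) / 2 ^ (m + m + l)) :: real)" for m m' l
      by (simp add: power2_eq_square power_add field_simps)
    have "avg2 \<Lambda> (\<lambda>\<epsilon> \<eta>. (fwd_diff (PhB j \<eta>) x * (dF j \<epsilon> y * Vs \<epsilon> y))\<^sup>2)
       \<le> ((4 / 2 ^ ?m)\<^sup>2 * (2 * 2 ^ ?m')) * ((1 / 4 ^ k * ((1 / 2 ^ (8 * n + j))\<^sup>2 * (5 * 2 ^ (8 * n + j)))) * (1\<^sup>2 * (4 * 2 ^ n)))"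
      by (rule avg2_product_sq_le[OF ph d])
    also have "\<dots> \<le> 640 * tgt" unfolding id by (rule tiny_tgt) (use p_less_n in auto)
    finally show "avg2 \<Lambda> (\<lambda>\<epsilon> \<eta>. (fwd_diff (PhB j \<eta>) x * (dF j \<epsilon> y * Vs \<epsilon> y))\<^sup>2) \<le> 640 * tgt" .
  qed
  have "fdx (trial \<epsilon> \<eta>) x y = fwd_diff \<Psi> x * Fs \<epsilon> y - (\<Sum>j<n. wt * (fwd_diff (PhB j \<eta>) x * (dF j \<epsilon> y * Vs \<epsilon> y)))" for \<epsilon> \<eta>
    unfolding fdx_def trial_def fwd_diff_def by (simp add: algebra_simps sum_subtractf)
  then show ?thesis using avg2_add_sq_le(2)[OF 1 2] tgt_nonneg by simp
qed

lemma fdy_trial_moment: "avg2 \<Lambda> (\<lambda>\<epsilon> \<eta>. (fdy (trial \<epsilon> \<eta>) x y)\<^sup>2) \<le> 2000 * tgt"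
proof -
  have 1: "avg2 \<Lambda> (\<lambda>\<epsilon> \<eta>. (\<Sum>j<n. wt * (\<Psi> x * fwd_diff (F j \<epsilon>) y))\<^sup>2) \<le> 5 * tgt"
  proof (rule mean_j_le)
    fix j assume "j < n"
    have "avg2 \<Lambda> (\<lambda>\<epsilon> \<eta>. (\<Psi> x * fwd_diff (F j \<epsilon>) y)\<^sup>2) \<le> 1\<^sup>2 * (1 / 4 ^ k * ((1 / 2 ^ (8 * n + j))\<^sup>2 * (5 * 2 ^ (8 * n + j))))"
      unfolding F_def fwd_diff_conv
      by (rule avg2_product_sq_le[OF avg_const_sq_le[OF \<Psi>_bound] avg_alpha_sq_le[OF kernel_fwd_diff_trap]])
    also have "\<dots> = 5 / 4 ^ k * (2 ^ 0 / 2 ^ (8 * n + j))" by (simp add: power2_eq_square)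
    also have "\<dots> \<le> 5 * tgt" by (rule tiny_tgt) auto
    finally show "avg2 \<Lambda> (\<lambda>\<epsilon> \<eta>. (\<Psi> x * fwd_diff (F j \<epsilon>) y)\<^sup>2) \<le> 5 * tgt" .
  qed
  have 2: "avg2 \<Lambda> (\<lambda>\<epsilon> \<eta>. (\<Sum>j<n. wt * (PhB j \<eta> x * (dF j \<epsilon> (y + 1) * fwd_diff (Vs \<epsilon>) y)))\<^sup>2) \<le> 150 * tgt"
  proof (rule mean_j_le)
    fix j assume "j < n"
    let ?U = "central_diff (trap (8 * n + j))"
    have d: "avg \<Lambda> (\<lambda>e. (dF j e (y + 1) * fwd_diff (Vs e) y)\<^sup>2) \<le> (1 / 4 ^ k * ((1 / 2 ^ (8 * n + j))\<^sup>2 * (5 * 2 ^ (8 * n + j)))) * (30 * wt\<^sup>2)"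
    proof -
      have "avg \<Lambda> (\<lambda>e. (conv \<Lambda> ?U (\<lambda>t. \<alpha> t * e t) (y + 1) * conv \<Lambda> (fwd_diff v) e y)\<^sup>2)
        = avg \<Lambda> (\<lambda>e. (conv \<Lambda> ?U (\<lambda>t. \<alpha> t * e t) (y + 1))\<^sup>2) * avg \<Lambda> (\<lambda>e. (conv \<Lambda> (fwd_diff v) e y)\<^sup>2)"
        using avg_far_near[OF far_central_diff_trap[of j] far_central_diff_trap[of j] near_fwd_v near_fwd_v, of "y + 1" y]
        by (simp add: power2_eq_square)
      also have "\<dots> \<le> (1 / 4 ^ k * ((1 / 2 ^ (8 * n + j))\<^sup>2 * (5 * 2 ^ (8 * n + j)))) * (30 * wt\<^sup>2)"
        by (intro mult_mono avg_alpha_sq_le kernel_central_diff_trap fwd_Vs_sq avg_nonneg) auto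
      finally show ?thesis unfolding dF_def Vs_def fwd_diff_conv .
    qed
    have "avg2 \<Lambda> (\<lambda>\<epsilon> \<eta>. (PhB j \<eta> x * (dF j \<epsilon> (y + 1) * fwd_diff (Vs \<epsilon>) y))\<^sup>2)
      \<le> 2 ^ (8 * n + j + p) * ((1 / 4 ^ k * ((1 / 2 ^ (8 * n + j))\<^sup>2 * (5 * 2 ^ (8 * n + j)))) * (30 * wt\<^sup>2))"
      by (rule avg2_product_sq_le[OF avg_PhB_sq d])
    also have "\<dots> = 150 / 4 ^ k * (2 ^ p * wt\<^sup>2)" by (simp add: power2_eq_square power_add)
    also have "\<dots> = 150 * tgt"
    proof -
      have "(4::real) ^ p * 4 ^ p = 2 ^ p * 8 ^ p" by (simp flip: power_mult_distrib)
      then show ?thesis by (simp add: wt_def tgt_def n_real field_simps power2_eq_square)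
    qed
    finally show "avg2 \<Lambda> (\<lambda>\<epsilon> \<eta>. (PhB j \<eta> x * (dF j \<epsilon> (y + 1) * fwd_diff (Vs \<epsilon>) y))\<^sup>2) \<le> 150 * tgt" .
  qed
  have 3: "avg2 \<Lambda> (\<lambda>\<epsilon> \<eta>. (\<Sum>j<n. wt * (PhB j \<eta> x * (fwd_diff (dF j \<epsilon>) y * Vs \<epsilon> y)))\<^sup>2) \<le> 192 * tgt"
  proof (rule mean_j_le)
    fix j assume "j < n"
    have d: "avg \<Lambda> (\<lambda>e. (fwd_diff (dF j e) y * Vs e y)\<^sup>2) \<le> (1 / 4 ^ k * ((2 / 2 ^ (8 * n + j))\<^sup>2 * 12)) * (1\<^sup>2 * (4 * 2 ^ n))"
      unfolding dF_def Vs_def fwd_diff_conv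
      by (rule avg_far_near_sq_le[OF far_diff_central_diff_trap(2) near_v _ kernel_fwd_central_diff_trap kernel_v]) simp
    have id: "2 ^ (l + p) * ((1 / 4 ^ k * ((2 / 2 ^ l)\<^sup>2 * 12)) * (1\<^sup>2 * (4 * 2 ^ n)))
       = (192 / 4 ^ k * (2 ^ (n + p) / 2 ^ l) :: real)" for l
      by (simp add: power2_eq_square power_add field_simps)
    have "avg2 \<Lambda> (\<lambda>\<epsilon> \<eta>. (PhB j \<eta> x * (fwd_diff (dF j \<epsilon>) y * Vs \<epsilon> y))\<^sup>2)
      \<le> 2 ^ (8 * n + j + p) * ((1 / 4 ^ k * ((2 / 2 ^ (8 * n + j))\<^sup>2 * 12)) * (1\<^sup>2 * (4 * 2 ^ n)))"
      by (rule avg2_product_sq_le[OF avg_PhB_sq d])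
    also have "\<dots> \<le> 192 * tgt" unfolding id by (rule tiny_tgt) (use p_less_n in auto)
    finally show "avg2 \<Lambda> (\<lambda>\<epsilon> \<eta>. (PhB j \<eta> x * (fwd_diff (dF j \<epsilon>) y * Vs \<epsilon> y))\<^sup>2) \<le> 192 * tgt" .
  qed
  have "fdy (trial \<epsilon> \<eta>) x y = (\<Sum>j<n. wt * (\<Psi> x * fwd_diff (F j \<epsilon>) y))
     - ((\<Sum>j<n. wt * (PhB j \<eta> x * (dF j \<epsilon> (y + 1) * fwd_diff (Vs \<epsilon>) y)))
      + (\<Sum>j<n. wt * (PhB j \<eta> x * (fwd_diff (dF j \<epsilon>) y * Vs \<epsilon> y))))" for \<epsilon> \<eta>
  proof -
    have "fdy (trial \<epsilon> \<eta>) x y = (\<Sum>j<n. wt * (\<Psi> x * fwd_diff (F j \<epsilon>) y))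
       - (\<Sum>j<n. wt * (PhB j \<eta> x * fwd_diff (\<lambda>y. dF j \<epsilon> y * Vs \<epsilon> y) y))"
      unfolding fdy_def trial_def fwd_diff_def Fs_sum by (simp add: algebra_simps sum_subtractf sum_distrib_left)
    then show ?thesis unfolding fwd_diff_mult distrib_left sum.distrib .
  qed
  then show ?thesis using avg2_add_sq_le(2)[OF 1 avg2_add_sq_le(1)[OF 2 3]] tgt_nonneg by simp
qed

lemma trial_moment: "avg2 \<Lambda> (\<lambda>\<epsilon> \<eta>. (trial \<epsilon> \<eta> x y)\<^sup>2) \<le> 48 * 2 ^ (9 * n) / 4 ^ k"
proof -
  have 1: "avg2 \<Lambda> (\<lambda>\<epsilon> \<eta>. (\<Psi> x * Fs \<epsilon> y)\<^sup>2) \<le> 1\<^sup>2 * (1 / 4 ^ k * (1\<^sup>2 * (4 * 2 ^ (9 * n))))"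
    unfolding Fs_def by (rule avg2_product_sq_le[OF avg_const_sq_le[OF \<Psi>_bound] avg_alpha_sq_le[OF kernel_u]])
  have 2: "avg2 \<Lambda> (\<lambda>\<epsilon> \<eta>. (\<Sum>j<n. wt * (PhB j \<eta> x * (dF j \<epsilon> y * Vs \<epsilon> y)))\<^sup>2) \<le> 20 * 2 ^ (9 * n) / 4 ^ k"
  proof (rule mean_j_le)
    fix j assume "j < n"
    have d: "avg \<Lambda> (\<lambda>e. (dF j e y * Vs e y)\<^sup>2) \<le> (1 / 4 ^ k * ((1 / 2 ^ (8 * n + j))\<^sup>2 * (5 * 2 ^ (8 * n + j)))) * (1\<^sup>2 * (4 * 2 ^ n))"
      unfolding dF_def Vs_def
      by (rule avg_far_near_sq_le[OF far_central_diff_trap near_v _ kernel_central_diff_trap kernel_v]) simp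
    have "avg2 \<Lambda> (\<lambda>\<epsilon> \<eta>. (PhB j \<eta> x * (dF j \<epsilon> y * Vs \<epsilon> y))\<^sup>2)
       \<le> 2 ^ (8 * n + j + p) * ((1 / 4 ^ k * ((1 / 2 ^ (8 * n + j))\<^sup>2 * (5 * 2 ^ (8 * n + j)))) * (1\<^sup>2 * (4 * 2 ^ n)))"
      by (rule avg2_product_sq_le[OF avg_PhB_sq d])
    also have "\<dots> = 20 * 2 ^ (p + n) / 4 ^ k" by (simp add: power2_eq_square power_add)
    also have "\<dots> \<le> 20 * 2 ^ (9 * n) / 4 ^ k"
      by (intro divide_right_mono mult_left_mono power_increasing) (use p_less_n in auto)
    finally show "avg2 \<Lambda> (\<lambda>\<epsilon> \<eta>. (PhB j \<eta> x * (dF j \<epsilon> y * Vs \<epsilon> y))\<^sup>2) \<le> 20 * 2 ^ (9 * n) / 4 ^ k" .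
  qed
  show ?thesis unfolding trial_def by (rule order_trans[OF avg2_add_sq_le(2)[OF 1 2]]) (simp add: field_simps)
qed

end

section \<open>Combining the scales\<close>

lemma avg2_abs_le: "\<bar>avg2 \<Lambda> f\<bar> \<le> avg2 \<Lambda> (\<lambda>\<epsilon> \<eta>. \<bar>f \<epsilon> \<eta>\<bar>)"
proof -
  have "avg2 \<Lambda> f \<le> avg2 \<Lambda> (\<lambda>\<epsilon> \<eta>. \<bar>f \<epsilon> \<eta>\<bar>)" by (rule avg2_mono) simp
  moreover have "(-1) * avg2 \<Lambda> f \<le> avg2 \<Lambda> (\<lambda>\<epsilon> \<eta>. \<bar>f \<epsilon> \<eta>\<bar>)"
    unfolding avg2_cmult[symmetric] by (rule avg2_mono) simp
  ultimately show ?thesis by linarith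
qed

lemma weighted_am_gm: "0 < c \<Longrightarrow> \<bar>a * b\<bar> \<le> (c * a\<^sup>2 + b\<^sup>2 / c) / 2" for a b c :: real
proof -
  assume c: "0 < c"
  have "0 \<le> (c * \<bar>a\<bar> - \<bar>b\<bar>)\<^sup>2 / c" using c by simp
  also have "\<dots> = c * a\<^sup>2 + b\<^sup>2 / c - 2 * \<bar>a * b\<bar>"
    using c by (simp add: power2_eq_square abs_mult field_simps)
  finally show ?thesis by simp
qed

lemma avg2_product_le:
  assumes X: "avg2 \<Lambda> (\<lambda>\<epsilon> \<eta>. (X \<epsilon> \<eta>)\<^sup>2) \<le> s / 4 ^ i" and Y: "avg2 \<Lambda> (\<lambda>\<epsilon> \<eta>. (Y \<epsilon> \<eta>)\<^sup>2) \<le> t / 4 ^ j"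
  shows "\<bar>avg2 \<Lambda> (\<lambda>\<epsilon> \<eta>. X \<epsilon> \<eta> * Y \<epsilon> \<eta>)\<bar> \<le> (s + t) / 2 / (2 ^ i * 2 ^ j)"
proof -
  define c :: real where "c = 2 ^ i / 2 ^ j"
  have c: "0 < c" by (simp add: c_def)
  have four: "(4::real) ^ m = 2 ^ m * 2 ^ m" for m by (simp flip: power_mult_distrib)
  have "\<bar>avg2 \<Lambda> (\<lambda>\<epsilon> \<eta>. X \<epsilon> \<eta> * Y \<epsilon> \<eta>)\<bar> \<le> avg2 \<Lambda> (\<lambda>\<epsilon> \<eta>. (c / 2) * (X \<epsilon> \<eta>)\<^sup>2 + (1 / (2 * c)) * (Y \<epsilon> \<eta>)\<^sup>2)"
    by (rule order_trans[OF avg2_abs_le], rule avg2_mono, rule order_trans[OF weighted_am_gm[OF c]]) (simp add: field_simps)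
  also have "\<dots> = (c / 2) * avg2 \<Lambda> (\<lambda>\<epsilon> \<eta>. (X \<epsilon> \<eta>)\<^sup>2) + (1 / (2 * c)) * avg2 \<Lambda> (\<lambda>\<epsilon> \<eta>. (Y \<epsilon> \<eta>)\<^sup>2)"
    by (simp only: avg2_add avg2_cmult)
  also have "\<dots> \<le> (c / 2) * (s / 4 ^ i) + (1 / (2 * c)) * (t / 4 ^ j)"
    by (intro add_mono mult_left_mono X Y) (use c in auto)
  also have "\<dots> = (s + t) / 2 / (2 ^ i * 2 ^ j)"
    unfolding c_def four by (simp add: field_simps)
  finally show ?thesis .
qed

lemma avg2_box_sum: "avg2 \<Lambda> (\<lambda>\<epsilon> \<eta>. box_sum M (\<lambda>x y. f \<epsilon> \<eta> x y)) = box_sum M (\<lambda>x y. avg2 \<Lambda> (\<lambda>\<epsilon> \<eta>. f \<epsilon> \<eta> x y))"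
  unfolding box_sum_def avg2_sum ..

lemma box_sum_le_card:
  assumes "\<And>x y. \<bar>a x y\<bar> \<le> B" "supported (8 * 2 ^ m) a" "0 \<le> B"
  shows "box_sum M a \<le> 289 * 4 ^ m * B"
proof -
  let ?J = "{- (8 * 2 ^ m)..8 * 2 ^ m :: int}"
  have inner: "(\<Sum>y\<in>{-M..M}. if y \<in> ?J then c else 0) = real (card ({-M..M} \<inter> ?J)) * c" for c
    unfolding sum.inter_restrict[OF finite_atLeastAtMost_int, symmetric] by (simp del: Int_atLeastAtMost)
  have "box_sum M a \<le> (\<Sum>x\<in>{-M..M}. \<Sum>y\<in>{-M..M}. if x \<in> ?J \<and> y \<in> ?J then B else 0)"
    unfolding box_sum_def
  proof (intro sum_mono)
    fix x y :: int
    show "a x y \<le> (if x \<in> ?J \<and> y \<in> ?J then B else 0)"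
    proof (cases "x \<in> ?J \<and> y \<in> ?J")
      case True then show ?thesis using assms(1)[of x y] by auto
    next
      case False
      then have "\<bar>x\<bar> > 8 * 2 ^ m \<or> \<bar>y\<bar> > 8 * 2 ^ m" by auto
      then have "a x y = 0" using assms(2) unfolding supported_def by blast
      then show ?thesis using False by auto
    qed
  qed
  also have "\<dots> = (\<Sum>x\<in>{-M..M}. if x \<in> ?J then (\<Sum>y\<in>{-M..M}. if y \<in> ?J then B else 0) else 0)"
    by (intro sum.cong refl) auto
  also have "\<dots> = real (card ({-M..M} \<inter> ?J)) * (real (card ({-M..M} \<inter> ?J)) * B)"
    unfolding inner ..
  also have "\<dots> \<le> real (card ?J) * (real (card ?J) * B)"
    using card_mono[of ?J "{-M..M} \<inter> ?J"] assms(3)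
    by (intro mult_mono mult_right_mono) (auto simp del: Int_atLeastAtMost card_atLeastAtMost_int)
  also have "real (card ?J) = 16 * 2 ^ m + 1" by simp
  also have "(16 * 2 ^ m + 1) * ((16 * 2 ^ m + 1) * B) \<le> (17 * 2 ^ m) * ((17 * 2 ^ m) * B)"
  proof -
    have "(1::real) \<le> 2 ^ m" by simp
    then have "16 * (2::real) ^ m + 1 \<le> 17 * 2 ^ m" by linarith
    then show ?thesis by (intro mult_mono mult_right_mono) (use assms(3) in auto)
  qed
  also have "\<dots> = 289 * 4 ^ m * B"
    by (simp flip: power_mult_distrib)
  finally show ?thesis .
qed

lemma multilevel_sum_le:
  fixes \<phi> :: "nat \<Rightarrow> (int \<Rightarrow> real) \<Rightarrow> (int \<Rightarrow> real) \<Rightarrow> int \<Rightarrow> int \<Rightarrow> real"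
  assumes I: "I \<subseteq> {..<K}"
    and mom: "\<And>k x y. k \<in> I \<Longrightarrow> avg2 \<Lambda> (\<lambda>\<epsilon> \<eta>. (\<phi> k \<epsilon> \<eta> x y)\<^sup>2) \<le> \<tau> k / 4 ^ k"
    and sup: "\<And>k \<epsilon> \<eta>. k \<in> I \<Longrightarrow> supported (8 * 2 ^ k) (\<phi> k \<epsilon> \<eta>)"
    and \<tau>: "\<And>k. k \<in> I \<Longrightarrow> 0 \<le> \<tau> k"
  shows "avg2 \<Lambda> (\<lambda>\<epsilon> \<eta>. box_sum M (\<lambda>x y. (\<Sum>k\<in>I. \<phi> k \<epsilon> \<eta> x y)\<^sup>2)) \<le> 867 * (\<Sum>k\<in>I. \<tau> k)"
proof -
  have fin: "finite I" using I finite_subset by blast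
  have cross: "box_sum M (\<lambda>x y. avg2 \<Lambda> (\<lambda>\<epsilon> \<eta>. \<phi> k \<epsilon> \<eta> x y * \<phi> l \<epsilon> \<eta> x y)) \<le> 289 / 2 * (\<tau> k * scale_ratio k l + \<tau> l * scale_ratio l k)"
    if k: "k \<in> I" "l \<in> I" for k l
  proof -
    have "box_sum M (\<lambda>x y. avg2 \<Lambda> (\<lambda>\<epsilon> \<eta>. \<phi> k \<epsilon> \<eta> x y * \<phi> l \<epsilon> \<eta> x y)) \<le> 289 * 4 ^ min k l * ((\<tau> k + \<tau> l) / 2 / (2 ^ k * 2 ^ l))"
    proof (rule box_sum_le_card)
      show "\<bar>avg2 \<Lambda> (\<lambda>\<epsilon> \<eta>. \<phi> k \<epsilon> \<eta> x y * \<phi> l \<epsilon> \<eta> x y)\<bar> \<le> (\<tau> k + \<tau> l) / 2 / (2 ^ k * 2 ^ l)" for x y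
        by (rule avg2_product_le[OF mom[OF k(1)] mom[OF k(2)]])
      show "supported (8 * 2 ^ min k l) (\<lambda>x y. avg2 \<Lambda> (\<lambda>\<epsilon> \<eta>. \<phi> k \<epsilon> \<eta> x y * \<phi> l \<epsilon> \<eta> x y))"
        unfolding supported_def
      proof (intro allI impI)
        fix x y :: int assume "8 * 2 ^ min k l < \<bar>x\<bar> \<or> 8 * 2 ^ min k l < \<bar>y\<bar>"
        then have "\<phi> k \<epsilon> \<eta> x y * \<phi> l \<epsilon> \<eta> x y = 0" for \<epsilon> \<eta>
          using sup[OF k(1), of \<epsilon> \<eta>] sup[OF k(2), of \<epsilon> \<eta>] unfolding supported_def min_def by (auto split: if_splits)
        then show "avg2 \<Lambda> (\<lambda>\<epsilon> \<eta>. \<phi> k \<epsilon> \<eta> x y * \<phi> l \<epsilon> \<eta> x y) = 0"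
          unfolding avg2_def avg_def by (simp only: sum.neutral_const div_0)
      qed
      show "0 \<le> (\<tau> k + \<tau> l) / 2 / (2 ^ k * 2 ^ l)" using \<tau> k by simp
    qed
    also have "\<dots> = 289 / 2 * (\<tau> k * scale_ratio k l + \<tau> l * scale_ratio l k)"
    proof -
      have "(4::real) ^ m = 2 ^ m * 2 ^ m" for m by (simp flip: power_mult_distrib)
      then show ?thesis by (cases "k \<le> l") (simp_all add: scale_ratio_def field_simps)
    qed
    finally show ?thesis .
  qed
  have row: "(\<Sum>l\<in>I. scale_ratio k l) \<le> 3" for k
    by (rule order_trans[OF sum_mono2 scale_ratio_row]) (use I scale_ratio_nonneg in auto)
  have "avg2 \<Lambda> (\<lambda>\<epsilon> \<eta>. box_sum M (\<lambda>x y. (\<Sum>k\<in>I. \<phi> k \<epsilon> \<eta> x y)\<^sup>2))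
     = (\<Sum>k\<in>I. \<Sum>l\<in>I. box_sum M (\<lambda>x y. avg2 \<Lambda> (\<lambda>\<epsilon> \<eta>. \<phi> k \<epsilon> \<eta> x y * \<phi> l \<epsilon> \<eta> x y)))"
    unfolding power2_eq_square sum_product avg2_box_sum avg2_sum box_sum_sum ..
  also have "\<dots> \<le> (\<Sum>k\<in>I. \<Sum>l\<in>I. 289 / 2 * (\<tau> k * scale_ratio k l + \<tau> l * scale_ratio l k))"
    by (intro sum_mono cross)
  also have "\<dots> = 289 / 2 * ((\<Sum>k\<in>I. \<Sum>l\<in>I. \<tau> k * scale_ratio k l) + (\<Sum>k\<in>I. \<Sum>l\<in>I. \<tau> l * scale_ratio l k))"
    by (simp only: sum_distrib_left[symmetric] sum.distrib)
  also have "(\<Sum>k\<in>I. \<Sum>l\<in>I. \<tau> l * scale_ratio l k) = (\<Sum>k\<in>I. \<Sum>l\<in>I. \<tau> k * scale_ratio k l)"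
    by (rule sum.swap)
  also have "289 / 2 * ((\<Sum>k\<in>I. \<Sum>l\<in>I. \<tau> k * scale_ratio k l) + (\<Sum>k\<in>I. \<Sum>l\<in>I. \<tau> k * scale_ratio k l))
     = 289 * (\<Sum>k\<in>I. \<tau> k * (\<Sum>l\<in>I. scale_ratio k l))" by (simp add: sum_distrib_left)
  also have "\<dots> \<le> 289 * (\<Sum>k\<in>I. \<tau> k * 3)"
    by (intro mult_left_mono sum_mono row \<tau>) auto
  finally show ?thesis by (simp add: sum_distrib_right[symmetric])
qed

text \<open>The largest \<open>p\<close> with \<open>64 * 4 ^ p \<le> k\<close>, so that the number \<open>4 ^ p\<close> of windows is comparable to \<open>k\<close>.\<close>

definition lev :: "nat \<Rightarrow> nat" where
  "lev k = (LEAST p. k < 64 * 4 ^ Suc p)"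

lemma lev_upper: "k < 64 * 4 ^ Suc (lev k)"
  unfolding lev_def
proof (rule LeastI)
  have "k < 4 ^ k" by (induction k) auto
  then show "k < 64 * 4 ^ Suc k" by simp
qed

lemma lev_lower: "64 \<le> k \<Longrightarrow> 64 * 4 ^ lev k \<le> k"
proof (cases "lev k")
  case (Suc q)
  then have "\<not> k < 64 * 4 ^ Suc q" using not_less_Least[of q "\<lambda>p. k < 64 * 4 ^ Suc p"] unfolding lev_def by simp
  then show ?thesis using Suc by simp
qed simp

lemma sum_lev_bounded: "\<exists>C. \<forall>K. (\<Sum>k\<in>{64..<K}. 1 / 8 ^ lev k) \<le> (C::real)"
proof -
  have le: "1 / 8 ^ lev k \<le> 4096 * real k powr (-3/2)" if "64 \<le> k" for k
  proof -
    have k: "real k > 0" using that by simp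
    have "real k < real (64 * 4 ^ Suc (lev k))" using lev_upper[of k] by (simp only: of_nat_less_iff)
    then have "real k / 256 \<le> 4 ^ lev k" by simp
    then have "(real k / 256) powr (3/2) \<le> (4 ^ lev k) powr (3/2)" by (intro powr_mono2) auto
    also have "(4 ^ lev k) powr (3/2) = (8::real) ^ lev k"
    proof -
      have "(4::real) powr (3/2) = 8"
      proof -
        have "(4::real) powr (3/2) = (2 powr 2) powr (3/2)" by simp
        also have "\<dots> = 2 powr 3" by (simp only: powr_powr) simp
        finally show ?thesis by simp
      qed
      then have eight: "((4::real) powr (3/2)) powr real (lev k) = 8 ^ lev k" by (simp add: powr_realpow)
      have "(4 ^ lev k) powr (3/2) = ((4::real) powr real (lev k)) powr (3/2)" by (simp add: powr_realpow)
      also have "\<dots> = ((4::real) powr (3/2)) powr real (lev k)" by (simp only: powr_powr mult.commute)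
      finally show ?thesis using eight by simp
    qed
    finally have "1 / 8 ^ lev k \<le> 1 / (real k / 256) powr (3/2)" using k by (intro divide_left_mono) auto
    also have "\<dots> = 4096 * real k powr (-3/2)"
    proof -
      have "(256::real) powr (3/2) = (2 powr 8) powr (3/2)" by simp
      also have "\<dots> = 2 powr 12" by (simp only: powr_powr) simp
      finally have "(256::real) powr (3/2) = 4096" by simp
      then show ?thesis using k by (simp add: powr_divide powr_minus_divide)
    qed
    finally show ?thesis .
  qed
  have s: "summable (\<lambda>k. real k powr (-3/2))" by (simp add: summable_real_powr_iff)
  have "(\<Sum>k\<in>{64..<K}. 1 / 8 ^ lev k) \<le> 4096 * (\<Sum>k. real k powr (-3/2))" for K
  proof -
    have "(\<Sum>k\<in>{64..<K}. 1 / 8 ^ lev k) \<le> (\<Sum>k\<in>{64..<K}. 4096 * real k powr (-3/2))" by (intro sum_mono le) auto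
    also have "\<dots> = 4096 * (\<Sum>k\<in>{64..<K}. real k powr (-3/2))" by (simp add: sum_distrib_left)
    also have "\<dots> \<le> 4096 * (\<Sum>k. real k powr (-3/2))" by (intro mult_left_mono sum_le_suminf[OF s]) auto
    finally show ?thesis .
  qed
  then show ?thesis by blast
qed

definition Psi :: "nat \<Rightarrow> int \<Rightarrow> real" where "Psi k = ramp_diff (k + 1) (k + 2)"

lemma cell_level:
  assumes "finite \<Lambda>" "{- (8 * 2 ^ k)..8 * 2 ^ k} \<subseteq> \<Lambda>" "64 \<le> k" "m = k + 1 \<or> m = k + 2"
  shows "cell \<Lambda> k (lev k) (unif m) (Psi k)"
proof
  have km: "k \<le> m" "m \<le> k + 2" using assms(4) by auto
  show "\<bar>unif m t\<bar> \<le> 1 / 2 ^ k" for t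
  proof -
    have "(1::real) / 2 ^ m \<le> 1 / 2 ^ k" using km by (simp add: frac_le)
    then show ?thesis by (simp add: unif_def)
  qed
  have "(2::int) ^ m \<le> 2 ^ (k + 2)" using km by (intro power_increasing) auto
  then show "vanishes_outside (4 * 2 ^ k) (unif m)" by (intro vanishes_outside_unif) simp
  show "vanishes_outside (4 * 2 ^ k) (Psi k)" unfolding Psi_def by (rule vanishes_outside_ramp_diff) auto
  show "\<bar>Psi k t\<bar> \<le> 1" for t
    using kernel_ramp_diff[of "k + 1" "k + 2"] unfolding Psi_def kernel_bound_def by simp
  have "\<bar>fwd_diff (Psi k) t\<bar> \<le> 4 / 2 ^ (k + 1)" for t
    using kernel_fwd_diff_ramp_diff[of "k + 1" "k + 2"] unfolding Psi_def kernel_bound_def by simp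
  moreover have "(4::real) / 2 ^ (k + 1) \<le> 4 / 2 ^ k" by (simp add: frac_le)
  ultimately show "\<bar>fwd_diff (Psi k) t\<bar> \<le> 4 / 2 ^ k" for t by (meson order_trans)
qed (use assms lev_lower in auto)

text \<open>The trial function and the error fluxes at scale \<open>2 ^ k\<close>; the second summand treats the
  flow in the vertical direction and is the transpose of the first.\<close>

definition tr :: "int set \<Rightarrow> nat \<Rightarrow> (int \<Rightarrow> real) \<Rightarrow> (int \<Rightarrow> real) \<Rightarrow> int \<Rightarrow> int \<Rightarrow> real" where
  "tr \<Lambda> k \<epsilon> \<eta> x y = cell.trial \<Lambda> (lev k) (unif (k + 1)) (Psi k) \<epsilon> \<eta> x y
     + cell.trial \<Lambda> (lev k) (unif (k + 2)) (Psi k) \<eta> \<epsilon> y x"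
definition Y1 :: "int set \<Rightarrow> nat \<Rightarrow> (int \<Rightarrow> real) \<Rightarrow> (int \<Rightarrow> real) \<Rightarrow> int \<Rightarrow> int \<Rightarrow> real" where
  "Y1 \<Lambda> k \<epsilon> \<eta> x y = cell.X1 \<Lambda> k (lev k) (unif (k + 1)) (Psi k) \<epsilon> \<eta> x y
     + cell.X3 \<Lambda> (lev k) (unif (k + 2)) (Psi k) \<eta> \<epsilon> y x"
definition Y2 :: "int set \<Rightarrow> nat \<Rightarrow> (int \<Rightarrow> real) \<Rightarrow> (int \<Rightarrow> real) \<Rightarrow> int \<Rightarrow> int \<Rightarrow> real" where
  "Y2 \<Lambda> k \<epsilon> \<eta> x y = cell.X2 \<Lambda> k (lev k) (unif (k + 1)) (Psi k) \<epsilon> \<eta> x y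
     + cell.X4 \<Lambda> (lev k) (unif (k + 2)) (Psi k) \<eta> \<epsilon> y x"
definition Y3 :: "int set \<Rightarrow> nat \<Rightarrow> (int \<Rightarrow> real) \<Rightarrow> (int \<Rightarrow> real) \<Rightarrow> int \<Rightarrow> int \<Rightarrow> real" where
  "Y3 \<Lambda> k \<epsilon> \<eta> x y = cell.X3 \<Lambda> (lev k) (unif (k + 1)) (Psi k) \<epsilon> \<eta> x y
     + cell.X1 \<Lambda> k (lev k) (unif (k + 2)) (Psi k) \<eta> \<epsilon> y x"
definition Y4 :: "int set \<Rightarrow> nat \<Rightarrow> (int \<Rightarrow> real) \<Rightarrow> (int \<Rightarrow> real) \<Rightarrow> int \<Rightarrow> int \<Rightarrow> real" where
  "Y4 \<Lambda> k \<epsilon> \<eta> x y = cell.X4 \<Lambda> (lev k) (unif (k + 1)) (Psi k) \<epsilon> \<eta> x y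
     + cell.X2 \<Lambda> k (lev k) (unif (k + 2)) (Psi k) \<eta> \<epsilon> y x"

lemma supported_add: "supported R a \<Longrightarrow> supported R b \<Longrightarrow> supported R (\<lambda>x y. a x y + b y x)"
  unfolding supported_def by auto

lemma box_sum_transposed_diffs:
  "box_sum M (\<lambda>x y. a x y * cdx (\<lambda>x y. g y x) x y) = box_sum M (\<lambda>x y. a y x * cdy g x y)"
  "box_sum M (\<lambda>x y. a x y * cdy (\<lambda>x y. g y x) x y) = box_sum M (\<lambda>x y. a y x * cdx g x y)"
  "box_sum M (\<lambda>x y. a x y * fdx (\<lambda>x y. g y x) x y) = box_sum M (\<lambda>x y. a y x * fdy g x y)"
  "box_sum M (\<lambda>x y. a x y * fdy (\<lambda>x y. g y x) x y) = box_sum M (\<lambda>x y. a y x * fdx g x y)"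
proof -
  have eq: "cdx (\<lambda>x y. g y x) = (\<lambda>x y. cdy g y x)" "cdy (\<lambda>x y. g y x) = (\<lambda>x y. cdx g y x)"
    "fdx (\<lambda>x y. g y x) = (\<lambda>x y. fdy g y x)" "fdy (\<lambda>x y. g y x) = (\<lambda>x y. fdx g y x)"
    by (intro ext, simp add: cdx_def cdy_def fdx_def fdy_def)+
  show "box_sum M (\<lambda>x y. a x y * cdx (\<lambda>x y. g y x) x y) = box_sum M (\<lambda>x y. a y x * cdy g x y)"
    unfolding eq by (rule box_sum_transpose[of M "\<lambda>x y. a y x * cdy g x y"])
  show "box_sum M (\<lambda>x y. a x y * cdy (\<lambda>x y. g y x) x y) = box_sum M (\<lambda>x y. a y x * cdx g x y)"
    unfolding eq by (rule box_sum_transpose[of M "\<lambda>x y. a y x * cdx g x y"])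
  show "box_sum M (\<lambda>x y. a x y * fdx (\<lambda>x y. g y x) x y) = box_sum M (\<lambda>x y. a y x * fdy g x y)"
    unfolding eq by (rule box_sum_transpose[of M "\<lambda>x y. a y x * fdy g x y"])
  show "box_sum M (\<lambda>x y. a x y * fdy (\<lambda>x y. g y x) x y) = box_sum M (\<lambda>x y. a y x * fdx g x y)"
    unfolding eq by (rule box_sum_transpose[of M "\<lambda>x y. a y x * fdx g x y"])
qed

lemma supported_transpose: "supported R g \<Longrightarrow> supported R (\<lambda>x y. g y x)"
  unfolding supported_def by auto

locale level =
  fixes \<Lambda> :: "int set" and k :: nat
  assumes fin\<Lambda>: "finite \<Lambda>" and \<Lambda>: "{- (8 * 2 ^ k)..8 * 2 ^ k} \<subseteq> \<Lambda>" and k64: "64 \<le> k"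
begin

lemma hc: "cell \<Lambda> k (lev k) (unif (k + 1)) (Psi k)" and vc: "cell \<Lambda> k (lev k) (unif (k + 2)) (Psi k)"
  using cell_level[OF fin\<Lambda> \<Lambda> k64] by auto

lemma tgt_eq: "cell.tgt k (lev k) = 1 / 8 ^ lev k / 4 ^ k"
  unfolding cell.tgt_def[OF hc] by simp

lemma supported_Y:
  "supported (8 * 2 ^ k) (Y1 \<Lambda> k \<epsilon> \<eta>)" "supported (8 * 2 ^ k) (Y2 \<Lambda> k \<epsilon> \<eta>)"
  "supported (8 * 2 ^ k) (Y3 \<Lambda> k \<epsilon> \<eta>)" "supported (8 * 2 ^ k) (Y4 \<Lambda> k \<epsilon> \<eta>)"
  "supported (6 * 2 ^ k) (tr \<Lambda> k \<epsilon> \<eta>)"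
  unfolding Y1_def Y2_def Y3_def Y4_def tr_def
  by (intro supported_add cell.supported_fields[OF hc] cell.supported_fields[OF vc])+

lemma supported_tr_diffs:
  "supported (8 * 2 ^ k) (fdx (tr \<Lambda> k \<epsilon> \<eta>))" "supported (8 * 2 ^ k) (fdy (tr \<Lambda> k \<epsilon> \<eta>))" "supported (8 * 2 ^ k) (tr \<Lambda> k \<epsilon> \<eta>)"
proof -
  have "(1::int) \<le> 2 ^ k" by simp
  then have le: "6 * (2::int) ^ k + 1 \<le> 8 * 2 ^ k" "6 * (2::int) ^ k \<le> 8 * 2 ^ k" by linarith+
  show "supported (8 * 2 ^ k) (fdx (tr \<Lambda> k \<epsilon> \<eta>))" "supported (8 * 2 ^ k) (fdy (tr \<Lambda> k \<epsilon> \<eta>))" "supported (8 * 2 ^ k) (tr \<Lambda> k \<epsilon> \<eta>)"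
    by (intro supported_mono[OF supported_diffs(3)[OF supported_Y(5)] le(1)] supported_mono[OF supported_diffs(4)[OF supported_Y(5)] le(1)]
       supported_mono[OF supported_Y(5) le(2)])+
qed

lemma swap_moment: "avg2 \<Lambda> (\<lambda>\<epsilon> \<eta>. (X \<epsilon> \<eta>)\<^sup>2) \<le> B \<Longrightarrow> avg2 \<Lambda> (\<lambda>\<epsilon> \<eta>. (X \<eta> \<epsilon>)\<^sup>2) \<le> B"
  using avg2_swap[of \<Lambda> "\<lambda>\<epsilon> \<eta>. (X \<epsilon> \<eta>)\<^sup>2"] by simp

lemma pair_moment:
  assumes "avg2 \<Lambda> (\<lambda>\<epsilon> \<eta>. (X \<epsilon> \<eta>)\<^sup>2) \<le> 2000 * cell.tgt k (lev k)" "avg2 \<Lambda> (\<lambda>\<epsilon> \<eta>. (Z \<epsilon> \<eta>)\<^sup>2) \<le> 2000 * cell.tgt k (lev k)"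
  shows "avg2 \<Lambda> (\<lambda>\<epsilon> \<eta>. (X \<epsilon> \<eta> + Z \<eta> \<epsilon>)\<^sup>2) \<le> 8000 * (1 / 8 ^ lev k) / 4 ^ k"
  using avg2_add_sq_le(1)[OF assms(1) swap_moment[OF assms(2)]] unfolding tgt_eq by (simp add: mult.commute)

lemma moments:
  "avg2 \<Lambda> (\<lambda>\<epsilon> \<eta>. (Y1 \<Lambda> k \<epsilon> \<eta> x y)\<^sup>2) \<le> 8000 * (1 / 8 ^ lev k) / 4 ^ k"
  "avg2 \<Lambda> (\<lambda>\<epsilon> \<eta>. (Y2 \<Lambda> k \<epsilon> \<eta> x y)\<^sup>2) \<le> 8000 * (1 / 8 ^ lev k) / 4 ^ k"
  "avg2 \<Lambda> (\<lambda>\<epsilon> \<eta>. (Y3 \<Lambda> k \<epsilon> \<eta> x y)\<^sup>2) \<le> 8000 * (1 / 8 ^ lev k) / 4 ^ k"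
  "avg2 \<Lambda> (\<lambda>\<epsilon> \<eta>. (Y4 \<Lambda> k \<epsilon> \<eta> x y)\<^sup>2) \<le> 8000 * (1 / 8 ^ lev k) / 4 ^ k"
  unfolding Y1_def Y2_def Y3_def Y4_def
  by (intro pair_moment cell.X1_moment[OF hc] cell.X2_moment[OF hc] cell.X3_moment[OF hc] cell.X4_moment[OF hc]
      cell.X1_moment[OF vc] cell.X2_moment[OF vc] cell.X3_moment[OF vc] cell.X4_moment[OF vc])+

lemma tr_diff_moments:
  "avg2 \<Lambda> (\<lambda>\<epsilon> \<eta>. (fdx (tr \<Lambda> k \<epsilon> \<eta>) x y)\<^sup>2) \<le> 8000 * (1 / 8 ^ lev k) / 4 ^ k"
  "avg2 \<Lambda> (\<lambda>\<epsilon> \<eta>. (fdy (tr \<Lambda> k \<epsilon> \<eta>) x y)\<^sup>2) \<le> 8000 * (1 / 8 ^ lev k) / 4 ^ k"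
proof -
  let ?h = "cell.trial \<Lambda> (lev k) (unif (k + 1)) (Psi k)" and ?v = "cell.trial \<Lambda> (lev k) (unif (k + 2)) (Psi k)"
  have x: "fdx (tr \<Lambda> k \<epsilon> \<eta>) x y = fdx (?h \<epsilon> \<eta>) x y + fdy (?v \<eta> \<epsilon>) y x" for \<epsilon> \<eta>
    by (simp add: fdx_def fdy_def tr_def)
  have y: "fdy (tr \<Lambda> k \<epsilon> \<eta>) x y = fdy (?h \<epsilon> \<eta>) x y + fdx (?v \<eta> \<epsilon>) y x" for \<epsilon> \<eta>
    by (simp add: fdx_def fdy_def tr_def)
  show "avg2 \<Lambda> (\<lambda>\<epsilon> \<eta>. (fdx (tr \<Lambda> k \<epsilon> \<eta>) x y)\<^sup>2) \<le> 8000 * (1 / 8 ^ lev k) / 4 ^ k"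
    unfolding x by (rule pair_moment[OF cell.fdx_trial_moment[OF hc] cell.fdy_trial_moment[OF vc]])
  show "avg2 \<Lambda> (\<lambda>\<epsilon> \<eta>. (fdy (tr \<Lambda> k \<epsilon> \<eta>) x y)\<^sup>2) \<le> 8000 * (1 / 8 ^ lev k) / 4 ^ k"
    unfolding y by (rule pair_moment[OF cell.fdy_trial_moment[OF hc] cell.fdx_trial_moment[OF vc]])
qed

lemma tr_moment: "avg2 \<Lambda> (\<lambda>\<epsilon> \<eta>. (tr \<Lambda> k \<epsilon> \<eta> x y)\<^sup>2) \<le> 192 * 2 ^ k / 4 ^ k"
proof -
  have "9 * cell.n (lev k) \<le> k" using lev_lower[OF k64] by (simp add: cell.n_def[OF hc])
  then have p: "(2::real) ^ (9 * cell.n (lev k)) \<le> 2 ^ k" by (intro power_increasing) auto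
  have "avg2 \<Lambda> (\<lambda>\<epsilon> \<eta>. (tr \<Lambda> k \<epsilon> \<eta> x y)\<^sup>2)
     \<le> 2 * (48 * 2 ^ (9 * cell.n (lev k)) / 4 ^ k) + 2 * (48 * 2 ^ (9 * cell.n (lev k)) / 4 ^ k)"
    unfolding tr_def by (rule avg2_add_sq_le(1)[OF cell.trial_moment[OF hc] swap_moment[OF cell.trial_moment[OF vc]]])
  also have "\<dots> = 192 * 2 ^ (9 * cell.n (lev k)) / 4 ^ k" by simp
  also have "\<dots> \<le> 192 * 2 ^ k / 4 ^ k" by (intro divide_right_mono mult_left_mono p) auto
  finally show ?thesis .
qed

lemma level_identity:
  assumes g: "supported R g" and M: "R + 1 < M" and \<epsilon>: "\<epsilon> \<in> coins \<Lambda>" and \<eta>: "\<eta> \<in> coins \<Lambda>"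
  shows "box_sum M (\<lambda>x y. tr \<Lambda> k \<epsilon> \<eta> x y * (\<epsilon> y * cdx g x y + \<eta> x * cdy g x y))
    = box_sum M (\<lambda>x y. (Psi k x * unif (k + 1) y) * cdx g x y) + box_sum M (\<lambda>x y. (unif (k + 2) x * Psi k y) * cdy g x y)
    + box_sum M (\<lambda>x y. Y1 \<Lambda> k \<epsilon> \<eta> x y * cdx g x y) + box_sum M (\<lambda>x y. Y2 \<Lambda> k \<epsilon> \<eta> x y * fdy g x y)
    + box_sum M (\<lambda>x y. Y3 \<Lambda> k \<epsilon> \<eta> x y * cdy g x y) + box_sum M (\<lambda>x y. Y4 \<Lambda> k \<epsilon> \<eta> x y * fdx g x y)"
proof -
  let ?v = "cell.trial \<Lambda> (lev k) (unif (k + 2)) (Psi k) \<eta> \<epsilon>"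
  let ?g = "\<lambda>x y. g y x"
  have t: "cdx ?g y x = cdy g x y" "cdy ?g y x = cdx g x y" "fdx ?g y x = fdy g x y" "fdy ?g y x = fdx g x y" for x y
    by (simp_all add: cdx_def cdy_def fdx_def fdy_def)
  note H = cell.cell_identity[OF hc g M \<epsilon> \<eta>]
  note V = cell.cell_identity[OF vc supported_transpose[OF g] M \<eta> \<epsilon>]
  have "box_sum M (\<lambda>x y. ?v y x * (\<epsilon> y * cdx g x y + \<eta> x * cdy g x y))
      = box_sum M (\<lambda>x y. (\<lambda>x y. ?v x y * (\<eta> y * cdx ?g x y + \<epsilon> x * cdy ?g x y)) y x)"
    by (rule box_sum_cong) (simp only: t add.commute)
  also have "\<dots> = box_sum M (\<lambda>x y. ?v x y * (\<eta> y * cdx ?g x y + \<epsilon> x * cdy ?g x y))"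
    by (rule box_sum_transpose)
  also have "\<dots> = box_sum M (\<lambda>x y. (unif (k + 2) x * Psi k y) * cdy g x y)
    + box_sum M (\<lambda>x y. cell.X1 \<Lambda> k (lev k) (unif (k + 2)) (Psi k) \<eta> \<epsilon> y x * cdy g x y)
    + box_sum M (\<lambda>x y. cell.X2 \<Lambda> k (lev k) (unif (k + 2)) (Psi k) \<eta> \<epsilon> y x * fdx g x y)
    + box_sum M (\<lambda>x y. cell.X3 \<Lambda> (lev k) (unif (k + 2)) (Psi k) \<eta> \<epsilon> y x * cdx g x y)
    + box_sum M (\<lambda>x y. cell.X4 \<Lambda> (lev k) (unif (k + 2)) (Psi k) \<eta> \<epsilon> y x * fdy g x y)"
    unfolding V box_sum_transposed_diffs[where g=g] mult.commute[of "Psi k _" "unif (k + 2) _"] ..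
  finally have V': "box_sum M (\<lambda>x y. ?v y x * (\<epsilon> y * cdx g x y + \<eta> x * cdy g x y)) = \<dots>" .
  show ?thesis
    unfolding tr_def Y1_def Y2_def Y3_def Y4_def distrib_right box_sum_add H V' by linarith
qed

lemma flow_identity:
  assumes g: "supported R g" and M: "R + 1 < M"
  shows "box_sum M (\<lambda>x y. (unif (k + 1) x * unif (k + 1) y) * g x y) - box_sum M (\<lambda>x y. (unif (k + 2) x * unif (k + 2) y) * g x y)
    = - (box_sum M (\<lambda>x y. (Psi k x * unif (k + 1) y) * cdx g x y) + box_sum M (\<lambda>x y. (unif (k + 2) x * Psi k y) * cdy g x y))"
proof -
  have RM: "R < M" using M by simp
  have cd: "central_diff (Psi k) x = unif (k + 1) x - unif (k + 2) x" for x
    unfolding Psi_def by (rule central_diff_ramp_diff) auto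
  have "box_sum M (\<lambda>x y. (unif (k + 1) x * unif (k + 1) y) * g x y) - box_sum M (\<lambda>x y. (unif (k + 2) x * unif (k + 2) y) * g x y)
     = box_sum M (\<lambda>x y. cdx (\<lambda>x y. Psi k x * unif (k + 1) y) x y * g x y + cdy (\<lambda>x y. unif (k + 2) x * Psi k y) x y * g x y)"
    unfolding box_sum_diff[symmetric]
  proof (rule box_sum_cong)
    fix x y
    have e: "cdx (\<lambda>x y. Psi k x * unif (k + 1) y) x y = central_diff (Psi k) x * unif (k + 1) y"
      "cdy (\<lambda>x y. unif (k + 2) x * Psi k y) x y = unif (k + 2) x * central_diff (Psi k) y"
      by (simp_all add: cdx_def cdy_def central_diff_def left_diff_distrib right_diff_distrib)
    show "unif (k + 1) x * unif (k + 1) y * g x y - unif (k + 2) x * unif (k + 2) y * g x y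
      = cdx (\<lambda>x y. Psi k x * unif (k + 1) y) x y * g x y + cdy (\<lambda>x y. unif (k + 2) x * Psi k y) x y * g x y"
      unfolding e cd by (simp add: algebra_simps)
  qed
  then show ?thesis unfolding box_sum_add sbp_cdx[OF g RM] sbp_cdy[OF g RM] by simp
qed

end

lemma level_below:
  assumes "finite \<Lambda>" "{- (8 * 2 ^ K)..8 * 2 ^ K} \<subseteq> \<Lambda>" and k: "k \<in> {64..<K}"
  shows "level \<Lambda> k"
proof
  have "(2::int) ^ k \<le> 2 ^ K" using k by (intro power_increasing) auto
  then have "{- (8 * 2 ^ k)..8 * 2 ^ k} \<subseteq> {- (8 * 2 ^ K)..8 * (2::int) ^ K}" by (intro atLeastatMost_subset_iff[THEN iffD2]) linarith
  then show "{- (8 * 2 ^ k)..8 * 2 ^ k} \<subseteq> \<Lambda>" using assms(2) by (rule order_trans)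
qed (use assms in auto)

section \<open>The Green function in a fixed environment\<close>

text \<open>For coins \<open>\<plusminus>1\<close> this is one step of the walk; for the coins \<open>0\<close> outside the cut-off it is a
  symmetric step.\<close>

definition step_op :: "(int \<Rightarrow> real) \<Rightarrow> (int \<Rightarrow> real) \<Rightarrow> (int \<Rightarrow> int \<Rightarrow> real) \<Rightarrow> int \<Rightarrow> int \<Rightarrow> real" where
  "step_op \<epsilon> \<eta> g x y = (g (x + 1) y + g (x - 1) y + g x (y + 1) + g x (y - 1)) / 4
     + (\<epsilon> y * cdx g x y + \<eta> x * cdy g x y) / 2"

definition dirac :: "int \<Rightarrow> int \<Rightarrow> real" where
  "dirac x y = (if x = 0 \<and> y = 0 then 1 else 0)"

text \<open>\<open>ret \<epsilon> \<eta> m x y\<close> is the probability that the walk from \<open>(x, y)\<close> is at the origin at time \<open>m\<close>.\<close>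

primrec ret :: "(int \<Rightarrow> real) \<Rightarrow> (int \<Rightarrow> real) \<Rightarrow> nat \<Rightarrow> int \<Rightarrow> int \<Rightarrow> real" where
  "ret \<epsilon> \<eta> 0 = dirac"
| "ret \<epsilon> \<eta> (Suc m) = step_op \<epsilon> \<eta> (ret \<epsilon> \<eta> m)"

lemma step_op_convex:
  "step_op \<epsilon> \<eta> g x y = (1 + \<epsilon> y) / 4 * g (x + 1) y + (1 - \<epsilon> y) / 4 * g (x - 1) y
     + (1 + \<eta> x) / 4 * g x (y + 1) + (1 - \<eta> x) / 4 * g x (y - 1)"
  by (simp add: step_op_def cdx_def cdy_def field_simps)

lemma ret_nonneg:
  assumes "\<And>t. \<bar>\<epsilon> t\<bar> \<le> 1" "\<And>t. \<bar>\<eta> t\<bar> \<le> 1"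
  shows "0 \<le> ret \<epsilon> \<eta> m x y"
proof (induction m arbitrary: x y)
  case (Suc m)
  have "0 \<le> 1 + \<epsilon> y" "0 \<le> 1 - \<epsilon> y" "0 \<le> 1 + \<eta> x" "0 \<le> 1 - \<eta> x"
    using assms(1)[of y] assms(2)[of x] by linarith+
  then show ?case unfolding ret.simps step_op_convex using Suc by (intro add_nonneg_nonneg mult_nonneg_nonneg) auto
qed (simp add: dirac_def)

lemma ret_le_1:
  assumes "\<And>t. \<bar>\<epsilon> t\<bar> \<le> 1" "\<And>t. \<bar>\<eta> t\<bar> \<le> 1"
  shows "ret \<epsilon> \<eta> m x y \<le> 1"
proof (induction m arbitrary: x y)
  case (Suc m)
  have "0 \<le> 1 + \<epsilon> y" "0 \<le> 1 - \<epsilon> y" "0 \<le> 1 + \<eta> x" "0 \<le> 1 - \<eta> x"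
    using assms(1)[of y] assms(2)[of x] by linarith+
  then have "ret \<epsilon> \<eta> (Suc m) x y \<le> (1 + \<epsilon> y) / 4 * 1 + (1 - \<epsilon> y) / 4 * 1 + (1 + \<eta> x) / 4 * 1 + (1 - \<eta> x) / 4 * 1"
    unfolding ret.simps step_op_convex by (intro add_mono mult_left_mono Suc) auto
  also have "\<dots> = 1" by (simp add: field_simps)
  finally show ?case .
qed (simp add: dirac_def)

lemma supported_step_op: "supported R g \<Longrightarrow> supported (R + 1) (step_op \<epsilon> \<eta> g)"
  unfolding supported_def step_op_convex by auto

lemma supported_ret: "supported (int m) (ret \<epsilon> \<eta> m)"
proof (induction m)
  case (Suc m)
  then show ?case using supported_step_op[of "int m" "ret \<epsilon> \<eta> m" \<epsilon> \<eta>] by (simp add: add.commute)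
qed (auto simp: supported_def dirac_def)

lemma box_sum_step_op:
  assumes g: "supported R g" and M: "R < M"
  shows "box_sum M (step_op \<epsilon> \<eta> g) = box_sum M g"
proof -
  note sh = box_sum_shift[OF g M, where a="\<lambda>_ _. 1", simplified]
  have "box_sum M (\<lambda>x y. \<epsilon> y * cdx g x y) = 0"
    using sbp_cdx[OF g M, of "\<lambda>x y. \<epsilon> y"] by (simp add: cdx_def[of "\<lambda>x y. \<epsilon> y"] box_sum_def)
  moreover have "box_sum M (\<lambda>x y. \<eta> x * cdy g x y) = 0"
    using sbp_cdy[OF g M, of "\<lambda>x y. \<eta> x"] by (simp add: cdy_def[of "\<lambda>x y. \<eta> x"] box_sum_def)
  moreover have "box_sum M (step_op \<epsilon> \<eta> g) = box_sum M (\<lambda>x y. 1/4 * (g (x + 1) y + g (x - 1) y + g x (y + 1) + g x (y - 1))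
     + 1/2 * (\<epsilon> y * cdx g x y + \<eta> x * cdy g x y))"
    by (rule box_sum_cong) (simp add: step_op_def)
  ultimately show ?thesis unfolding box_sum_add box_sum_cmult using sh by simp
qed

lemma box_sum_dirac: "0 \<le> M \<Longrightarrow> box_sum M (\<lambda>x y. f x y * dirac x y) = f 0 0"
proof -
  assume "0 \<le> M"
  have "box_sum M (\<lambda>x y. f x y * dirac x y) = (\<Sum>x\<in>{-M..M}. if x = 0 then (\<Sum>y\<in>{-M..M}. if y = 0 then f 0 0 else 0) else 0)"
    unfolding box_sum_def
  proof (rule sum.cong[OF refl])
    fix x
    show "(\<Sum>y\<in>{-M..M}. f x y * dirac x y) = (if x = 0 then (\<Sum>y\<in>{-M..M}. if y = 0 then f 0 0 else 0) else 0)"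
    proof (cases "x = 0")
      case True
      have "(\<Sum>y\<in>{-M..M}. f x y * dirac x y) = (\<Sum>y\<in>{-M..M}. if y = 0 then f 0 0 else 0)"
        by (rule sum.cong) (use True in \<open>auto simp: dirac_def\<close>)
      then show ?thesis using True by simp
    qed (simp add: dirac_def)
  qed
  then show ?thesis using \<open>0 \<le> M\<close> by simp
qed

lemma box_sum_ret: "int m < M \<Longrightarrow> box_sum M (ret \<epsilon> \<eta> m) = 1"
proof (induction m)
  case 0
  then show ?case using box_sum_dirac[of M "\<lambda>_ _. 1"] by simp
next
  case (Suc m)
  then show ?case using box_sum_step_op[OF supported_ret, of m M \<epsilon> \<eta> \<epsilon> \<eta>] by simp
qed

definition grn :: "real \<Rightarrow> nat \<Rightarrow> (int \<Rightarrow> real) \<Rightarrow> (int \<Rightarrow> real) \<Rightarrow> int \<Rightarrow> int \<Rightarrow> real" where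
  "grn r T \<epsilon> \<eta> x y = (\<Sum>m<T. r ^ m * ret \<epsilon> \<eta> m x y)"

lemma supported_grn: "supported (int T) (grn r T \<epsilon> \<eta>)"
  unfolding supported_def grn_def
proof (intro allI impI sum.neutral ballI)
  fix x y m assume a: "int T < \<bar>x\<bar> \<or> int T < \<bar>y\<bar>" "m \<in> {..<T}"
  then have "int m < \<bar>x\<bar> \<or> int m < \<bar>y\<bar>" by auto
  then show "r ^ m * ret \<epsilon> \<eta> m x y = 0" using supported_ret[of m \<epsilon> \<eta>] unfolding supported_def by auto
qed

lemma grn_resolvent: "grn r T \<epsilon> \<eta> x y - r * step_op \<epsilon> \<eta> (grn r T \<epsilon> \<eta>) x y = dirac x y - r ^ T * ret \<epsilon> \<eta> T x y"
proof (induction T)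
  case 0
  then show ?case by (simp add: grn_def step_op_convex)
next
  case (Suc T)
  have "step_op \<epsilon> \<eta> (grn r (Suc T) \<epsilon> \<eta>) x y = step_op \<epsilon> \<eta> (grn r T \<epsilon> \<eta>) x y + r ^ T * ret \<epsilon> \<eta> (Suc T) x y"
    unfolding ret.simps step_op_convex by (simp add: grn_def algebra_simps)
  moreover have "grn r (Suc T) \<epsilon> \<eta> x y = grn r T \<epsilon> \<eta> x y + r ^ T * ret \<epsilon> \<eta> T x y" by (simp add: grn_def)
  ultimately show ?case using Suc by (simp add: algebra_simps)
qed

lemma box_sum_gradient:
  assumes g: "supported R g" and M: "R + 1 < M"
  shows "box_sum M (\<lambda>x y. f x y * step_op \<epsilon> \<eta> g x y) = box_sum M (\<lambda>x y. f x y * g x y)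
    - 1/4 * (box_sum M (\<lambda>x y. fdx f x y * fdx g x y) + box_sum M (\<lambda>x y. fdy f x y * fdy g x y))
    + 1/2 * box_sum M (\<lambda>x y. f x y * (\<epsilon> y * cdx g x y + \<eta> x * cdy g x y))"
proof -
  have 1: "box_sum M (\<lambda>x y. fdx f x y * fdx g x y) = box_sum M (\<lambda>x y. f x y * (2 * g x y - g (x + 1) y - g (x - 1) y))"
  proof -
    have "box_sum M (\<lambda>x y. fdx f x y * fdx g x y) = box_sum M (\<lambda>x y. f (x + 1) y * fdx g x y) - box_sum M (\<lambda>x y. f x y * fdx g x y)"
      unfolding box_sum_diff[symmetric] by (rule box_sum_cong) (simp add: fdx_def[of f] left_diff_distrib)
    also have "\<dots> = box_sum M (\<lambda>x y. f x y * fdx g (x - 1) y) - box_sum M (\<lambda>x y. f x y * fdx g x y)"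
      unfolding box_sum_shift(1)[OF supported_diffs(3)[OF g] M] ..
    also have "\<dots> = box_sum M (\<lambda>x y. f x y * (2 * g x y - g (x + 1) y - g (x - 1) y))"
      unfolding box_sum_diff[symmetric] by (rule box_sum_cong) (simp add: fdx_def algebra_simps)
    finally show ?thesis .
  qed
  have 2: "box_sum M (\<lambda>x y. fdy f x y * fdy g x y) = box_sum M (\<lambda>x y. f x y * (2 * g x y - g x (y + 1) - g x (y - 1)))"
  proof -
    have "box_sum M (\<lambda>x y. fdy f x y * fdy g x y) = box_sum M (\<lambda>x y. f x (y + 1) * fdy g x y) - box_sum M (\<lambda>x y. f x y * fdy g x y)"
      unfolding box_sum_diff[symmetric] by (rule box_sum_cong) (simp add: fdy_def[of f] left_diff_distrib)
    also have "\<dots> = box_sum M (\<lambda>x y. f x y * fdy g x (y - 1)) - box_sum M (\<lambda>x y. f x y * fdy g x y)"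
      unfolding box_sum_shift(3)[OF supported_diffs(4)[OF g] M] ..
    also have "\<dots> = box_sum M (\<lambda>x y. f x y * (2 * g x y - g x (y + 1) - g x (y - 1)))"
      unfolding box_sum_diff[symmetric] by (rule box_sum_cong) (simp add: fdy_def algebra_simps)
    finally show ?thesis .
  qed
  show ?thesis
    unfolding 1 2 box_sum_add[symmetric] box_sum_diff[symmetric] box_sum_cmult[symmetric]
    by (rule box_sum_cong) (simp add: step_op_def field_simps)
qed

lemma box_sum_antisymmetric:
  assumes g: "supported R g" and M: "R < M"
  shows "box_sum M (\<lambda>x y. g x y * (\<epsilon> y * cdx g x y + \<eta> x * cdy g x y)) = 0"
proof -
  have s: "supported R (\<lambda>x y. \<epsilon> y * g x y)" "supported R (\<lambda>x y. \<eta> x * g x y)" using g unfolding supported_def by auto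
  have "box_sum M (\<lambda>x y. cdx g x y * (\<epsilon> y * g x y)) = - box_sum M (\<lambda>x y. g x y * cdx (\<lambda>x y. \<epsilon> y * g x y) x y)"
    by (rule sbp_cdx[OF s(1) M])
  moreover have "box_sum M (\<lambda>x y. g x y * cdx (\<lambda>x y. \<epsilon> y * g x y) x y) = box_sum M (\<lambda>x y. cdx g x y * (\<epsilon> y * g x y))"
    by (rule box_sum_cong) (simp add: cdx_def field_simps)
  ultimately have 1: "box_sum M (\<lambda>x y. cdx g x y * (\<epsilon> y * g x y)) = 0" by simp
  have "box_sum M (\<lambda>x y. cdy g x y * (\<eta> x * g x y)) = - box_sum M (\<lambda>x y. g x y * cdy (\<lambda>x y. \<eta> x * g x y) x y)"
    by (rule sbp_cdy[OF s(2) M])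
  moreover have "box_sum M (\<lambda>x y. g x y * cdy (\<lambda>x y. \<eta> x * g x y) x y) = box_sum M (\<lambda>x y. cdy g x y * (\<eta> x * g x y))"
    by (rule box_sum_cong) (simp add: cdy_def field_simps)
  ultimately have 2: "box_sum M (\<lambda>x y. cdy g x y * (\<eta> x * g x y)) = 0" by simp
  have "box_sum M (\<lambda>x y. g x y * (\<epsilon> y * cdx g x y + \<eta> x * cdy g x y))
     = box_sum M (\<lambda>x y. cdx g x y * (\<epsilon> y * g x y)) + box_sum M (\<lambda>x y. cdy g x y * (\<eta> x * g x y))"
    unfolding box_sum_add[symmetric] by (rule box_sum_cong) (simp add: algebra_simps)
  then show ?thesis using 1 2 by simp
qed

lemma box_sum_abs: "\<bar>box_sum M a\<bar> \<le> box_sum M (\<lambda>x y. \<bar>a x y\<bar>)"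
  unfolding box_sum_def by (intro order_trans[OF sum_abs] sum_mono sum_abs)

lemma box_sum_am_gm:
  assumes "0 < c"
  shows "\<bar>box_sum M (\<lambda>x y. a x y * b x y)\<bar> \<le> c / 2 * box_sum M (\<lambda>x y. (a x y)\<^sup>2) + 1 / (2 * c) * box_sum M (\<lambda>x y. (b x y)\<^sup>2)"
proof -
  have "\<bar>box_sum M (\<lambda>x y. a x y * b x y)\<bar> \<le> box_sum M (\<lambda>x y. c / 2 * (a x y)\<^sup>2 + 1 / (2 * c) * (b x y)\<^sup>2)"
    by (rule order_trans[OF box_sum_abs], rule box_sum_mono, rule order_trans[OF weighted_am_gm[OF assms]])
       (use assms in \<open>simp add: field_simps\<close>)
  then show ?thesis unfolding box_sum_add box_sum_cmult .
qed

lemma box_sum_cd_le_fd: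
  assumes g: "supported R g" and M: "R + 1 < M"
  shows "box_sum M (\<lambda>x y. (cdx g x y)\<^sup>2) \<le> box_sum M (\<lambda>x y. (fdx g x y)\<^sup>2)"
    "box_sum M (\<lambda>x y. (cdy g x y)\<^sup>2) \<le> box_sum M (\<lambda>x y. (fdy g x y)\<^sup>2)"
proof -
  have av: "((a + b) / 2)\<^sup>2 \<le> 1/2 * a\<^sup>2 + 1/2 * b\<^sup>2" for a b :: real
    using zero_le_power2[of "a - b"] by (simp add: power2_eq_square field_simps)
  have sx: "supported (R + 1) (\<lambda>x y. (fdx g x y)\<^sup>2)" and sy: "supported (R + 1) (\<lambda>x y. (fdy g x y)\<^sup>2)"
    using supported_diffs(3,4)[OF g] unfolding supported_def by auto
  have "box_sum M (\<lambda>x y. (cdx g x y)\<^sup>2) \<le> box_sum M (\<lambda>x y. 1/2 * (fdx g x y)\<^sup>2 + 1/2 * (fdx g (x - 1) y)\<^sup>2)"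
  proof (rule box_sum_mono)
    fix x y
    have e: "cdx g x y = (fdx g x y + fdx g (x - 1) y) / 2" by (simp add: cdx_def fdx_def)
    show "(cdx g x y)\<^sup>2 \<le> 1/2 * (fdx g x y)\<^sup>2 + 1/2 * (fdx g (x - 1) y)\<^sup>2" unfolding e by (rule av)
  qed
  also have "box_sum M (\<lambda>x y. (fdx g (x - 1) y)\<^sup>2) = box_sum M (\<lambda>x y. (fdx g x y)\<^sup>2)"
    using box_sum_shift(1)[OF sx M, of "\<lambda>_ _. 1"] by simp
  then have "box_sum M (\<lambda>x y. 1/2 * (fdx g x y)\<^sup>2 + 1/2 * (fdx g (x - 1) y)\<^sup>2) = box_sum M (\<lambda>x y. (fdx g x y)\<^sup>2)"
    unfolding box_sum_add box_sum_cmult by simp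
  finally show "box_sum M (\<lambda>x y. (cdx g x y)\<^sup>2) \<le> box_sum M (\<lambda>x y. (fdx g x y)\<^sup>2)" .
  have "box_sum M (\<lambda>x y. (cdy g x y)\<^sup>2) \<le> box_sum M (\<lambda>x y. 1/2 * (fdy g x y)\<^sup>2 + 1/2 * (fdy g x (y - 1))\<^sup>2)"
  proof (rule box_sum_mono)
    fix x y
    have e: "cdy g x y = (fdy g x y + fdy g x (y - 1)) / 2" by (simp add: cdy_def fdy_def)
    show "(cdy g x y)\<^sup>2 \<le> 1/2 * (fdy g x y)\<^sup>2 + 1/2 * (fdy g x (y - 1))\<^sup>2" unfolding e by (rule av)
  qed
  also have "box_sum M (\<lambda>x y. (fdy g x (y - 1))\<^sup>2) = box_sum M (\<lambda>x y. (fdy g x y)\<^sup>2)"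
    using box_sum_shift(3)[OF sy M, of "\<lambda>_ _. 1"] by simp
  then have "box_sum M (\<lambda>x y. 1/2 * (fdy g x y)\<^sup>2 + 1/2 * (fdy g x (y - 1))\<^sup>2) = box_sum M (\<lambda>x y. (fdy g x y)\<^sup>2)"
    unfolding box_sum_add box_sum_cmult by simp
  finally show "box_sum M (\<lambda>x y. (cdy g x y)\<^sup>2) \<le> box_sum M (\<lambda>x y. (fdy g x y)\<^sup>2)" .
qed

lemma path_difference:
  fixes g :: "int \<Rightarrow> int \<Rightarrow> real"
  assumes a: "a < M" and b: "b < M" and nn: "0 \<le> a" "0 \<le> b" and c: "0 < c"
  shows "\<bar>g 0 0 - g a b\<bar> \<le> c / 2 * real_of_int (a + b)
    + 1 / (2 * c) * (box_sum M (\<lambda>x y. (fdx g x y)\<^sup>2) + box_sum M (\<lambda>x y. (fdy g x y)\<^sup>2))"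
proof -
  have am: "\<bar>t\<bar> \<le> c / 2 + 1 / (2 * c) * t\<^sup>2" for t :: real
    using weighted_am_gm[OF c, of 1 t] c by (simp add: field_simps)
  have tel: "h (int m) - h 0 = (\<Sum>i\<in>{0..<int m}. h (i + 1) - h i)" for h :: "int \<Rightarrow> real" and m
  proof (induction m)
    case (Suc m)
    have "{0..<int (Suc m)} = insert (int m) {0..<int m}" by auto
    then show ?case using Suc by (simp add: add.commute)
  qed simp
  have tel': "h m - h 0 = (\<Sum>i\<in>{0..<m}. h (i + 1) - h i)" if "0 \<le> m" for h :: "int \<Rightarrow> real" and m
    using tel[of h "nat m"] that by simp
  have one: "\<bar>h m - h 0\<bar> \<le> c / 2 * real_of_int m + 1 / (2 * c) * (\<Sum>i\<in>{-M..M}. (h (i + 1) - h i)\<^sup>2)"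
    if "0 \<le> m" "m < M" for h :: "int \<Rightarrow> real" and m
  proof -
    have "\<bar>h m - h 0\<bar> \<le> (\<Sum>i\<in>{0..<m}. c / 2 + 1 / (2 * c) * (h (i + 1) - h i)\<^sup>2)"
      unfolding tel'[OF that(1)] by (intro order_trans[OF sum_abs] sum_mono am)
    also have "\<dots> = c / 2 * real_of_int m + 1 / (2 * c) * (\<Sum>i\<in>{0..<m}. (h (i + 1) - h i)\<^sup>2)"
      using that by (simp add: sum.distrib sum_distrib_left mult.commute)
    also have "\<dots> \<le> c / 2 * real_of_int m + 1 / (2 * c) * (\<Sum>i\<in>{-M..M}. (h (i + 1) - h i)\<^sup>2)"
      by (intro add_left_mono mult_left_mono sum_mono2) (use that c in auto)
    finally show ?thesis .
  qed
  have M: "0 \<in> {-M..M}" "a \<in> {-M..M}" using a b nn by auto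
  have "(\<Sum>i\<in>{-M..M}. (g (i + 1) 0 - g i 0)\<^sup>2) \<le> box_sum M (\<lambda>x y. (fdx g x y)\<^sup>2)"
    unfolding box_sum_swap fdx_def by (rule member_le_sum[OF M(1)]) (auto intro: sum_nonneg)
  then have 1: "\<bar>g a 0 - g 0 0\<bar> \<le> c / 2 * real_of_int a + 1 / (2 * c) * box_sum M (\<lambda>x y. (fdx g x y)\<^sup>2)"
    using one[OF nn(1) a, of "\<lambda>i. g i 0"] c by (meson add_left_mono mult_left_mono order_trans divide_nonneg_pos zero_le_one mult_pos_pos zero_less_numeral)
  have "(\<Sum>i\<in>{-M..M}. (g a (i + 1) - g a i)\<^sup>2) \<le> box_sum M (\<lambda>x y. (fdy g x y)\<^sup>2)"
    unfolding box_sum_def fdy_def by (rule member_le_sum[OF M(2)]) (auto intro: sum_nonneg)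
  then have 2: "\<bar>g a b - g a 0\<bar> \<le> c / 2 * real_of_int b + 1 / (2 * c) * box_sum M (\<lambda>x y. (fdy g x y)\<^sup>2)"
    using one[OF nn(2) b, of "\<lambda>i. g a i"] c by (meson add_left_mono mult_left_mono order_trans divide_nonneg_pos zero_le_one mult_pos_pos zero_less_numeral)
  have "\<bar>g 0 0 - g a b\<bar> \<le> \<bar>g a 0 - g 0 0\<bar> + \<bar>g a b - g a 0\<bar>" by linarith
  also have "\<dots> \<le> (c / 2 * real_of_int a + 1 / (2 * c) * box_sum M (\<lambda>x y. (fdx g x y)\<^sup>2))
     + (c / 2 * real_of_int b + 1 / (2 * c) * box_sum M (\<lambda>x y. (fdy g x y)\<^sup>2))" by (intro add_mono 1 2)
  finally show ?thesis by (simp add: algebra_simps add_divide_distrib)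
qed

lemma sum_unif: "2 ^ m \<le> M \<Longrightarrow> (\<Sum>x\<in>{-M..M}. unif m x) = 1"
proof -
  assume M: "2 ^ m \<le> M"
  have "(\<Sum>x\<in>{-M..M}. unif m x) = (\<Sum>x\<in>{0..<2 ^ m}. unif m x)"
  proof (rule sum.mono_neutral_right)
    have "(0::int) < 2 ^ m" by simp
    then show "{0..<2 ^ m} \<subseteq> {-M..M}" using M by auto
  qed (auto simp: unif_def)
  also have "\<dots> = (\<Sum>x\<in>{0..<2 ^ m :: int}. 1 / 2 ^ m)" by (rule sum.cong) (auto simp: unif_def)
  finally show ?thesis by simp
qed

lemma box_sum_unif: "2 ^ m \<le> M \<Longrightarrow> box_sum M (\<lambda>x y. unif m x * unif m y) = 1"
  unfolding box_sum_def by (simp add: sum_unif flip: sum_distrib_left)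

lemma box_sum_unif_sq: "2 ^ m \<le> M \<Longrightarrow> box_sum M (\<lambda>x y. (unif m x * unif m y)\<^sup>2) \<le> 1 / 4 ^ m"
proof -
  assume M: "2 ^ m \<le> M"
  have "(unif m x * unif m y)\<^sup>2 \<le> 1 / 4 ^ m * (unif m x * unif m y)" for x y
  proof -
    have "(4::real) ^ m = 2 ^ m * 2 ^ m" by (simp flip: power_mult_distrib)
    then show ?thesis by (simp add: unif_def power2_eq_square)
  qed
  then have "box_sum M (\<lambda>x y. (unif m x * unif m y)\<^sup>2) \<le> box_sum M (\<lambda>x y. 1 / 4 ^ m * (unif m x * unif m y))"
    by (rule box_sum_mono)
  then show ?thesis unfolding box_sum_cmult box_sum_unif[OF M] by simp
qed

lemma box_sum_unif_difference:
  assumes M: "2 ^ m \<le> M" and B: "\<And>x y. 0 \<le> x \<Longrightarrow> x < 2 ^ m \<Longrightarrow> 0 \<le> y \<Longrightarrow> y < 2 ^ m \<Longrightarrow> \<bar>c - g x y\<bar> \<le> B"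
  shows "\<bar>c - box_sum M (\<lambda>x y. (unif m x * unif m y) * g x y)\<bar> \<le> B"
proof -
  have "c - box_sum M (\<lambda>x y. (unif m x * unif m y) * g x y) = box_sum M (\<lambda>x y. c * (unif m x * unif m y) - (unif m x * unif m y) * g x y)"
    unfolding box_sum_diff box_sum_cmult box_sum_unif[OF M] by simp
  also have "\<bar>\<dots>\<bar> \<le> box_sum M (\<lambda>x y. B * (unif m x * unif m y))"
  proof (rule order_trans[OF box_sum_abs], rule box_sum_mono)
    fix x y
    have "\<bar>c * (unif m x * unif m y) - (unif m x * unif m y) * g x y\<bar> = \<bar>c - g x y\<bar> * (unif m x * unif m y)"
    proof -
      have nn: "0 \<le> unif m x * unif m y" by (simp add: unif_def)
      have "c * (unif m x * unif m y) - (unif m x * unif m y) * g x y = (c - g x y) * (unif m x * unif m y)" by (simp add: algebra_simps)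
      then show ?thesis by (simp only: abs_mult[of "c - g x y"] abs_of_nonneg[OF nn])
    qed
    also have "\<dots> \<le> B * (unif m x * unif m y)"
    proof (cases "unif m x * unif m y = 0")
      case False
      then have "\<bar>c - g x y\<bar> \<le> B" using B[of x y] by (auto simp: unif_def split: if_splits)
      then show ?thesis by (rule mult_right_mono) (simp add: unif_def)
    qed (simp only: mult_zero_right)
    finally show "\<bar>c * (unif m x * unif m y) - (unif m x * unif m y) * g x y\<bar> \<le> B * (unif m x * unif m y)" .
  qed
  finally show ?thesis unfolding box_sum_cmult box_sum_unif[OF M] by simp
qed

locale quenched =
  fixes \<Lambda> :: "int set" and K T :: nat and M :: int and \<epsilon> \<eta> :: "int \<Rightarrow> real"
  assumes fin\<Lambda>: "finite \<Lambda>" and \<Lambda>K: "{- (8 * 2 ^ K)..8 * 2 ^ K} \<subseteq> \<Lambda>" and K64: "64 \<le> K"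
    and MT: "int T + 1 < M" and MK: "2 ^ (K + 1) \<le> M"
    and \<epsilon>: "\<epsilon> \<in> coins \<Lambda>" and \<eta>: "\<eta> \<in> coins \<Lambda>"
begin

definition "r = 1 - 1 / (4::real) ^ K"
definition "g = grn r T \<epsilon> \<eta>"
definition "f x y = (\<Sum>k\<in>{64..<K}. tr \<Lambda> k \<epsilon> \<eta> x y)"
definition "Z1 x y = (\<Sum>k\<in>{64..<K}. Y1 \<Lambda> k \<epsilon> \<eta> x y)"
definition "Z2 x y = (\<Sum>k\<in>{64..<K}. Y2 \<Lambda> k \<epsilon> \<eta> x y)"
definition "Z3 x y = (\<Sum>k\<in>{64..<K}. Y3 \<Lambda> k \<epsilon> \<eta> x y)"
definition "Z4 x y = (\<Sum>k\<in>{64..<K}. Y4 \<Lambda> k \<epsilon> \<eta> x y)"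
definition "D = box_sum M (\<lambda>x y. (fdx g x y)\<^sup>2) + box_sum M (\<lambda>x y. (fdy g x y)\<^sup>2)"
definition "A = box_sum M (\<lambda>x y. f x y * (\<epsilon> y * cdx g x y + \<eta> x * cdy g x y))"

lemma r_bounds: "1/2 \<le> r" "r < 1" "1 - r = 1 / 4 ^ K"
proof -
  have "(4::real) ^ 1 \<le> 4 ^ K" using K64 by (intro power_increasing) auto
  then have "1 / (4::real) ^ K \<le> 1 / 2" by (intro divide_left_mono) auto
  then show "1/2 \<le> r" by (simp add: r_def)
qed (simp_all add: r_def)

lemma abs_le_1: "\<bar>\<epsilon> t\<bar> \<le> 1" "\<bar>\<eta> t\<bar> \<le> 1"
  using \<epsilon> \<eta> by (auto intro: abs_coin_le_1)

lemma g_supp: "supported (int T) g" unfolding g_def by (rule supported_grn)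

lemma g_nonneg: "0 \<le> g x y"
  unfolding g_def grn_def by (intro sum_nonneg mult_nonneg_nonneg ret_nonneg abs_le_1 zero_le_power) (use r_bounds in auto)

lemma D_nonneg: "0 \<le> D" unfolding D_def by (intro add_nonneg_nonneg box_sum_nonneg) auto

lemma weak_form:
  "(1 - r) * box_sum M (\<lambda>x y. h x y * g x y) + r / 4 * (box_sum M (\<lambda>x y. fdx h x y * fdx g x y) + box_sum M (\<lambda>x y. fdy h x y * fdy g x y))
     - r / 2 * box_sum M (\<lambda>x y. h x y * (\<epsilon> y * cdx g x y + \<eta> x * cdy g x y))
   = h 0 0 - r ^ T * box_sum M (\<lambda>x y. h x y * ret \<epsilon> \<eta> T x y)"
proof -
  have M0: "0 \<le> M" using MT by simp
  have "box_sum M (\<lambda>x y. h x y * g x y) - r * box_sum M (\<lambda>x y. h x y * step_op \<epsilon> \<eta> g x y)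
     = box_sum M (\<lambda>x y. h x y * (g x y - r * step_op \<epsilon> \<eta> g x y))"
    unfolding box_sum_cmult[symmetric] box_sum_diff[symmetric] by (rule box_sum_cong) (simp add: algebra_simps)
  also have "\<dots> = box_sum M (\<lambda>x y. h x y * dirac x y - r ^ T * (h x y * ret \<epsilon> \<eta> T x y))"
    unfolding g_def grn_resolvent by (rule box_sum_cong) (simp add: algebra_simps)
  also have "\<dots> = h 0 0 - r ^ T * box_sum M (\<lambda>x y. h x y * ret \<epsilon> \<eta> T x y)"
    unfolding box_sum_diff box_sum_cmult box_sum_dirac[OF M0] ..
  finally show ?thesis
    unfolding box_sum_gradient[OF g_supp MT] by (simp add: algebra_simps)
qed

lemma energy: "(1 - r) * box_sum M (\<lambda>x y. (g x y)\<^sup>2) \<le> g 0 0" "D \<le> 8 * g 0 0"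
proof -
  have MT': "int T < M" using MT by simp
  have "0 \<le> r ^ T * box_sum M (\<lambda>x y. g x y * ret \<epsilon> \<eta> T x y)"
    by (intro mult_nonneg_nonneg zero_le_power box_sum_nonneg g_nonneg ret_nonneg abs_le_1) (use r_bounds in auto)
  then have e: "(1 - r) * box_sum M (\<lambda>x y. (g x y)\<^sup>2) + r / 4 * D \<le> g 0 0"
    using weak_form[of g] unfolding box_sum_antisymmetric[OF g_supp MT'] D_def power2_eq_square by simp
  have 1: "0 \<le> (1 - r) * box_sum M (\<lambda>x y. (g x y)\<^sup>2)"
    by (intro mult_nonneg_nonneg box_sum_nonneg) (use r_bounds in auto)
  have 2: "1 / 8 * D \<le> r / 4 * D" using r_bounds D_nonneg by (intro mult_right_mono) auto
  show "(1 - r) * box_sum M (\<lambda>x y. (g x y)\<^sup>2) \<le> g 0 0" using e 2 D_nonneg by linarith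
  show "D \<le> 8 * g 0 0" using e 1 2 by linarith
qed

lemma ret_sq: "box_sum M (\<lambda>x y. (ret \<epsilon> \<eta> T x y)\<^sup>2) \<le> 1"
proof -
  have "box_sum M (\<lambda>x y. (ret \<epsilon> \<eta> T x y)\<^sup>2) \<le> box_sum M (ret \<epsilon> \<eta> T)"
  proof (rule box_sum_mono)
    fix x y
    show "(ret \<epsilon> \<eta> T x y)\<^sup>2 \<le> ret \<epsilon> \<eta> T x y"
      using ret_nonneg[where \<epsilon>=\<epsilon> and \<eta>=\<eta> and m=T and x=x and y=y, OF abs_le_1]
        ret_le_1[where \<epsilon>=\<epsilon> and \<eta>=\<eta> and m=T and x=x and y=y, OF abs_le_1]
      by (simp add: power2_eq_square mult_left_le_one_le)
  qed
  then show ?thesis using box_sum_ret[of T M \<epsilon> \<eta>] MT by simp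
qed

lemma A_bound:
  "\<bar>A\<bar> \<le> 64 * (1 - r) * box_sum M (\<lambda>x y. (f x y)\<^sup>2)
     + 32 * (box_sum M (\<lambda>x y. (fdx f x y)\<^sup>2) + box_sum M (\<lambda>x y. (fdy f x y)\<^sup>2))
     + 4 * \<bar>f 0 0\<bar> + 2 * r ^ T * (box_sum M (\<lambda>x y. (f x y)\<^sup>2) + 1) + 1 / 8 * g 0 0"
proof -
  let ?S = "box_sum M (\<lambda>x y. (f x y)\<^sup>2)" and ?G = "box_sum M (\<lambda>x y. (g x y)\<^sup>2)"
  let ?fg = "box_sum M (\<lambda>x y. f x y * g x y)" and ?fr = "box_sum M (\<lambda>x y. f x y * ret \<epsilon> \<eta> T x y)"
  let ?X = "box_sum M (\<lambda>x y. fdx f x y * fdx g x y)" and ?Y = "box_sum M (\<lambda>x y. fdy f x y * fdy g x y)"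
  let ?Fx = "box_sum M (\<lambda>x y. (fdx f x y)\<^sup>2)" and ?Fy = "box_sum M (\<lambda>x y. (fdy f x y)\<^sup>2)"
  have w: "r / 2 * A = (1 - r) * ?fg + r / 4 * (?X + ?Y) - f 0 0 + r ^ T * ?fr"
    using weak_form[of f] unfolding A_def by linarith
  have rT: "0 \<le> r ^ T" using r_bounds by simp
  have "1/4 * \<bar>A\<bar> \<le> r / 2 * \<bar>A\<bar>" using r_bounds by (intro mult_right_mono) auto
  also have "\<dots> = \<bar>r / 2 * A\<bar>" using r_bounds by (simp add: abs_mult)
  also have "\<dots> \<le> (1 - r) * \<bar>?fg\<bar> + r / 4 * (\<bar>?X\<bar> + \<bar>?Y\<bar>) + \<bar>f 0 0\<bar> + r ^ T * \<bar>?fr\<bar>"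
  proof -
    have "\<bar>(1 - r) * ?fg\<bar> = (1 - r) * \<bar>?fg\<bar>" "\<bar>r ^ T * ?fr\<bar> = r ^ T * \<bar>?fr\<bar>" "\<bar>r / 4 * (?X + ?Y)\<bar> \<le> r / 4 * (\<bar>?X\<bar> + \<bar>?Y\<bar>)"
      using r_bounds rT by (auto simp: abs_mult)
    then show ?thesis unfolding w by linarith
  qed
  finally have 0: "\<bar>A\<bar> \<le> 4 * ((1 - r) * \<bar>?fg\<bar>) + r * (\<bar>?X\<bar> + \<bar>?Y\<bar>) + 4 * \<bar>f 0 0\<bar> + 4 * (r ^ T * \<bar>?fr\<bar>)" by linarith
  have 1: "(1 - r) * \<bar>?fg\<bar> \<le> (1 - r) * (16 * ?S) + 1 / 64 * g 0 0"
  proof -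
    have "(1 - r) * \<bar>?fg\<bar> \<le> (1 - r) * (32 / 2 * ?S + 1 / (2 * 32) * ?G)"
      by (intro mult_left_mono box_sum_am_gm) (use r_bounds in auto)
    also have "\<dots> = (1 - r) * (16 * ?S) + 1 / 64 * ((1 - r) * ?G)" by (simp add: distrib_left)
    finally show ?thesis using energy(1) by linarith
  qed
  have 2: "r * (\<bar>?X\<bar> + \<bar>?Y\<bar>) \<le> 32 * (?Fx + ?Fy) + 1 / 128 * D"
  proof -
    have "r * (\<bar>?X\<bar> + \<bar>?Y\<bar>) \<le> 1 * (\<bar>?X\<bar> + \<bar>?Y\<bar>)" using r_bounds by (intro mult_right_mono) auto
    moreover have "\<bar>?X\<bar> \<le> 64 / 2 * ?Fx + 1 / (2 * 64) * box_sum M (\<lambda>x y. (fdx g x y)\<^sup>2)" by (rule box_sum_am_gm) simp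
    moreover have "\<bar>?Y\<bar> \<le> 64 / 2 * ?Fy + 1 / (2 * 64) * box_sum M (\<lambda>x y. (fdy g x y)\<^sup>2)" by (rule box_sum_am_gm) simp
    ultimately show ?thesis unfolding D_def by (simp add: field_simps)
  qed
  have 3: "r ^ T * \<bar>?fr\<bar> \<le> r ^ T * (1 / 2 * (?S + 1))"
  proof (intro mult_left_mono rT)
    have "\<bar>?fr\<bar> \<le> 1 / 2 * ?S + 1 / (2 * 1) * box_sum M (\<lambda>x y. (ret \<epsilon> \<eta> T x y)\<^sup>2)" by (rule box_sum_am_gm) simp
    then show "\<bar>?fr\<bar> \<le> 1 / 2 * (?S + 1)" using ret_sq by (simp add: field_simps)
  qed
  have g0: "0 \<le> g 0 0" by (rule g_nonneg)
  have "\<bar>A\<bar> \<le> 4 * ((1 - r) * (16 * ?S) + 1 / 64 * g 0 0) + (32 * (?Fx + ?Fy) + 1 / 128 * D) + 4 * \<bar>f 0 0\<bar> + 4 * (r ^ T * (1 / 2 * (?S + 1)))"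
    by (rule order_trans[OF 0], intro add_mono mult_left_mono 1 2 3 order_refl) auto
  also have "\<dots> = 64 * (1 - r) * ?S + 1 / 16 * g 0 0 + 32 * (?Fx + ?Fy) + 1 / 128 * D + 4 * \<bar>f 0 0\<bar> + 2 * r ^ T * (?S + 1)"
    by (simp add: algebra_simps)
  finally have 4: "\<bar>A\<bar> \<le> 64 * (1 - r) * ?S + 1 / 16 * g 0 0 + 32 * (?Fx + ?Fy) + 1 / 128 * D + 4 * \<bar>f 0 0\<bar> + 2 * r ^ T * (?S + 1)" .
  have ar: "a \<le> s + 32 * q + f0 + t + 1 / 8 * g0"
    if "a \<le> s + 1 / 16 * g0 + 32 * q + 1 / 128 * d + f0 + t" "d \<le> 8 * g0" for a s q f0 t g0 d :: real
    using that by linarith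
  show ?thesis by (rule ar[OF 4 energy(2)])
qed

definition "W = box_sum M (\<lambda>x y. Z1 x y * cdx g x y) + box_sum M (\<lambda>x y. Z2 x y * fdy g x y)
   + box_sum M (\<lambda>x y. Z3 x y * cdy g x y) + box_sum M (\<lambda>x y. Z4 x y * fdx g x y)"

definition "mass k = box_sum M (\<lambda>x y. (unif (k + 1) x * unif (k + 1) y) * g x y)"

lemma level: "k \<in> {64..<K} \<Longrightarrow> level \<Lambda> k"
  by (rule level_below[OF fin\<Lambda> \<Lambda>K])

lemma mass_telescope: "mass 64 - mass K = W - A"
proof -
  let ?h = "\<lambda>k. box_sum M (\<lambda>x y. (Psi k x * unif (k + 1) y) * cdx g x y) + box_sum M (\<lambda>x y. (unif (k + 2) x * Psi k y) * cdy g x y)"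
  have "mass K - mass 64 = (\<Sum>k\<in>{64..<K}. mass (Suc k) - mass k)"
    by (rule sum_Suc_diff'[symmetric]) (use K64 in auto)
  also have "\<dots> = (\<Sum>k\<in>{64..<K}. ?h k)"
  proof (rule sum.cong[OF refl])
    fix k assume "k \<in> {64..<K}"
    from level.flow_identity[OF level[OF this] g_supp MT]
    show "mass (Suc k) - mass k = ?h k" unfolding mass_def by simp
  qed
  finally have 1: "mass K - mass 64 = (\<Sum>k\<in>{64..<K}. ?h k)" .
  have dist: "box_sum M (\<lambda>x y. (\<Sum>k\<in>{64..<K}. a k x y) * h x y) = (\<Sum>k\<in>{64..<K}. box_sum M (\<lambda>x y. a k x y * h x y))" for a h
    unfolding sum_distrib_right box_sum_sum ..
  have "A = (\<Sum>k\<in>{64..<K}. ?h k + box_sum M (\<lambda>x y. Y1 \<Lambda> k \<epsilon> \<eta> x y * cdx g x y) + box_sum M (\<lambda>x y. Y2 \<Lambda> k \<epsilon> \<eta> x y * fdy g x y)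
    + box_sum M (\<lambda>x y. Y3 \<Lambda> k \<epsilon> \<eta> x y * cdy g x y) + box_sum M (\<lambda>x y. Y4 \<Lambda> k \<epsilon> \<eta> x y * fdx g x y))"
    unfolding A_def f_def dist
    by (rule sum.cong[OF refl], rule level.level_identity[OF level g_supp MT \<epsilon> \<eta>])
  also have "\<dots> = (\<Sum>k\<in>{64..<K}. ?h k) + W"
    unfolding W_def Z1_def Z2_def Z3_def Z4_def dist sum.distrib by simp
  finally show ?thesis using 1 by linarith
qed

lemma W_bound: "\<bar>W\<bar> \<le> 64 * (box_sum M (\<lambda>x y. (Z1 x y)\<^sup>2) + box_sum M (\<lambda>x y. (Z2 x y)\<^sup>2)
    + box_sum M (\<lambda>x y. (Z3 x y)\<^sup>2) + box_sum M (\<lambda>x y. (Z4 x y)\<^sup>2)) + 1 / 16 * g 0 0"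
proof -
  have am: "\<bar>box_sum M (\<lambda>x y. a x y * b x y)\<bar> \<le> 64 * box_sum M (\<lambda>x y. (a x y)\<^sup>2) + 1 / 256 * box_sum M (\<lambda>x y. (b x y)\<^sup>2)" for a b
    using box_sum_am_gm[of 128 M a b] by simp
  have ar: "\<bar>w1 + w2 + w3 + w4\<bar> \<le> 64 * (z1 + z2 + z3 + z4) + 1 / 16 * (g0::real)"
    if "\<bar>w1\<bar> \<le> 64 * z1 + 1 / 256 * p" "\<bar>w2\<bar> \<le> 64 * z2 + 1 / 256 * q" "\<bar>w3\<bar> \<le> 64 * z3 + 1 / 256 * s" "\<bar>w4\<bar> \<le> 64 * z4 + 1 / 256 * t"
      "p \<le> t" "s \<le> q" "t + q \<le> 8 * g0" for w1 w2 w3 w4 z1 z2 z3 z4 p q s t g0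
    using that unfolding distrib_left by linarith
  show ?thesis
    unfolding W_def
    by (rule ar[OF am am am am box_sum_cd_le_fd[OF g_supp MT] energy(2)[unfolded D_def]])
qed

lemma mass_K_bound: "\<bar>mass K\<bar> \<le> 1 + 1 / 16 * g 0 0"
proof -
  let ?c = "8 * (4::real) ^ K"
  have "\<bar>mass K\<bar> \<le> ?c / 2 * box_sum M (\<lambda>x y. (unif (K + 1) x * unif (K + 1) y)\<^sup>2) + 1 / (2 * ?c) * box_sum M (\<lambda>x y. (g x y)\<^sup>2)"
    unfolding mass_def by (rule box_sum_am_gm) simp
  also have "\<dots> \<le> ?c / 2 * (1 / 4 ^ (K + 1)) + 1 / (2 * ?c) * box_sum M (\<lambda>x y. (g x y)\<^sup>2)"
    by (intro add_right_mono mult_left_mono box_sum_unif_sq MK) auto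
  also have "\<dots> = 1 + 1 / 16 * ((1 - r) * box_sum M (\<lambda>x y. (g x y)\<^sup>2))"
    unfolding r_bounds by simp
  finally show ?thesis using energy(1) by linarith
qed

lemma mass_64_bound: "\<bar>g 0 0 - mass 64\<bar> \<le> 2 ^ 71 + 1 / 16 * g 0 0"
proof -
  have "(2::int) ^ 65 \<le> 2 ^ (K + 1)" using K64 by (intro power_increasing) auto
  then have M65: "2 ^ 65 \<le> M" using MK by linarith
  have "\<bar>g 0 0 - g x y\<bar> \<le> 2 ^ 71 + 1 / 16 * g 0 0" if xy: "0 \<le> x" "x < 2 ^ 65" "0 \<le> y" "y < 2 ^ 65" for x y
  proof -
    have "\<bar>g 0 0 - g x y\<bar> \<le> 64 / 2 * real_of_int (x + y) + 1 / (2 * 64) * D"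
      unfolding D_def by (rule path_difference) (use xy M65 in auto)
    moreover have "real_of_int (x + y) \<le> 2 ^ 66"
    proof -
      have "x + y \<le> 2 ^ 66" using xy by simp
      then have "real_of_int (x + y) \<le> real_of_int (2 ^ 66)" by (simp only: of_int_le_iff)
      then show ?thesis by simp
    qed
    ultimately show ?thesis using energy(2) by simp
  qed
  then show ?thesis
    unfolding mass_def using box_sum_unif_difference[of "64 + 1" M "g 0 0" g "2 ^ 71 + 1 / 16 * g 0 0"] M65 by simp
qed

lemma green_bound:
  "g 0 0 \<le> 2 * (2 ^ 71 + 1 + 64 * (box_sum M (\<lambda>x y. (Z1 x y)\<^sup>2) + box_sum M (\<lambda>x y. (Z2 x y)\<^sup>2)
      + box_sum M (\<lambda>x y. (Z3 x y)\<^sup>2) + box_sum M (\<lambda>x y. (Z4 x y)\<^sup>2))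
    + 32 * (box_sum M (\<lambda>x y. (fdx f x y)\<^sup>2) + box_sum M (\<lambda>x y. (fdy f x y)\<^sup>2))
    + 64 * (1 - r) * box_sum M (\<lambda>x y. (f x y)\<^sup>2) + 2 * r ^ T * (box_sum M (\<lambda>x y. (f x y)\<^sup>2) + 1) + 4 * \<bar>f 0 0\<bar>)"
proof -
  have ar: "g0 \<le> 2 * (c + 1 + w + a + a' + a'' + f0)"
    if "\<bar>g0 - m\<bar> \<le> c + 1 / 16 * g0" "\<bar>m'\<bar> \<le> 1 + 1 / 16 * g0" "m - m' = W - A" "\<bar>W\<bar> \<le> w + 1 / 16 * g0"
      "\<bar>A\<bar> \<le> a' + a + f0 + a'' + 1 / 8 * g0" "0 \<le> g0" for g0 c w a a' a'' f0 m m' W A :: real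
    using that unfolding distrib_left by linarith
  show ?thesis
    by (rule ar[OF mass_64_bound mass_K_bound mass_telescope W_bound A_bound g_nonneg])
qed

end

section \<open>The annealed bound\<close>

lemma abs_le_weighted: "0 < d \<Longrightarrow> \<bar>a\<bar> \<le> d + a\<^sup>2 / d" for a d :: real
proof -
  assume d: "0 < d"
  have "0 \<le> a\<^sup>2 / d" using d by simp
  moreover have "\<bar>a\<bar> \<le> (a\<^sup>2 / d + d) / 2" using weighted_am_gm[of "1 / d" a 1] d by simp
  ultimately show ?thesis using d by simp
qed

lemma avg_green_bound: "\<exists>C::real. 0 \<le> C \<and> (\<forall>\<Lambda> K T. finite \<Lambda> \<longrightarrow> {- (8 * 2 ^ K)..8 * 2 ^ K} \<subseteq> \<Lambda> \<longrightarrow> 64 \<le> K \<longrightarrow>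
    avg2 \<Lambda> (\<lambda>\<epsilon> \<eta>. grn (1 - 1 / 4 ^ K) T \<epsilon> \<eta> 0 0) \<le> C * (1 + (1 - 1 / 4 ^ K) ^ T * 2 ^ K))"
proof -
  obtain Cl :: real where Cl: "\<And>K. (\<Sum>k\<in>{64..<K}. 1 / 8 ^ lev k) \<le> Cl" using sum_lev_bounded by blast
  have Cl0: "0 \<le> Cl" using Cl[of 0] by simp
  define B where "B = 867 * (8000 * Cl)"
  have B0: "0 \<le> B" using Cl0 by (simp add: B_def)
  define C0 where "C0 = 2 * (2 ^ 71 + 1 + 64 * (4 * B) + 32 * (2 * B) + 64 * (867 * 192) + 2 * (867 * 192 + 1) + 4 * 580)"
  have "avg2 \<Lambda> (\<lambda>\<epsilon> \<eta>. grn (1 - 1 / 4 ^ K) T \<epsilon> \<eta> 0 0) \<le> C0 * (1 + (1 - 1 / 4 ^ K) ^ T * 2 ^ K)"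
    if fin: "finite \<Lambda>" and \<Lambda>K: "{- (8 * 2 ^ K)..8 * 2 ^ K} \<subseteq> \<Lambda>" and K64: "64 \<le> K" for \<Lambda> K T
  proof -
    define M :: int where "M = 2 ^ (K + 1) + int T + 2"
    have q: "quenched \<Lambda> K T M \<epsilon> \<eta>" if "\<epsilon> \<in> coins \<Lambda>" "\<eta> \<in> coins \<Lambda>" for \<epsilon> \<eta>
      by unfold_locales (use fin \<Lambda>K K64 that in \<open>auto simp: M_def intro!: add_pos_pos\<close>)
    note lvl = level_below[OF fin \<Lambda>K]
    let ?I = "{64..<K}" and ?r = "1 - 1 / (4::real) ^ K"
    have r: "0 \<le> ?r" by simp
    define f where "f \<epsilon> \<eta> x y = (\<Sum>k\<in>?I. tr \<Lambda> k \<epsilon> \<eta> x y)" for \<epsilon> \<eta> x y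
    let ?E = "\<lambda>\<phi>. avg2 \<Lambda> (\<lambda>\<epsilon> \<eta>. box_sum M (\<lambda>x y. (\<Sum>k\<in>?I. \<phi> k \<epsilon> \<eta> x y)\<^sup>2))"
    have I: "?I \<subseteq> {..<K}" by auto
    have flux: "?E \<phi> \<le> B" if "\<And>k x y. k \<in> ?I \<Longrightarrow> avg2 \<Lambda> (\<lambda>\<epsilon> \<eta>. (\<phi> k \<epsilon> \<eta> x y)\<^sup>2) \<le> 8000 * (1 / 8 ^ lev k) / 4 ^ k"
        "\<And>k \<epsilon> \<eta>. k \<in> ?I \<Longrightarrow> supported (8 * 2 ^ k) (\<phi> k \<epsilon> \<eta>)" for \<phi>
    proof -
      have "?E \<phi> \<le> 867 * (\<Sum>k\<in>?I. 8000 * (1 / 8 ^ lev k))"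
        by (rule multilevel_sum_le[OF I that]) auto
      also have "\<dots> = 867 * (8000 * (\<Sum>k\<in>?I. 1 / 8 ^ lev k))" by (simp only: sum_distrib_left)
      also have "\<dots> \<le> B" unfolding B_def by (intro mult_left_mono Cl) auto
      finally show ?thesis .
    qed
    have Z: "?E (Y1 \<Lambda>) \<le> B" "?E (Y2 \<Lambda>) \<le> B" "?E (Y3 \<Lambda>) \<le> B" "?E (Y4 \<Lambda>) \<le> B"
      by (rule flux, erule level.moments(1)[OF lvl], erule level.supported_Y(1)[OF lvl])
        (rule flux, erule level.moments(2)[OF lvl], erule level.supported_Y(2)[OF lvl],
         rule flux, erule level.moments(3)[OF lvl], erule level.supported_Y(3)[OF lvl],
         rule flux, erule level.moments(4)[OF lvl], erule level.supported_Y(4)[OF lvl])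
    have G: "?E (\<lambda>k \<epsilon> \<eta>. fdx (tr \<Lambda> k \<epsilon> \<eta>)) \<le> B" "?E (\<lambda>k \<epsilon> \<eta>. fdy (tr \<Lambda> k \<epsilon> \<eta>)) \<le> B"
      by (rule flux, erule level.tr_diff_moments(1)[OF lvl], erule level.supported_tr_diffs(1)[OF lvl])
        (rule flux, erule level.tr_diff_moments(2)[OF lvl], erule level.supported_tr_diffs(2)[OF lvl])
    have S: "?E (tr \<Lambda>) \<le> 867 * 192 * 2 ^ K"
    proof -
      have "?E (tr \<Lambda>) \<le> 867 * (\<Sum>k\<in>?I. 192 * 2 ^ k)"
        by (rule multilevel_sum_le[OF I]) (use level.tr_moment[OF lvl] level.supported_tr_diffs(3)[OF lvl] in auto)
      also have "(\<Sum>k\<in>?I. 192 * (2::real) ^ k) = 192 * (\<Sum>k\<in>?I. 2 ^ k)" by (simp only: sum_distrib_left)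
      also have "867 * (192 * (\<Sum>k\<in>?I. (2::real) ^ k)) \<le> 867 * (192 * 2 ^ K)"
      proof (intro mult_left_mono)
        have "(\<Sum>k\<in>?I. (2::real) ^ k) \<le> (\<Sum>k<K. 2 ^ k)" by (rule sum_mono2) auto
        also have "\<dots> = 2 ^ K - 1" by (induction K) auto
        finally show "(\<Sum>k\<in>?I. (2::real) ^ k) \<le> 2 ^ K" by simp
      qed auto
      finally show ?thesis by simp
    qed
    have F0: "avg2 \<Lambda> (\<lambda>\<epsilon> \<eta>. \<bar>f \<epsilon> \<eta> 0 0\<bar>) \<le> 580"
    proof -
      have "avg2 \<Lambda> (\<lambda>\<epsilon> \<eta>. \<bar>f \<epsilon> \<eta> 0 0\<bar>) \<le> avg2 \<Lambda> (\<lambda>\<epsilon> \<eta>. \<Sum>k\<in>?I. (3/4) ^ k + (1 / (3/4) ^ k) * (tr \<Lambda> k \<epsilon> \<eta> 0 0)\<^sup>2)"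
      proof (rule avg2_mono)
        fix \<epsilon> \<eta> :: "int \<Rightarrow> real"
        have "\<bar>tr \<Lambda> k \<epsilon> \<eta> 0 0\<bar> \<le> (3/4) ^ k + (1 / (3/4) ^ k) * (tr \<Lambda> k \<epsilon> \<eta> 0 0)\<^sup>2" for k
          using abs_le_weighted[of "(3/4) ^ k" "tr \<Lambda> k \<epsilon> \<eta> 0 0"] by simp
        then show "\<bar>f \<epsilon> \<eta> 0 0\<bar> \<le> (\<Sum>k\<in>?I. (3/4) ^ k + (1 / (3/4) ^ k) * (tr \<Lambda> k \<epsilon> \<eta> 0 0)\<^sup>2)"
          unfolding f_def by (intro order_trans[OF sum_abs] sum_mono)
      qed
      also have "\<dots> = (\<Sum>k\<in>?I. (3/4) ^ k + (1 / (3/4) ^ k) * avg2 \<Lambda> (\<lambda>\<epsilon> \<eta>. (tr \<Lambda> k \<epsilon> \<eta> 0 0)\<^sup>2))"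
        unfolding avg2_sum avg2_add avg2_cmult avg2_const[OF fin] ..
      also have "\<dots> \<le> (\<Sum>k\<in>?I. (3/4) ^ k + 192 * (2/3) ^ k)"
      proof (intro sum_mono add_left_mono)
        fix k assume k: "k \<in> ?I"
        have "(1 / (3/4) ^ k) * avg2 \<Lambda> (\<lambda>\<epsilon> \<eta>. (tr \<Lambda> k \<epsilon> \<eta> 0 0)\<^sup>2) \<le> (1 / (3/4) ^ k) * (192 * 2 ^ k / 4 ^ k)"
          by (intro mult_left_mono level.tr_moment[OF lvl[OF k]]) auto
        also have "\<dots> = 192 * (2/3) ^ k" by (simp add: power_divide)
        finally show "(1 / (3/4) ^ k) * avg2 \<Lambda> (\<lambda>\<epsilon> \<eta>. (tr \<Lambda> k \<epsilon> \<eta> 0 0)\<^sup>2) \<le> 192 * (2/3) ^ k" .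
      qed
      also have "\<dots> \<le> (\<Sum>k<K. (3/4) ^ k + 192 * (2/3) ^ k)" by (rule sum_mono2) auto
      also have "\<dots> = 580 - 4 * (3/4) ^ K - 576 * (2/3) ^ K" by (induction K) auto
      also have "\<dots> \<le> 580"
      proof -
        have "0 \<le> (3/4 :: real) ^ K" "0 \<le> (2/3 :: real) ^ K" by (intro zero_le_power; simp)+
        then show ?thesis by linarith
      qed
      finally show ?thesis .
    qed
    have bound: "grn ?r T \<epsilon> \<eta> 0 0 \<le> 2 * (2 ^ 71 + 1
       + 64 * (box_sum M (\<lambda>x y. (\<Sum>k\<in>?I. Y1 \<Lambda> k \<epsilon> \<eta> x y)\<^sup>2) + box_sum M (\<lambda>x y. (\<Sum>k\<in>?I. Y2 \<Lambda> k \<epsilon> \<eta> x y)\<^sup>2)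
          + box_sum M (\<lambda>x y. (\<Sum>k\<in>?I. Y3 \<Lambda> k \<epsilon> \<eta> x y)\<^sup>2) + box_sum M (\<lambda>x y. (\<Sum>k\<in>?I. Y4 \<Lambda> k \<epsilon> \<eta> x y)\<^sup>2))
       + 32 * (box_sum M (\<lambda>x y. (\<Sum>k\<in>?I. fdx (tr \<Lambda> k \<epsilon> \<eta>) x y)\<^sup>2) + box_sum M (\<lambda>x y. (\<Sum>k\<in>?I. fdy (tr \<Lambda> k \<epsilon> \<eta>) x y)\<^sup>2))
       + 64 * (1 - ?r) * box_sum M (\<lambda>x y. (\<Sum>k\<in>?I. tr \<Lambda> k \<epsilon> \<eta> x y)\<^sup>2)
       + 2 * ?r ^ T * (box_sum M (\<lambda>x y. (\<Sum>k\<in>?I. tr \<Lambda> k \<epsilon> \<eta> x y)\<^sup>2) + 1) + 4 * \<bar>f \<epsilon> \<eta> 0 0\<bar>)"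
      if c: "\<epsilon> \<in> coins \<Lambda>" "\<eta> \<in> coins \<Lambda>" for \<epsilon> \<eta>
    proof -
      note Q = q[OF c]
      have fd: "fdx (quenched.f \<Lambda> K \<epsilon> \<eta>) x y = (\<Sum>k\<in>?I. fdx (tr \<Lambda> k \<epsilon> \<eta>) x y)"
         "fdy (quenched.f \<Lambda> K \<epsilon> \<eta>) x y = (\<Sum>k\<in>?I. fdy (tr \<Lambda> k \<epsilon> \<eta>) x y)" for x y
        unfolding fdx_def fdy_def quenched.f_def[OF Q] by (simp_all add: sum_subtractf)
      show ?thesis
        using quenched.green_bound[OF Q]
        unfolding fd quenched.g_def[OF Q] quenched.r_def[OF Q] quenched.f_def[OF Q] quenched.Z1_def[OF Q] quenched.Z2_def[OF Q]
          quenched.Z3_def[OF Q] quenched.Z4_def[OF Q] f_def .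
    qed
    have "avg2 \<Lambda> (\<lambda>\<epsilon> \<eta>. grn ?r T \<epsilon> \<eta> 0 0) \<le> 2 * (2 ^ 71 + 1
       + 64 * (?E (Y1 \<Lambda>) + ?E (Y2 \<Lambda>) + ?E (Y3 \<Lambda>) + ?E (Y4 \<Lambda>))
       + 32 * (?E (\<lambda>k \<epsilon> \<eta>. fdx (tr \<Lambda> k \<epsilon> \<eta>)) + ?E (\<lambda>k \<epsilon> \<eta>. fdy (tr \<Lambda> k \<epsilon> \<eta>)))
       + 64 * (1 - ?r) * ?E (tr \<Lambda>) + 2 * ?r ^ T * (?E (tr \<Lambda>) + 1) + 4 * avg2 \<Lambda> (\<lambda>\<epsilon> \<eta>. \<bar>f \<epsilon> \<eta> 0 0\<bar>))"
      by (rule order_trans[OF avg2_mono[OF bound]]) (simp_all only: avg2_cmult avg2_add avg2_const[OF fin] order_refl)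
    also have "\<dots> \<le> 2 * (2 ^ 71 + 1 + 64 * (B + B + B + B) + 32 * (B + B)
       + 64 * (1 - ?r) * (867 * 192 * 2 ^ K) + 2 * ?r ^ T * (867 * 192 * 2 ^ K + 1) + 4 * 580)"
      using r by (intro mult_left_mono add_mono Z G S F0 order_refl mult_nonneg_nonneg zero_le_power) auto
    also have "\<dots> \<le> C0 * (1 + ?r ^ T * 2 ^ K)"
    proof -
      have bnd: "2 * (a + 64 * d * (c * p) + 2 * s * (c * p + 1) + e) \<le> 2 * (a + 64 * c + 2 * (c + 1) + e) * (1 + s * p)"
        if "1 \<le> p" "d * p \<le> 1" "0 \<le> s" "0 \<le> c" "0 \<le> e" "0 \<le> a" for a c d e p s :: real
      proof -
        have "s * 1 \<le> s * p" "c * (d * p) \<le> c * 1" using that by (intro mult_left_mono; simp)+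
        then have "0 \<le> 128 * (c - c * (d * p)) + 4 * c + 4 + 2 * (a * (s * p)) + 128 * (c * (s * p)) + 2 * (e * (s * p)) + 4 * (s * p - s)"
          using that by (intro add_nonneg_nonneg mult_nonneg_nonneg) auto
        also have "\<dots> = 2 * (a + 64 * c + 2 * (c + 1) + e) * (1 + s * p) - 2 * (a + 64 * d * (c * p) + 2 * s * (c * p + 1) + e)"
          by algebra
        finally show ?thesis by (rule diff_ge_0_iff_ge[THEN iffD1])
      qed
      have p: "1 \<le> (2::real) ^ K" "(1 - ?r) * 2 ^ K \<le> 1" by (simp_all add: power_mono divide_le_eq)
      have C0: "C0 = 2 * (2 ^ 71 + 1 + 64 * (B + B + B + B) + 32 * (B + B) + 64 * (867 * 192) + 2 * (867 * 192 + 1) + 4 * 580)"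
        by (simp add: C0_def)
      show ?thesis unfolding C0
        by (rule bnd[OF p]) (use B0 in \<open>auto intro!: add_nonneg_nonneg zero_le_power\<close>)
    qed
    finally show ?thesis .
  qed
  moreover have "0 \<le> C0" using B0 unfolding C0_def by (intro mult_nonneg_nonneg add_nonneg_nonneg) auto
  ultimately show ?thesis by blast
qed

lemma ret_coins_nonneg: "\<epsilon> \<in> coins \<Lambda> \<Longrightarrow> \<eta> \<in> coins \<Lambda> \<Longrightarrow> 0 \<le> ret \<epsilon> \<eta> m x y"
  by (intro ret_nonneg abs_coin_le_1)

lemma avg2_ret_nonneg: "0 \<le> avg2 \<Lambda> (\<lambda>\<epsilon> \<eta>. ret \<epsilon> \<eta> m 0 0)"
  unfolding avg2_def by (intro avg_nonneg ret_coins_nonneg)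

lemma return_sum_bound:
  "\<exists>C::real. 0 \<le> C \<and> (\<forall>N. \<exists>L\<ge>int N. (\<Sum>m<N. avg2 {-L..L} (\<lambda>\<epsilon> \<eta>. ret \<epsilon> \<eta> m 0 0)) \<le> C)"
proof -
  obtain C :: real where C0: "0 \<le> C" and C: "\<And>\<Lambda> K T. finite \<Lambda> \<Longrightarrow> {- (8 * 2 ^ K)..8 * 2 ^ K} \<subseteq> \<Lambda> \<Longrightarrow> 64 \<le> K \<Longrightarrow>
    avg2 \<Lambda> (\<lambda>\<epsilon> \<eta>. grn (1 - 1 / 4 ^ K) T \<epsilon> \<eta> 0 0) \<le> C * (1 + (1 - 1 / 4 ^ K) ^ T * 2 ^ K)"
    using avg_green_bound by blast
  have "\<exists>L\<ge>int N. (\<Sum>m<N. avg2 {-L..L} (\<lambda>\<epsilon> \<eta>. ret \<epsilon> \<eta> m 0 0)) \<le> 4 * C" for N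
  proof -
    define K where "K = 64 + N"
    define r where "r = 1 - 1 / (4::real) ^ K"
    have r: "0 \<le> r" "r < 1" by (simp_all add: r_def)
    obtain t where t: "r ^ t < 1 / 2 ^ K" using real_arch_pow_inv[of "1 / 2 ^ K" r] r by auto
    define T where "T = t + N"
    have "r ^ T \<le> r ^ t" using r by (intro power_decreasing) (auto simp: T_def)
    then have "r ^ T * 2 ^ K \<le> 1 / 2 ^ K * 2 ^ K" using t by (intro mult_right_mono) auto
    then have rT: "r ^ T * 2 ^ K \<le> 1" by simp
    define L :: int where "L = 8 * 2 ^ K + int N"
    let ?\<Lambda> = "{-L..L}"
    have LN: "int N \<le> L" by (simp add: L_def)
    have "avg2 ?\<Lambda> (\<lambda>\<epsilon> \<eta>. grn r T \<epsilon> \<eta> 0 0) \<le> C * (1 + r ^ T * 2 ^ K)"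
      unfolding r_def by (rule C) (auto simp: K_def L_def)
    also have "\<dots> \<le> C * 2" using rT C0 by (intro mult_left_mono) auto
    finally have g: "avg2 ?\<Lambda> (\<lambda>\<epsilon> \<eta>. grn r T \<epsilon> \<eta> 0 0) \<le> 2 * C" by simp
    have half: "1/2 \<le> r ^ m" if "m < N" for m
    proof -
      have "N < 4 ^ N" by (induction N) auto
      then have "real N < real (4 ^ N)" by (simp only: of_nat_less_iff)
      then have "real N < 4 ^ N" by simp
      also have "(4::real) ^ N \<le> 4 ^ K / 2"
      proof -
        have "(4::real) ^ N * 4 ^ 1 \<le> 4 ^ N * 4 ^ 64" by (intro mult_left_mono power_increasing) auto
        then show ?thesis by (simp add: K_def power_add)
      qed
      finally have "real N * (1 / 4 ^ K) \<le> 1/2" by (simp add: field_simps)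
      moreover have "1 - real m * (1 / 4 ^ K) \<le> (1 - 1 / 4 ^ K) ^ m"
        using Bernoulli_inequality[of "- (1 / 4 ^ K)" m] by simp
      moreover have "real m * (1 / 4 ^ K) \<le> real N * (1 / 4 ^ K)" using that by (intro mult_right_mono) auto
      ultimately show ?thesis unfolding r_def by linarith
    qed
    have "(\<Sum>m<N. avg2 ?\<Lambda> (\<lambda>\<epsilon> \<eta>. ret \<epsilon> \<eta> m 0 0)) \<le> (\<Sum>m<N. 2 * (r ^ m * avg2 ?\<Lambda> (\<lambda>\<epsilon> \<eta>. ret \<epsilon> \<eta> m 0 0)))"
    proof (rule sum_mono)
      fix m assume "m \<in> {..<N}"
      then have "1/2 * avg2 ?\<Lambda> (\<lambda>\<epsilon> \<eta>. ret \<epsilon> \<eta> m 0 0) \<le> r ^ m * avg2 ?\<Lambda> (\<lambda>\<epsilon> \<eta>. ret \<epsilon> \<eta> m 0 0)"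
        by (intro mult_right_mono half avg2_ret_nonneg) auto
      then show "avg2 ?\<Lambda> (\<lambda>\<epsilon> \<eta>. ret \<epsilon> \<eta> m 0 0) \<le> 2 * (r ^ m * avg2 ?\<Lambda> (\<lambda>\<epsilon> \<eta>. ret \<epsilon> \<eta> m 0 0))" by linarith
    qed
    also have "\<dots> \<le> (\<Sum>m<T. 2 * (r ^ m * avg2 ?\<Lambda> (\<lambda>\<epsilon> \<eta>. ret \<epsilon> \<eta> m 0 0)))"
      by (rule sum_mono2) (use r avg2_ret_nonneg in \<open>auto simp: T_def\<close>)
    also have "\<dots> = 2 * avg2 ?\<Lambda> (\<lambda>\<epsilon> \<eta>. grn r T \<epsilon> \<eta> 0 0)"
      unfolding grn_def avg2_sum avg2_cmult sum_distrib_left ..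
    also have "\<dots> \<le> 4 * C" using g by simp
    finally show ?thesis using LN by blast
  qed
  then show ?thesis using C0 by (intro exI[of _ "4 * C"]) auto
qed

lemma ret_local:
  assumes "\<And>t. \<bar>t\<bar> \<le> L \<Longrightarrow> \<epsilon> t = \<epsilon>' t" "\<And>t. \<bar>t\<bar> \<le> L \<Longrightarrow> \<eta> t = \<eta>' t" "int m \<le> L"
  shows "ret \<epsilon> \<eta> m = ret \<epsilon>' \<eta>' m"
  using assms(3)
proof (induction m)
  case (Suc m)
  then have IH: "ret \<epsilon> \<eta> m = ret \<epsilon>' \<eta>' m" by simp
  have s: "ret \<epsilon>' \<eta>' m x y = 0" if "int m < \<bar>x\<bar> \<or> int m < \<bar>y\<bar>" for x y
    using supported_ret[of m \<epsilon>' \<eta>'] that unfolding supported_def by blast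
  show ?case
  proof (intro ext)
    fix x y
    have e1: "\<epsilon> y * cdx (ret \<epsilon>' \<eta>' m) x y = \<epsilon>' y * cdx (ret \<epsilon>' \<eta>' m) x y"
    proof (cases "\<bar>y\<bar> \<le> int m")
      case True then show ?thesis using assms(1)[of y] Suc.prems by simp
    next
      case False then show ?thesis by (simp add: cdx_def s)
    qed
    have e2: "\<eta> x * cdy (ret \<epsilon>' \<eta>' m) x y = \<eta>' x * cdy (ret \<epsilon>' \<eta>' m) x y"
    proof (cases "\<bar>x\<bar> \<le> int m")
      case True then show ?thesis using assms(2)[of x] Suc.prems by simp
    next
      case False then show ?thesis by (simp add: cdy_def s)
    qed
    show "ret \<epsilon> \<eta> (Suc m) x y = ret \<epsilon>' \<eta>' (Suc m) x y"
      unfolding ret.simps IH step_op_def e1 e2 ..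
  qed
qed simp

section \<open>From finitely many coins to the law of the environment\<close>

definition hor_coins :: "int \<Rightarrow> (line \<Rightarrow> int) \<Rightarrow> int \<Rightarrow> real" where
  "hor_coins b c t = real_of_int (c (Hor, b + t))"
definition ver_coins :: "int \<Rightarrow> (line \<Rightarrow> int) \<Rightarrow> int \<Rightarrow> real" where
  "ver_coins a c t = real_of_int (c (Ver, a + t))"

lemma coin_cylinder:
  assumes S: "finite S" and \<sigma>: "\<And>l. l \<in> S \<Longrightarrow> \<sigma> l \<in> {-1, 1}"
  shows "{c \<in> space coin_law. \<forall>l\<in>S. c l = \<sigma> l} \<in> sets coin_law"
    and "emeasure coin_law {c \<in> space coin_law. \<forall>l\<in>S. c l = \<sigma> l} = ennreal ((1/2) ^ card S)"
proof -
  interpret product_prob_space "\<lambda>_::line. uniform_count_measure {-1, 1 :: int}" UNIV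
    by (rule product_prob_spaceI, rule prob_space_uniform_count_measure) simp_all
  have "{c \<in> space coin_law. c l = \<sigma> l} \<in> sets coin_law" if "l \<in> S" for l
  proof -
    have "(\<lambda>c. c l) -` {\<sigma> l} \<inter> space coin_law \<in> sets coin_law"
      by (rule measurable_sets[OF coin_component_measurable]) (use \<sigma>[OF that] in auto)
    moreover have "(\<lambda>c. c l) -` {\<sigma> l} \<inter> space coin_law = {c \<in> space coin_law. c l = \<sigma> l}" by auto
    ultimately show ?thesis by simp
  qed
  then show "{c \<in> space coin_law. \<forall>l\<in>S. c l = \<sigma> l} \<in> sets coin_law"
    by (rule sets.sets_Collect_finite_All[OF _ S])
  have "emeasure coin_law {c \<in> space coin_law. \<forall>l\<in>S. c l \<in> {\<sigma> l}}
      = (\<Prod>l\<in>S. emeasure (uniform_count_measure {-1, 1 :: int}) {\<sigma> l})"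
    unfolding coin_law_def
    by (rule emeasure_PiM_Collect[OF _ S]) (use \<sigma> in \<open>auto simp: sets_uniform_count_measure\<close>)
  also have "\<dots> = (\<Prod>l\<in>S. ennreal (1/2))"
  proof (rule prod.cong[OF refl])
    fix l assume "l \<in> S"
    then have "{\<sigma> l} \<subseteq> {-1, 1}" using \<sigma> by auto
    then show "emeasure (uniform_count_measure {-1, 1 :: int}) {\<sigma> l} = ennreal (1/2)"
      by (subst emeasure_uniform_count_measure) auto
  qed
  also have "\<dots> = ennreal ((1/2) ^ card S)" unfolding prod_constant by (rule ennreal_power) simp
  finally show "emeasure coin_law {c \<in> space coin_law. \<forall>l\<in>S. c l = \<sigma> l} = ennreal ((1/2) ^ card S)" by simp
qed

lemma coin_values: "c \<in> space coin_law \<Longrightarrow> c l = 1 \<or> c l = -1"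
proof -
  assume "c \<in> space coin_law"
  then have "c l \<in> {-1, 1}" unfolding space_coin_law by blast
  then show ?thesis by auto
qed

lemma nn_integral_coins:
  assumes fin: "finite \<Lambda>" and Q: "\<And>\<epsilon> \<eta>. \<epsilon> \<in> coins \<Lambda> \<Longrightarrow> \<eta> \<in> coins \<Lambda> \<Longrightarrow> 0 \<le> Q \<epsilon> \<eta>"
  shows "(\<integral>\<^sup>+c. ennreal (Q (cut \<Lambda> (hor_coins b c)) (cut \<Lambda> (ver_coins a c))) \<partial>coin_law) = ennreal (avg2 \<Lambda> Q)"
proof -
  let ?C = "coins \<Lambda>"
  define S :: "line set" where "S = (\<lambda>t. (Hor, b + t)) ` \<Lambda> \<union> (\<lambda>t. (Ver, a + t)) ` \<Lambda>"
  define \<sigma> :: "(int \<Rightarrow> real) \<Rightarrow> (int \<Rightarrow> real) \<Rightarrow> line \<Rightarrow> int" where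
    "\<sigma> e h l = (case l of (Hor, t) \<Rightarrow> if e (t - b) = 1 then 1 else -1 | (Ver, t) \<Rightarrow> if h (t - a) = 1 then 1 else -1)" for e h l
  define A where "A e h = {c \<in> space coin_law. \<forall>l\<in>S. c l = \<sigma> e h l}" for e h
  have S: "finite S" "card S = card \<Lambda> + card \<Lambda>"
  proof -
    show "finite S" using fin by (simp add: S_def)
    have "card S = card ((\<lambda>t. (Hor, b + t)) ` \<Lambda>) + card ((\<lambda>t. (Ver, a + t)) ` \<Lambda>)"
      unfolding S_def by (rule card_Un_disjoint) (use fin in auto)
    also have "\<dots> = card \<Lambda> + card \<Lambda>" by (intro arg_cong2[where f="(+)"] card_image) (auto simp: inj_on_def)
    finally show "card S = card \<Lambda> + card \<Lambda>" .
  qed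
  have \<sigma>: "\<sigma> e h l \<in> {-1, 1}" for e h l by (auto simp: \<sigma>_def split: direction.split prod.split)
  have A: "A e h \<in> sets coin_law" "emeasure coin_law (A e h) = ennreal ((1/2) ^ (card \<Lambda> + card \<Lambda>))" for e h
    unfolding A_def using coin_cylinder[OF S(1) \<sigma>] S(2) by simp_all
  have mem: "c \<in> A e h \<longleftrightarrow> e = cut \<Lambda> (hor_coins b c) \<and> h = cut \<Lambda> (ver_coins a c)"
    if c: "c \<in> space coin_law" and eh: "e \<in> ?C" "h \<in> ?C" for c e h
  proof -
    note c1 = coin_values[OF c]
    have one: "c l = (if x = 1 then 1 else -1) \<longleftrightarrow> x = real_of_int (c l)" if "x = 1 \<or> x = -1" for l and x :: real
      using c1[of l] that by auto
    have "c \<in> A e h \<longleftrightarrow> (\<forall>t\<in>\<Lambda>. c (Hor, b + t) = (if e t = 1 then 1 else -1)) \<and> (\<forall>t\<in>\<Lambda>. c (Ver, a + t) = (if h t = 1 then 1 else -1))"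
      using c unfolding A_def S_def \<sigma>_def by auto
    also have "\<dots> \<longleftrightarrow> (\<forall>t\<in>\<Lambda>. e t = hor_coins b c t) \<and> (\<forall>t\<in>\<Lambda>. h t = ver_coins a c t)"
      using eh one unfolding hor_coins_def ver_coins_def coins_def by auto
    also have "\<dots> \<longleftrightarrow> e = cut \<Lambda> (hor_coins b c) \<and> h = cut \<Lambda> (ver_coins a c)"
      using eh unfolding coins_def cut_def fun_eq_iff by auto
    finally show ?thesis .
  qed
  have cutC: "cut \<Lambda> (hor_coins b c) \<in> ?C" "cut \<Lambda> (ver_coins a c) \<in> ?C" if "c \<in> space coin_law" for c
  proof -
    note c1 = coin_values[OF that]
    have "real_of_int (c l) = 1 \<or> real_of_int (c l) = -1" for l using c1[of l] by auto
    then show "cut \<Lambda> (hor_coins b c) \<in> ?C" "cut \<Lambda> (ver_coins a c) \<in> ?C" 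
      unfolding coins_def cut_def hor_coins_def ver_coins_def by auto
  qed
  have finC: "finite (?C \<times> ?C)" using finite_coins[OF fin] by simp
  have "(\<integral>\<^sup>+c. ennreal (Q (cut \<Lambda> (hor_coins b c)) (cut \<Lambda> (ver_coins a c))) \<partial>coin_law)
     = (\<integral>\<^sup>+c. (\<Sum>q\<in>?C \<times> ?C. ennreal (Q (fst q) (snd q)) * indicator (A (fst q) (snd q)) c) \<partial>coin_law)"
  proof (rule nn_integral_cong)
    fix c assume c: "c \<in> space coin_law"
    let ?q = "(cut \<Lambda> (hor_coins b c), cut \<Lambda> (ver_coins a c))"
    have "(\<Sum>q\<in>?C \<times> ?C. ennreal (Q (fst q) (snd q)) * indicator (A (fst q) (snd q)) c)
       = (\<Sum>q\<in>?C \<times> ?C. if q = ?q then ennreal (Q (fst ?q) (snd ?q)) else 0)"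
    proof (rule sum.cong[OF refl])
      fix q assume "q \<in> ?C \<times> ?C"
      then have "c \<in> A (fst q) (snd q) \<longleftrightarrow> q = ?q" using mem[OF c, of "fst q" "snd q"] by (auto simp: prod_eq_iff)
      then show "ennreal (Q (fst q) (snd q)) * indicator (A (fst q) (snd q)) c = (if q = ?q then ennreal (Q (fst ?q) (snd ?q)) else 0)"
        by (auto simp: indicator_def)
    qed
    also have "\<dots> = ennreal (Q (fst ?q) (snd ?q))"
      using finC cutC[OF c] by (subst sum.delta) auto
    finally show "ennreal (Q (cut \<Lambda> (hor_coins b c)) (cut \<Lambda> (ver_coins a c)))
      = (\<Sum>q\<in>?C \<times> ?C. ennreal (Q (fst q) (snd q)) * indicator (A (fst q) (snd q)) c)" by simp
  qed
  also have "\<dots> = (\<Sum>q\<in>?C \<times> ?C. ennreal (Q (fst q) (snd q)) * emeasure coin_law (A (fst q) (snd q)))"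
    by (subst nn_integral_sum) (auto intro!: sum.cong nn_integral_cmult_indicator borel_measurable_times_ennreal borel_measurable_indicator simp: A(1))
  also have "\<dots> = (\<Sum>q\<in>?C \<times> ?C. ennreal (Q (fst q) (snd q) * (1/2) ^ (card \<Lambda> + card \<Lambda>)))"
    by (intro sum.cong refl) (use Q A(2) in \<open>auto simp: ennreal_mult\<close>)
  also have "\<dots> = ennreal (\<Sum>q\<in>?C \<times> ?C. Q (fst q) (snd q) * (1/2) ^ (card \<Lambda> + card \<Lambda>))"
    by (rule sum_ennreal) (use Q in auto)
  also have "(\<Sum>q\<in>?C \<times> ?C. Q (fst q) (snd q) * (1/2) ^ (card \<Lambda> + card \<Lambda>)) = avg2 \<Lambda> Q"
  proof -
    have "(\<Sum>q\<in>?C \<times> ?C. Q (fst q) (snd q) * (1/2) ^ (card \<Lambda> + card \<Lambda>))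
       = (\<Sum>e\<in>?C. \<Sum>h\<in>?C. Q e h) * (1/2) ^ (card \<Lambda> + card \<Lambda>)"
      by (simp add: sum.cartesian_product case_prod_unfold sum_distrib_right)
    also have "(\<Sum>e\<in>?C. \<Sum>h\<in>?C. Q e h) = (\<Sum>h\<in>?C. \<Sum>e\<in>?C. Q e h)" by (rule sum.swap)
    also have "\<dots> * (1/2) ^ (card \<Lambda> + card \<Lambda>) = avg2 \<Lambda> Q"
      unfolding avg2_def avg_def sum_divide_distrib[symmetric] card_coins[OF fin] by (simp add: power_add power_divide)
    finally show ?thesis .
  qed
  finally show ?thesis .
qed

lemma walk_Suc_first: "walk \<omega> (Suc n) z = bind_pmf (walk_step \<omega> z) (walk \<omega> n)"
proof (induction n)
  case 0
  show ?case by (simp add: bind_return_pmf bind_return_pmf')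
next
  case (Suc n)
  have "walk \<omega> (Suc (Suc n)) z = bind_pmf (bind_pmf (walk_step \<omega> z) (walk \<omega> n)) (walk_step \<omega>)"
    using Suc by simp
  then show ?case by (simp add: bind_assoc_pmf)
qed

lemma trans_prob_Suc:
  "trans_prob \<omega> (Suc n) z y = (trans_prob \<omega> n (z + smult_site (\<omega> (z, Hor)) (1, 0)) y + trans_prob \<omega> n (z + smult_site (\<omega> (z, Ver)) (0, 1)) y) / 2"
  unfolding trans_prob_def walk_Suc_first walk_step_def bind_map_pmf pmf_bind
  by (subst integral_pmf_of_set) auto

lemma trans_prob_eq_ret:
  assumes c: "\<And>l. c l = 1 \<or> c l = -1"
  shows "trans_prob (env_of_coins c) n (a + u, b + v) (a, b) = ret (hor_coins b c) (ver_coins a c) n u v"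
proof (induction n arbitrary: u v)
  case 0
  then show ?case by (auto simp: trans_prob_def dirac_def pmf_return)
next
  case (Suc n)
  let ?r = "ret (hor_coins b c) (ver_coins a c) n"
  have e: "env_of_coins c ((p, q), Hor) = c (Hor, q)" "env_of_coins c ((p, q), Ver) = c (Ver, p)" for p q
    by (simp_all add: env_of_coins_def)
  have 1: "trans_prob (env_of_coins c) n ((a + u, b + v) + smult_site (env_of_coins c ((a + u, b + v), Hor)) (1, 0)) (a, b)
     = ?r (u + c (Hor, b + v)) v"
    using Suc.IH[of "u + c (Hor, b + v)" v] unfolding e by (simp add: smult_site_def add.assoc)
  have 2: "trans_prob (env_of_coins c) n ((a + u, b + v) + smult_site (env_of_coins c ((a + u, b + v), Ver)) (0, 1)) (a, b)
     = ?r u (v + c (Ver, a + u))"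
    using Suc.IH[of u "v + c (Ver, a + u)"] unfolding e by (simp add: smult_site_def add.assoc)
  show ?case
    unfolding trans_prob_Suc 1 2 ret.simps step_op_convex hor_coins_def ver_coins_def
    using c[of "(Hor, b + v)"] c[of "(Ver, a + u)"] by (elim disjE) (simp_all add: field_simps)
qed

lemma env_component_measurable: "(\<lambda>\<omega>. \<omega> zi) \<in> measurable env_space (count_space {-1, 1})"
  unfolding env_space_def by (rule measurable_restrict_space1) simp

lemma trans_prob_measurable: "(\<lambda>\<omega>. trans_prob \<omega> n z y) \<in> borel_measurable env_space"
proof (induction n arbitrary: z)
  case 0
  show ?case by (simp add: trans_prob_def)
next
  case (Suc n)
  let ?f = "\<lambda>\<omega>. \<Sum>s\<in>{-1, 1 :: int}. (indicator {s} (\<omega> (z, Hor)) * trans_prob \<omega> n (z + smult_site s (1, 0)) y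
      + indicator {s} (\<omega> (z, Ver)) * trans_prob \<omega> n (z + smult_site s (0, 1)) y) / 2"
  have ind: "(\<lambda>\<omega>. indicator {s} (\<omega> zi) :: real) \<in> borel_measurable env_space" for s zi
    by (rule measurable_compose[OF env_component_measurable]) simp
  have "?f \<in> borel_measurable env_space"
    by (intro borel_measurable_sum borel_measurable_divide borel_measurable_add borel_measurable_times ind Suc borel_measurable_const)
  moreover have "trans_prob \<omega> (Suc n) z y = ?f \<omega>" if "\<omega> \<in> space env_space" for \<omega>
  proof -
    have "\<omega> (z, i) \<in> {-1, 1}" for i using that unfolding space_env_space environments_def by blast
    then have "\<omega> (z, Hor) = -1 \<or> \<omega> (z, Hor) = 1" "\<omega> (z, Ver) = -1 \<or> \<omega> (z, Ver) = 1" by auto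
    then show ?thesis unfolding trans_prob_Suc by (elim disjE) (simp_all add: field_simps)
  qed
  ultimately show ?case using measurable_cong[of env_space "\<lambda>\<omega>. trans_prob \<omega> (Suc n) z y" ?f borel] by blast
qed

theorem theorem1p1:
  "AE \<omega> in env_law. \<forall>x::site. summable (\<lambda>n. trans_prob \<omega> n x x)"
proof -
  obtain C :: real where C0: "0 \<le> C" and C: "\<And>N. \<exists>L\<ge>int N. (\<Sum>m<N. avg2 {-L..L} (\<lambda>\<epsilon> \<eta>. ret \<epsilon> \<eta> m 0 0)) \<le> C"
    using return_sum_bound by blast
  have "AE \<omega> in env_law. summable (\<lambda>n. trans_prob \<omega> n x x)" for x :: site
  proof -
    obtain a b where x: "x = (a, b)" by force
    let ?J = "\<lambda>m. \<integral>\<^sup>+\<omega>. ennreal (trans_prob \<omega> m x x) \<partial>env_law"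
    have J: "?J m = ennreal (avg2 {-L..L} (\<lambda>\<epsilon> \<eta>. ret \<epsilon> \<eta> m 0 0))" if "int m \<le> L" for m L
    proof -
      have "?J m = (\<integral>\<^sup>+c. ennreal (trans_prob (env_of_coins c) m x x) \<partial>coin_law)"
        unfolding env_law_def
        by (rule nn_integral_distr[OF env_of_coins_measurable])
          (simp add: measurable_distr_eq1 measurable_compose[OF trans_prob_measurable measurable_ennreal])
      also have "\<dots> = (\<integral>\<^sup>+c. ennreal ((\<lambda>\<epsilon> \<eta>. ret \<epsilon> \<eta> m 0 0) (cut {-L..L} (hor_coins b c)) (cut {-L..L} (ver_coins a c))) \<partial>coin_law)"
      proof (rule nn_integral_cong)
        fix c assume "c \<in> space coin_law"
        then have "c l = 1 \<or> c l = -1" for l by (rule coin_values)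
        then have "trans_prob (env_of_coins c) m x x = ret (hor_coins b c) (ver_coins a c) m 0 0"
          using trans_prob_eq_ret[of c m a 0 b 0] by (simp add: x)
        also have "ret (hor_coins b c) (ver_coins a c) m = ret (cut {-L..L} (hor_coins b c)) (cut {-L..L} (ver_coins a c)) m"
          by (rule ret_local[OF _ _ that]) (auto simp: cut_def abs_le_iff)
        finally show "ennreal (trans_prob (env_of_coins c) m x x)
          = ennreal ((\<lambda>\<epsilon> \<eta>. ret \<epsilon> \<eta> m 0 0) (cut {-L..L} (hor_coins b c)) (cut {-L..L} (ver_coins a c)))" by simp
      qed
      also have "\<dots> = ennreal (avg2 {-L..L} (\<lambda>\<epsilon> \<eta>. ret \<epsilon> \<eta> m 0 0))"
      proof (rule nn_integral_coins)
        fix \<epsilon> \<eta> :: "int \<Rightarrow> real" assume "\<epsilon> \<in> coins {-L..L}" "\<eta> \<in> coins {-L..L}"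
        then show "0 \<le> ret \<epsilon> \<eta> m 0 0" by (rule ret_coins_nonneg)
      qed simp
      finally show ?thesis .
    qed
    have part: "(\<Sum>m<N. ?J m) \<le> ennreal C" for N
    proof -
      obtain L where L: "L \<ge> int N" "(\<Sum>m<N. avg2 {-L..L} (\<lambda>\<epsilon> \<eta>. ret \<epsilon> \<eta> m 0 0)) \<le> C" using C by blast
      have "(\<Sum>m<N. ?J m) = (\<Sum>m<N. ennreal (avg2 {-L..L} (\<lambda>\<epsilon> \<eta>. ret \<epsilon> \<eta> m 0 0)))"
        by (intro sum.cong refl J) (use L in auto)
      also have "\<dots> = ennreal (\<Sum>m<N. avg2 {-L..L} (\<lambda>\<epsilon> \<eta>. ret \<epsilon> \<eta> m 0 0))" by (rule sum_ennreal) (rule avg2_ret_nonneg)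
      also have "\<dots> \<le> ennreal C" using L(2) by (rule ennreal_leI)
      finally show ?thesis .
    qed
    have meas: "(\<lambda>\<omega>. ennreal (trans_prob \<omega> m x x)) \<in> borel_measurable env_law" for m
    proof -
      have "(\<lambda>\<omega>. ennreal (trans_prob \<omega> m x x)) \<in> borel_measurable env_space"
        by (rule measurable_compose[OF trans_prob_measurable measurable_ennreal])
      then show ?thesis unfolding env_law_def by (simp add: measurable_distr_eq1)
    qed
    have "(\<integral>\<^sup>+\<omega>. (\<Sum>m. ennreal (trans_prob \<omega> m x x)) \<partial>env_law) = (\<Sum>m. ?J m)"
      by (rule nn_integral_suminf[OF meas])
    also have "\<dots> \<le> ennreal C" unfolding suminf_eq_SUP by (intro SUP_least part)
    finally have "(\<integral>\<^sup>+\<omega>. (\<Sum>m. ennreal (trans_prob \<omega> m x x)) \<partial>env_law) \<noteq> \<infinity>"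
      by (metis ennreal_less_top infinity_ennreal_def leD)
    then have "AE \<omega> in env_law. (\<Sum>m. ennreal (trans_prob \<omega> m x x)) \<noteq> \<infinity>"
      by (intro nn_integral_PInf_AE borel_measurable_suminf_order meas)
    then show ?thesis
      by (rule eventually_mono) (auto intro!: summable_suminf_not_top simp: trans_prob_def)
  qed
  then show ?thesis by (simp add: AE_all_countable)
qed

end
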